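(* Assume the model accuracy, preconditioner, regularity, local Lipschitz and quadratic growth conditions given in the context, and assume $\mathcal{X}^*$ is nonempty. Let $\{x_k\}$ be generated by the model-based ispPPA algorithm with stepsizes $\{\alpha_k\}$ and parameters $\{\epsilon_k\}$. Put $\eta=L_\infty^2\overline{\eta}$, $\tau=L_\infty^2\overline{\tau}$, $c_1=\mu_\infty^2\overline{c}_1$. Suppose there exist $\gamma\in\mathbb{R}_+$ and $\overline{\rho}>\eta+\tau$ such that $$\alpha_k=\alpha_0\quad\text{and}\quad\epsilon_k=\gamma\alpha_0^{3/2}\quad\text{for all }k\in\mathbb{Z}_+,\qquad\text{where }\alpha_0\in(0,(\overline{\rho})^{-1}).$$ Set $c_{\tau,\eta}=c_1-\frac{\tau+\eta}2$, $\tilde{c}_1=\frac{\overline{\rho}c_{\tau,\eta}}{\overline{\rho}+\eta}$, $\delta_1=\mathrm{dist}(x_1,\mathcal{X}^* )^2$, and let $s\in(0,2)$ be an arbitrary scalar. If $c_1>\frac{\tau+\eta}2$, then on the event that $\sup_{k\in\mathbb{Z}_+}\|x_k\|_2<\infty$, for all $k\in\mathbb{Z}_+$, $$\mathbb{E}\left[\mathrm{dist}(x_k,\mathcal{X}^* )^2\right]\le(\nu_\infty L_\infty)^2\left[\left(\frac1{1+s\tilde{c}_1\alpha_0}\right)^{k-1}\delta_1+\frac{\tilde{C}(\alpha_0)}{s\tilde{c}_1}\alpha_0\right],$$ where, for $\alpha\in\mathbb{R}_+$, $$\tilde{C}(\alpha)=\rho_{f,m,U}L_F(U)^2+\frac{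(1+(2c_1-\tau)\alpha)\left(2(1+\eta\alpha)+s(2c_1-\tau-\eta)\alpha\right)}{(2-s)(2c_1-\tau-\eta)(1+\eta\alpha)}\gamma^2.$$
   Context: Notation: $\mathbb{Z}_+=\{1,2,\dots\}$, $\mathbb{R}_+=[0,\infty)$, $\mathbb{R}_{++}=(0,\infty)$. For a self-adjoint positive-definite linear map $M$ on $\mathbb{R}^d$: $\|x\|_M^2=\langle x,Mx\rangle$, $\mathrm{dist}_M(x,X)=\inf_{y\in X}\|x-y\|_M$ (subscript omitted when $M=I_d$); for $p:\mathbb{R}^d\to(-\infty,+\infty]$ proper closed and $\alpha>0$, $\mathrm{prox}^M_{\alpha p}(x)=\arg\min_y\{p(y)+\frac1{2\alpha}\|y-x\|_M^2\}$. A proper closed $p$ is $\overline{\tau}$-weakly convex if $p+\frac{\overline{\tau}}2\|\cdot\|_2^2$ is convex; $\partial p$ is the regular (Fréchet) subdifferential. (The scalar $s\in(0,2)$ in the claim is unrelated to the sample variable $s\in\mathcal{S}$ below.) Problem: minimize $\phi(x)=F(x)+r(x)$ over $\mathbb{R}^d$, $F(x)=\mathbb{E}_{s\sim P}[f(x;s)]$, $P$ a distribution on a sample space $\mathcal{S}$, $r:\mathbb{R}^d\to(-\infty,+\infty]$. $\phi^*=\inf\phi$, $\mathcal{X}^*=\arg\min\phi$. Model functions: $V$ is an open convex set containing $\mathrm{dom}(r)$, and $(x,y,s)\mapsto f_x(y;s)$ is a measurable function on $V\times V\times\mathcal{S}$; $\varphi_x(y;s)=f_x(y;s)+r(y)$,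 with value $+\infty$ for $y\notin\mathrm{dom}(r)$. For a minibatch $S_k^{1:m}=\{S_k^i\}_{i=1}^m$: $\overline{f}_{x_k}(x;S_k^{1:m})=\frac1m\sum_{i=1}^m f_{x_k}(x;S_k^i)$, $\overline{\varphi}_{x_k}(x;S_k^{1:m})=\overline{f}_{x_k}(x;S_k^{1:m})+r(x)$. Model-based ispPPA algorithm: given $x_1$, stepsizes $\alpha_k>0$, accuracies $\epsilon_k\ge0$, minibatch size $m$ and self-adjoint positive-definite linear maps (preconditioners) $M_k$, which may depend on the sampled minibatches, at iteration $k=1,2,\dots$ draw $S_k^1,\dots,S_k^m$ i.i.d. from $P$ and let $x_{k+1}$ be an approximate minimizer of $\Phi_k(x)=\overline{\varphi}_{x_k}(x;S_k^{1:m})+\frac1{2\alpha_k}\|x-x_k\|_{M_k}^2$ satisfying one of: (a) $\|x_{k+1}-\tilde{x}_{k+1}\|_{M_k}\le\epsilon_k$, where $\tilde{x}_{k+1}=\mathrm{prox}^{M_k}_{\alpha_k\overline{\varphi}_{x_k}(\cdot;S_k^{1:m})}(x_k)$; (b) $\Phi_k(x_{k+1})-\min\Phi_k\le\frac{1-\tau\alpha_k}{2\alpha_k}\epsilon_k^2$; (c) $\mathrm{dist}_{M_k^{-1}}(0,\partial\Phi_k(x_{k+1}))\le\frac{1-\tau\alpha_k}{\alpha_k}\epsilon_k$; here $\tau=L_\infty^2\overline{\tau}$. $\mathcal{F}_k=\sigma(S_1^{1:m},\dots,S_k^{1:m})$ and $\mathbb{E}_k[\cdot]=\mathbb{E}[\cdot\mid\mathcal{F}_{k-1}]$.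 Model accuracy condition: there is a scalar $\overline{\eta}\in\mathbb{R}$ such that for $P$-almost all $s$, $f_x(x;s)=f(x;s)$ and $|f_x(y;s)-f(y;s)|\le\frac{\overline{\eta}}2\|y-x\|_2^2$ for all $x,y\in V$. Preconditioner condition: there are $\mu_\infty\in(0,1]$, $L_\infty\in[1,\infty)$ such that for every $k\in\mathbb{Z}_+$, $\mu_k\|x\|_{M_k}\le\|x\|_2\le L_k\|x\|_{M_k}$ for all $x\in\mathbb{R}^d$, with $\mu_k\in[\mu_\infty,\infty)$, $L_k\in(0,L_\infty]$; and $\rho_k^{-2}\le\mathbb{E}_k\big[\|x\|_{M_k}^2/\|x\|_{M_{k-1}}^2\big]\le\rho_k^2$ for all $x\ne0$, with $\rho_k\in[1,\infty)$ and $\nu_k=\prod_{i=0}^{k-1}\rho_i\nearrow\nu_\infty=\prod_{i=0}^\infty\rho_i<\infty$; by definition $M_0=I_d$, $\mu_0=L_0=\rho_0=1$. Regularity condition: $F:\mathbb{R}^d\to\mathbb{R}$ is locally Lipschitz, $r$ is proper closed, and for $P$-almost all $s$, $f(\cdot;s):\mathbb{R}^d\to(-\infty,+\infty]$ is proper closed with $\mathrm{dom}(f(\cdot;s))\supset\mathrm{dom}(r)$, and $\varphi_x(\cdot;s)$ is $\overline{\tau}$-weakly convex for all $x\in V$, where $\overline{\tau}\in\mathbb{R}_+$ is a constant. Local Lipschitz condition: for any bounded subset $U\subset V$ there is a measurable $\overline{L}_{f,U}:\mathcal{S}\to\mathbb{R}_+$ with $\sqrt{\mathbb{E}_{s\sim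 P}[\overline{L}_{f,U}(s)^2]}\le\overline{L}_F(U)$ for some constant $\overline{L}_F(U)\in\mathbb{R}_+$ depending on $U$ such that for $P$-almost all $s$, $|f_x(x;s)-f_x(y;s)|\le\overline{L}_{f,U}(s)\|x-y\|_2$ for all $x,y\in U$. Quadratic growth condition: there is $\overline{c}_1>0$ with $\phi(x)\ge\phi^*+\overline{c}_1\,\mathrm{dist}(x,\mathcal{X}^* )^2$ for all $x\in\mathbb{R}^d$. The set $U$ in the constants of the claim: on the event that $\sup_{k\in\mathbb{Z}_+}\|x_k\|_2<\infty$, $U$ denotes a bounded open convex subset of $V$ that contains both $\{x_k\}$ and $\{\tilde{x}_k\}$. Constants: $L_{f,U}(s)=L_\infty\overline{L}_{f,U}(s)$, $L_F(U)=L_\infty\overline{L}_F(U)$, and, assuming without loss of generality $\mathbb{E}_{s\sim P}[L_{f,U}(s)^2]>0$, $\omega_{f,U}=1-\mathrm{Var}(L_{f,U}(s))/\mathbb{E}_{s\sim P}[L_{f,U}(s)^2]$, $\rho_{f,m,U}=\Big(\sqrt{\tfrac{1+(m-1)\omega_{f,U}}{m}}+1\Big)^2$.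
   Formalization: "On the event that sup‖x_k‖<∞" is read as: this event has probability one, and U is one fixed (non-random) bounded open convex subset of V containing all x_k and exact proximal points almost surely; otherwise the bound on the expectation would depend on the outcome. *)

theory Defs
  imports "HOL-Probability.Probability"
begin

section \<open>Extended-real-valued functions and preconditioned norms\<close>

text \<open>Functions into \<open>(-\<infinity>,+\<infinity>]\<close> are rendered as \<^typ>\<open>ereal\<close>-valued functions that never
  take the value \<open>-\<infinity>\<close>; \<open>closed\<close> means that the epigraph is closed.\<close>

definition proper_closed :: "('a::euclidean_space \<Rightarrow> ereal) \<Rightarrow> bool" where
  "proper_closed p \<longleftrightarrow>
     (\<forall>x. p x \<noteq> -\<infinity>) \<and> (\<exists>x. p x \<noteq> \<infinity>) \<and> closed {(x, c::real). p x \<le> ereal c}"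

definition edom :: "('a::euclidean_space \<Rightarrow> ereal) \<Rightarrow> 'a set" where
  "edom p = {x. p x < \<infinity>}"

definition ext_convex :: "('a::euclidean_space \<Rightarrow> ereal) \<Rightarrow> bool" where
  "ext_convex p \<longleftrightarrow>
     (\<forall>x y. \<forall>t\<in>{0<..<1::real}.
        p ((1 - t) *\<^sub>R x + t *\<^sub>R y) \<le> ereal (1 - t) * p x + ereal t * p y)"

definition weakly_convex :: "real \<Rightarrow> ('a::euclidean_space \<Rightarrow> ereal) \<Rightarrow> bool" where
  "weakly_convex t p \<longleftrightarrow>
     proper_closed p \<and> ext_convex (\<lambda>x. p x + ereal (t / 2 * (norm x)\<^sup>2))"

definition pos_def_map :: "('a::euclidean_space \<Rightarrow> 'a) \<Rightarrow> bool" where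
  "pos_def_map M \<longleftrightarrow>
     linear M \<and> (\<forall>x y. inner (M x) y = inner x (M y)) \<and> (\<forall>x. x \<noteq> 0 \<longrightarrow> 0 < inner x (M x))"

definition normM :: "('a::euclidean_space \<Rightarrow> 'a) \<Rightarrow> 'a \<Rightarrow> real" where
  "normM M x = sqrt (inner x (M x))"

text \<open>Extended-real-valued, so that the distance to the empty set is \<open>+\<infinity>\<close> (the library's
  \<^const>\<open>infdist\<close> is 0 there). This matters for stationarity measures, where the
  subdifferential may be empty.\<close>

definition distM :: "('a::euclidean_space \<Rightarrow> 'a) \<Rightarrow> 'a \<Rightarrow> 'a set \<Rightarrow> ereal" where
  "distM M x X = (INF y\<in>X. ereal (normM M (x - y)))"

definition frechet_subdiff :: "('a::euclidean_space \<Rightarrow> ereal) \<Rightarrow> 'a \<Rightarrow> 'a set" where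
  "frechet_subdiff p x =
     {v. \<bar>p x\<bar> \<noteq> \<infinity> \<and>
         0 \<le> Liminf (at x) (\<lambda>y. (p y - p x - ereal (inner v (y - x))) / ereal (norm (y - x)))}"

definition prox_objective ::
  "('a::euclidean_space \<Rightarrow> 'a) \<Rightarrow> real \<Rightarrow> ('a \<Rightarrow> ereal) \<Rightarrow> 'a \<Rightarrow> 'a \<Rightarrow> ereal" where
  "prox_objective M a p x y = p y + ereal (1 / (2 * a) * (normM M (y - x))\<^sup>2)"

definition prox :: "('a::euclidean_space \<Rightarrow> 'a) \<Rightarrow> real \<Rightarrow> ('a \<Rightarrow> ereal) \<Rightarrow> 'a \<Rightarrow> 'a" where
  "prox M a p x = arg_min (prox_objective M a p x) (\<lambda>_. True)"

section \<open>The stochastic problem and its models\<close>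

text \<open>\<open>f x s\<close> is \<open>f(x;s)\<close>; \<open>fm x y s\<close> is the model \<open>f\<^sub>x(y;s)\<close>, whose values are only used for
  \<open>x, y \<in> V\<close>. The sum \<open>ereal (fm x y s) + r y\<close> is \<open>+\<infinity>\<close> for every
  \<open>y\<close> with \<open>r y = \<infinity>\<close>, whatever the junk value of \<open>fm x y s\<close>.\<close>

definition expected_loss :: "'s measure \<Rightarrow> ('a::euclidean_space \<Rightarrow> 's \<Rightarrow> ereal) \<Rightarrow> 'a \<Rightarrow> real" where
  "expected_loss P f x = (\<integral>s. real_of_ereal (f x s) \<partial>P)"

definition objective ::
  "'s measure \<Rightarrow> ('a::euclidean_space \<Rightarrow> 's \<Rightarrow> ereal) \<Rightarrow> ('a \<Rightarrow> ereal) \<Rightarrow> 'a \<Rightarrow> ereal" where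
  "objective P f r x = ereal (expected_loss P f x) + r x"

definition argmin_set :: "('a \<Rightarrow> ereal) \<Rightarrow> 'a set" where
  "argmin_set p = {x. is_arg_min p (\<lambda>_. True) x}"

definition model_functions ::
  "'s measure \<Rightarrow> ('a::euclidean_space \<Rightarrow> ereal) \<Rightarrow> 'a set \<Rightarrow> ('a \<Rightarrow> 'a \<Rightarrow> 's \<Rightarrow> real) \<Rightarrow> bool" where
  "model_functions P r V fm \<longleftrightarrow>
     open V \<and> convex V \<and> edom r \<subseteq> V \<and>
     (\<lambda>(x, y, s). fm x y s)
       \<in> borel_measurable (restrict_space borel V \<Otimes>\<^sub>M (restrict_space borel V \<Otimes>\<^sub>M P))"

definition model_phi ::
  "('a::euclidean_space \<Rightarrow> 'a \<Rightarrow> 's \<Rightarrow> real) \<Rightarrow> ('a \<Rightarrow> ereal) \<Rightarrow> 'a \<Rightarrow> 's \<Rightarrow> 'a \<Rightarrow> ereal" where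
  "model_phi fm r x s y = ereal (fm x y s) + r y"

definition minibatch_phi ::
  "('a::euclidean_space \<Rightarrow> 'a \<Rightarrow> 's \<Rightarrow> real) \<Rightarrow> ('a \<Rightarrow> ereal) \<Rightarrow> nat \<Rightarrow> 'a \<Rightarrow> (nat \<Rightarrow> 's) \<Rightarrow> 'a \<Rightarrow> ereal" where
  "minibatch_phi fm r m x ss y = ereal ((\<Sum>i=1..m. fm x y (ss i)) / real m) + r y"

definition model_accuracy ::
  "'s measure \<Rightarrow> ('a::euclidean_space \<Rightarrow> 's \<Rightarrow> ereal) \<Rightarrow> 'a set \<Rightarrow> ('a \<Rightarrow> 'a \<Rightarrow> 's \<Rightarrow> real) \<Rightarrow> real \<Rightarrow> bool" where
  "model_accuracy P f V fm etab \<longleftrightarrow>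
     (AE s in P. \<forall>x\<in>V. \<forall>y\<in>V. ereal (fm x x s) = f x s \<and>
        \<bar>ereal (fm x y s) - f y s\<bar> \<le> ereal (etab / 2 * (norm (y - x))\<^sup>2))"

text \<open>The first conjunct says that \<open>F(x) = E[f(x;s)]\<close> is a well-defined real number for every
  \<open>x\<close>, i.e. \<open>F\<close> maps into the reals.\<close>

definition regularity ::
  "'s measure \<Rightarrow> ('a::euclidean_space \<Rightarrow> 's \<Rightarrow> ereal) \<Rightarrow> ('a \<Rightarrow> ereal) \<Rightarrow> 'a set \<Rightarrow>
   ('a \<Rightarrow> 'a \<Rightarrow> 's \<Rightarrow> real) \<Rightarrow> real \<Rightarrow> bool" where
  "regularity P f r V fm taub \<longleftrightarrow>
     (\<forall>x. (AE s in P. \<bar>f x s\<bar> \<noteq> \<infinity>) \<and> integrable P (\<lambda>s. real_of_ereal (f x s))) \<and>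
     (\<forall>x. \<exists>e>0. \<exists>L. L-lipschitz_on (ball x e) (expected_loss P f)) \<and>
     proper_closed r \<and>
     (AE s in P. proper_closed (\<lambda>x. f x s) \<and> edom r \<subseteq> edom (\<lambda>x. f x s) \<and>
        (\<forall>x\<in>V. weakly_convex taub (model_phi fm r x s))) \<and>
     0 \<le> taub"

definition local_lipschitz_condition ::
  "'s measure \<Rightarrow> ('a::euclidean_space) set \<Rightarrow> ('a \<Rightarrow> 'a \<Rightarrow> 's \<Rightarrow> real) \<Rightarrow>
   ('a set \<Rightarrow> 's \<Rightarrow> real) \<Rightarrow> ('a set \<Rightarrow> real) \<Rightarrow> bool" where
  "local_lipschitz_condition P V fm Lfb LFb \<longleftrightarrow>
     (\<forall>U. bounded U \<and> U \<subseteq> V \<longrightarrow>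
        Lfb U \<in> borel_measurable P \<and> (\<forall>s\<in>space P. 0 \<le> Lfb U s) \<and>
        integrable P (\<lambda>s. (Lfb U s)\<^sup>2) \<and> 0 \<le> LFb U \<and>
        sqrt (\<integral>s. (Lfb U s)\<^sup>2 \<partial>P) \<le> LFb U \<and>
        (AE s in P. \<forall>x\<in>U. \<forall>y\<in>U. \<bar>fm x x s - fm x y s\<bar> \<le> Lfb U s * norm (x - y)))"

text \<open>\<^const>\<open>infdist\<close> is used for the unpreconditioned distance to a nonempty set.\<close>

definition quadratic_growth :: "('a::euclidean_space \<Rightarrow> ereal) \<Rightarrow> real \<Rightarrow> bool" where
  "quadratic_growth p c \<longleftrightarrow>
     0 < c \<and> (\<forall>x. (INF y. p y) + ereal (c * (infdist x (argmin_set p))\<^sup>2) \<le> p x)"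

section \<open>The algorithm\<close>

text \<open>\<open>S k i\<close> is the \<open>i\<close>-th sample (\<open>1 \<le> i \<le> m\<close>) of iteration \<open>k \<ge> 1\<close>; the sigma-algebra below
  is \<open>\<F>\<^sub>k\<close>, trivial for \<open>k = 0\<close>.\<close>

definition sample_sigma ::
  "'w measure \<Rightarrow> 's measure \<Rightarrow> nat \<Rightarrow> (nat \<Rightarrow> nat \<Rightarrow> 'w \<Rightarrow> 's) \<Rightarrow> nat \<Rightarrow> 'w measure" where
  "sample_sigma W P m S k =
     sigma (space W) {S j i -` A \<inter> space W | j i A. j \<in> {1..k} \<and> i \<in> {1..m} \<and> A \<in> sets P}"

definition iid_samples ::
  "'w measure \<Rightarrow> 's measure \<Rightarrow> nat \<Rightarrow> (nat \<Rightarrow> nat \<Rightarrow> 'w \<Rightarrow> 's) \<Rightarrow> bool" where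
  "iid_samples W P m S \<longleftrightarrow>
     prob_space.indep_vars W (\<lambda>_. P) (\<lambda>(k, i). S k i) ({1..} \<times> {1..m}) \<and>
     (\<forall>k\<ge>1. \<forall>i\<in>{1..m}. distr W P (S k i) = P)"

text \<open>The three inexactness criteria for the subproblem \<open>min \<Phi>\<close> with
  \<open>\<Phi> = prox_objective M a p x\<close>, parameter \<open>t = \<tau>\<close> and accuracy \<open>e\<close>.\<close>

definition inexact_prox ::
  "real \<Rightarrow> ('a::euclidean_space \<Rightarrow> 'a) \<Rightarrow> real \<Rightarrow> real \<Rightarrow> ('a \<Rightarrow> ereal) \<Rightarrow> 'a \<Rightarrow> 'a \<Rightarrow> bool" where
  "inexact_prox t M a e p x x' \<longleftrightarrow>
     normM M (x' - prox M a p x) \<le> e \<or>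
     prox_objective M a p x x' - (INF y. prox_objective M a p x y)
       \<le> ereal ((1 - t * a) / (2 * a) * e\<^sup>2) \<or>
     distM (inv M) 0 (frechet_subdiff (prox_objective M a p x) x')
       \<le> ereal ((1 - t * a) / a * e)"

text \<open>\<open>x k \<omega>\<close> is the iterate \<open>x\<^sub>k\<close> (\<open>k \<ge> 1\<close>). Note the shift: \<open>exact_step \<dots> k \<omega>\<close> is the exact
  proximal point computed from \<open>x\<^sub>k\<close>, i.e. the exact counterpart of \<open>x\<^sub>k\<^sub>+\<^sub>1\<close>.\<close>

definition exact_step ::
  "('a::euclidean_space \<Rightarrow> 'a \<Rightarrow> 's \<Rightarrow> real) \<Rightarrow> ('a \<Rightarrow> ereal) \<Rightarrow> nat \<Rightarrow> (nat \<Rightarrow> real) \<Rightarrow>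
   (nat \<Rightarrow> nat \<Rightarrow> 'w \<Rightarrow> 's) \<Rightarrow> (nat \<Rightarrow> 'w \<Rightarrow> 'a \<Rightarrow> 'a) \<Rightarrow> (nat \<Rightarrow> 'w \<Rightarrow> 'a) \<Rightarrow> nat \<Rightarrow> 'w \<Rightarrow> 'a" where
  "exact_step fm r m alpha S M x k \<omega> =
     prox (M k \<omega>) (alpha k) (minibatch_phi fm r m (x k \<omega>) (\<lambda>i. S k i \<omega>)) (x k \<omega>)"

definition ispPPA ::
  "'w measure \<Rightarrow> 's measure \<Rightarrow> ('a::euclidean_space \<Rightarrow> 'a \<Rightarrow> 's \<Rightarrow> real) \<Rightarrow> ('a \<Rightarrow> ereal) \<Rightarrow> nat \<Rightarrow>
   real \<Rightarrow> (nat \<Rightarrow> real) \<Rightarrow> (nat \<Rightarrow> real) \<Rightarrow> (nat \<Rightarrow> nat \<Rightarrow> 'w \<Rightarrow> 's) \<Rightarrow>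
   (nat \<Rightarrow> 'w \<Rightarrow> 'a \<Rightarrow> 'a) \<Rightarrow> 'a \<Rightarrow> (nat \<Rightarrow> 'w \<Rightarrow> 'a) \<Rightarrow> bool" where
  "ispPPA W P fm r m tau alpha eps S M x1 x \<longleftrightarrow>
     1 \<le> m \<and> iid_samples W P m S \<and> (\<forall>\<omega>\<in>space W. x 1 \<omega> = x1) \<and>
     (\<forall>k\<ge>1.
        0 < alpha k \<and> 0 \<le> eps k \<and>
        (\<forall>v. (\<lambda>\<omega>. M k \<omega> v) \<in> borel_measurable (sample_sigma W P m S k)) \<and>
        x (Suc k) \<in> borel_measurable (sample_sigma W P m S k) \<and>
        (AE \<omega> in W. pos_def_map (M k \<omega>) \<and>
           inexact_prox tau (M k \<omega>) (alpha k) (eps k)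
             (minibatch_phi fm r m (x k \<omega>) (\<lambda>i. S k i \<omega>)) (x k \<omega>) (x (Suc k) \<omega>)))"

definition preconditioner_condition ::
  "'w measure \<Rightarrow> 's measure \<Rightarrow> nat \<Rightarrow> (nat \<Rightarrow> nat \<Rightarrow> 'w \<Rightarrow> 's) \<Rightarrow>
   (nat \<Rightarrow> 'w \<Rightarrow> 'a::euclidean_space \<Rightarrow> 'a) \<Rightarrow> (nat \<Rightarrow> real) \<Rightarrow> (nat \<Rightarrow> real) \<Rightarrow> (nat \<Rightarrow> real) \<Rightarrow>
   real \<Rightarrow> real \<Rightarrow> real \<Rightarrow> bool" where
  "preconditioner_condition W P m S M mu L rho mu_inf L_inf nu_inf \<longleftrightarrow>
     0 < mu_inf \<and> mu_inf \<le> 1 \<and> 1 \<le> L_inf \<and>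
     (\<forall>\<omega>\<in>space W. \<forall>v. M 0 \<omega> v = v) \<and> mu 0 = 1 \<and> L 0 = 1 \<and> rho 0 = 1 \<and>
     (\<forall>k\<ge>1.
        mu_inf \<le> mu k \<and> 0 < L k \<and> L k \<le> L_inf \<and> 1 \<le> rho k \<and>
        (AE \<omega> in W. \<forall>v. mu k * normM (M k \<omega>) v \<le> norm v \<and> norm v \<le> L k * normM (M k \<omega>) v) \<and>
        (\<forall>v. v \<noteq> 0 \<longrightarrow>
           (AE \<omega> in W.
              1 / (rho k)\<^sup>2
                \<le> real_cond_exp W (sample_sigma W P m S (k - 1))
                    (\<lambda>\<omega>. (normM (M k \<omega>) v)\<^sup>2 / (normM (M (k - 1) \<omega>) v)\<^sup>2) \<omega> \<and>
              real_cond_exp W (sample_sigma W P m S (k - 1))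
                    (\<lambda>\<omega>. (normM (M k \<omega>) v)\<^sup>2 / (normM (M (k - 1) \<omega>) v)\<^sup>2) \<omega>
                \<le> (rho k)\<^sup>2))) \<and>
     (\<lambda>k. \<Prod>i<k. rho i) \<longlonglongrightarrow> nu_inf"

section \<open>Constants of the complexity bound\<close>

definition omega_const :: "'s measure \<Rightarrow> ('s \<Rightarrow> real) \<Rightarrow> real" where
  "omega_const P Lf = 1 - prob_space.variance P Lf / prob_space.expectation P (\<lambda>s. (Lf s)\<^sup>2)"

definition rho_const :: "'s measure \<Rightarrow> nat \<Rightarrow> ('s \<Rightarrow> real) \<Rightarrow> real" where
  "rho_const P m Lf = (sqrt ((1 + (real m - 1) * omega_const P Lf) / real m) + 1)\<^sup>2"

definition C_tilde ::
  "real \<Rightarrow> real \<Rightarrow> real \<Rightarrow> real \<Rightarrow> real \<Rightarrow> real \<Rightarrow> real \<Rightarrow> real \<Rightarrow> real" where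
  "C_tilde rhofm LF c1 tau eta s gam a =
     rhofm * LF\<^sup>2 +
     ((1 + (2 * c1 - tau) * a) * (2 * (1 + eta * a) + s * (2 * c1 - tau - eta) * a)) /
       ((2 - s) * (2 * c1 - tau - eta) * (1 + eta * a)) * gam\<^sup>2"

end

theory Submission
  imports Defs
begin

text \<open>The proof follows the squared distance to the solution set, measured at iteration \<open>k\<close> in the
norm of \<open>M\<^sub>k\<^sub>-\<^sub>1\<close>, and shows that its expectation contracts up to an additive term of order
\<open>\<alpha>\<^sub>0\<^sup>2\<close>.

One step is deterministic convex analysis. In the norm of \<open>M\<^sub>k\<close> the subproblem objective is
strongly convex with modulus \<open>1/\<alpha> - \<tau>\<close>: the proximal term contributes \<open>1/\<alpha>\<close> and weak
convexity costs at most \<open>\<tau>\<close>. Hence it has an exact minimizer \<open>z\<close>, each of the three inexactness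
criteria places the new iterate within \<open>\<epsilon>\<close> of \<open>z\<close> (\<open>inexact_prox_distance\<close>), and its
value at a solution \<open>q\<close> exceeds its value at \<open>z\<close> by at least the strong convexity gap. Model accuracy turns the model value
at \<open>q\<close> into \<open>f(q)\<close>, the Lipschitz constants turn the model value at \<open>z\<close> into \<open>F(z)\<close>, and quadratic
growth turns \<open>\<phi>(z) - \<phi>(q)\<close> into a distance. What remains (\<open>exact_step_inequality\<close>) is a sampling
error that depends only on \<open>q\<close>, the old iterate and the new samples.

The second ingredient is conditioning on the past samples. A function of the past and of an
independent sample is averaged by integrating the sample out
(\<open>cond_exp_independent_argument\<close>); this makes the linear part of the sampling error vanish and
bounds its quadratic part by \<open>\<rho> L\<^sub>F\<^sup>2\<close>. The preconditioner hypothesis, stated for fixed vectors,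
extends to vectors that depend on the past, because the conditional expectation of a quadratic form
is a quadratic form (\<open>cond_exp_preconditioner_change\<close>). All conditional estimates are made for a
fixed solution \<open>q\<close> out of a countable dense subset of the solution set, and the infimum over \<open>q\<close>
is taken afterwards. No measurable choice of a nearest solution is therefore involved, and the exact
proximal point, whose measurability is unclear, occurs only in inequalities between numbers.

The inexactness is absorbed by Young's inequality, whose weight is tuned in \<open>step_constants\<close> so
that the contraction factor is at most \<open>1/(1 + s c \<alpha>)\<close>. The factors \<open>\<rho>\<^sub>k\<close> accumulate to at
most \<open>\<nu>\<close> (\<open>discounted_recursion_bound\<close>), and a last change of norm contributes \<open>L\<^sub>\<infinity>\<close>.\<close>

section \<open>Preconditioned norms\<close>

lemma normM_nonneg: "0 \<le> normM M v" if "pos_def_map M"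
proof -
  have "0 \<le> inner v (M v)" using that unfolding pos_def_map_def
    by (cases "v = 0") (auto intro: less_imp_le)
  then show ?thesis by (simp add: normM_def)
qed

lemma normM_square: "(normM M v)\<^sup>2 = inner v (M v)" if "pos_def_map M"
proof -
  have "0 \<le> inner v (M v)" using that unfolding pos_def_map_def
    by (cases "v = 0") (auto intro: less_imp_le)
  then show ?thesis by (simp add: normM_def)
qed

lemma normM_minus_commute: "normM M (u - v) = normM M (v - u)" if "pos_def_map M"
proof -
  have "linear M" using that by (simp add: pos_def_map_def)
  then have "inner (u - v) (M (u - v)) = inner (v - u) (M (v - u))"
    by (simp add: linear_diff inner_diff_left inner_diff_right)
  then show ?thesis by (simp add: normM_def)
qed

lemma normM_square_combination:
  assumes "pos_def_map M"
  shows "(normM M (a *\<^sub>R u + b *\<^sub>R v))\<^sup>2 =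
    a\<^sup>2 * (normM M u)\<^sup>2 + 2 * a * b * inner u (M v) + b\<^sup>2 * (normM M v)\<^sup>2"
proof -
  have lin: "linear M" and sym: "inner v (M u) = inner u (M v)"
    using assms by (auto simp: pos_def_map_def) (metis inner_commute)
  show ?thesis unfolding normM_square[OF assms]
    by (simp add: linear_add[OF lin] linear_scale[OF lin] inner_add_left inner_add_right sym
        power2_eq_square algebra_simps)
qed

lemma normM_square_segment:
  assumes "pos_def_map M"
  shows "(normM M ((1 - t) *\<^sub>R u + t *\<^sub>R v))\<^sup>2 =
    (1 - t) * (normM M u)\<^sup>2 + t * (normM M v)\<^sup>2 - t * (1 - t) * (normM M (u - v))\<^sup>2"
proof -
  have "(normM M (u - v))\<^sup>2 = (normM M u)\<^sup>2 - 2 * inner u (M v) + (normM M v)\<^sup>2"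
    using normM_square_combination[OF assms, of 1 u "-1" v] by simp
  then show ?thesis
    unfolding normM_square_combination[OF assms] by (simp only:) (simp add: power2_eq_square algebra_simps)
qed

text \<open>Young's inequality, obtained from the nonnegativity of the square of
\<open>\<surd>\<theta> u - v / \<surd>\<theta>\<close>.\<close>

lemma normM_square_young:
  assumes M: "pos_def_map M" and th: "0 < \<theta>"
  shows "(normM M (u + v))\<^sup>2 \<le> (1 + \<theta>) * (normM M u)\<^sup>2 + (1 + 1 / \<theta>) * (normM M v)\<^sup>2"
proof -
  have "0 \<le> (normM M (sqrt \<theta> *\<^sub>R u + (- 1 / sqrt \<theta>) *\<^sub>R v))\<^sup>2" by simp
  also have "\<dots> = \<theta> * (normM M u)\<^sup>2 - 2 * inner u (M v) + (1 / \<theta>) * (normM M v)\<^sup>2"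
    using th by (subst normM_square_combination[OF M]) (simp add: power_divide)
  finally show ?thesis
    using normM_square_combination[OF M, of 1 u 1 v] by (simp add: algebra_simps)
qed

lemma pos_def_map_id: "pos_def_map (\<lambda>v. v)"
  by (auto simp: pos_def_map_def linear_id[unfolded id_def])

lemma normM_id: "normM (\<lambda>v. v) = norm"
  by (auto simp: normM_def norm_eq_sqrt_inner)

section \<open>Minimizers of strongly convex functions\<close>

text \<open>Lower semicontinuity phrased by neighbourhoods, which passes to sums more easily than closedness
of the epigraph.\<close>

definition lsc :: "('a::topological_space \<Rightarrow> ereal) \<Rightarrow> bool" where
  "lsc p \<longleftrightarrow> (\<forall>y c. ereal c < p y \<longrightarrow> (\<forall>\<^sub>F z in nhds y. ereal c < p z))"

lemma proper_closed_lsc: "lsc p" if "proper_closed p"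
  unfolding lsc_def
proof (intro allI impI)
  fix y c assume c: "ereal c < p y"
  have "open (- {(x, c::real). p x \<le> ereal c})"
    using that by (auto simp: proper_closed_def)
  moreover have "(y, c) \<in> - {(x, c::real). p x \<le> ereal c}" using c by auto
  ultimately obtain A B where "open A" "open B" "(y, c) \<in> A \<times> B"
      "A \<times> B \<subseteq> - {(x, c::real). p x \<le> ereal c}"
    by (rule open_prod_elim)
  then show "\<forall>\<^sub>F z in nhds y. ereal c < p z"
    unfolding eventually_nhds by (intro exI[of _ A]) (force simp: not_le)
qed

text \<open>If no point of \<open>K\<close> were minimal, every point would have a neighbourhood on which \<open>p\<close> exceeds
some value \<open>c x\<close> that is still undercut elsewhere. Among the finitely many values of a finite subcover
the smallest one is undercut at a point that lies in one of the neighbourhoods, which is impossible.\<close>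

lemma lsc_attains_inf:
  assumes p: "lsc p" and K: "compact K" "K \<noteq> {}"
  shows "\<exists>x\<in>K. \<forall>y\<in>K. p x \<le> p y"
proof (rule ccontr)
  assume "\<not> ?thesis"
  then have "\<forall>x\<in>K. \<exists>y\<in>K. p y < p x" by (auto simp: not_le)
  then have "\<forall>x\<in>K. \<exists>y c. y \<in> K \<and> p y < ereal c \<and> ereal c < p x"
    by (meson ereal_dense2)
  then obtain y c where yc: "\<And>x. x \<in> K \<Longrightarrow> y x \<in> K \<and> p (y x) < ereal (c x) \<and> ereal (c x) < p x"
    by metis
  have "\<forall>x\<in>K. \<exists>A. open A \<and> x \<in> A \<and> (\<forall>z\<in>A. ereal (c x) < p z)"
    using p yc unfolding lsc_def eventually_nhds by meson
  then obtain A where A: "\<And>x. x \<in> K \<Longrightarrow> open (A x) \<and> x \<in> A x \<and> (\<forall>z\<in>A x. ereal (c x) < p z)"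
    by metis
  obtain T where T: "T \<subseteq> K" "finite T" "K \<subseteq> (\<Union>x\<in>T. A x)"
    by (rule compactE_image[OF K(1), of K A]) (use A in auto)
  then have "T \<noteq> {}" using K by auto
  obtain x where x: "x \<in> T" "\<And>z. z \<in> T \<Longrightarrow> c x \<le> c z"
    using ex_min_if_finite[of "c ` T"] T(2) \<open>T \<noteq> {}\<close>
    by (metis (no_types, lifting) arg_min_if_finite(1) arg_min_least)
  obtain z where z: "z \<in> T" "y x \<in> A z" using T yc x by blast
  have "ereal (c z) < p (y x)" using A z T by auto
  also have "\<dots> < ereal (c x)" using yc x T by auto
  finally show False using x(2)[OF z(1)] by simp
qed

text \<open>For functions without the value \<open>-\<infinity>\<close> the usual inequality is trivial unless \<open>\<Phi>\<close> is finite at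
both end points; stating it there avoids arithmetic with infinite values.\<close>

definition strongly_convex_wrt :: "('a::euclidean_space \<Rightarrow> 'a) \<Rightarrow> real \<Rightarrow> ('a \<Rightarrow> ereal) \<Rightarrow> bool" where
  "strongly_convex_wrt M \<kappa> \<Phi> \<longleftrightarrow>
     (\<forall>x y a b t. \<Phi> x = ereal a \<longrightarrow> \<Phi> y = ereal b \<longrightarrow> 0 < t \<longrightarrow> t < 1 \<longrightarrow>
        \<Phi> ((1 - t) *\<^sub>R x + t *\<^sub>R y)
          \<le> ereal ((1 - t) * a + t * b - \<kappa> / 2 * (t * (1 - t)) * (normM M (x - y))\<^sup>2))"

text \<open>Coercivity comes for free: \<open>\<Phi>\<close> is bounded below on the unit ball around a point \<open>x0\<close> of its
domain, and along a ray from \<open>x0\<close> strong convexity makes it grow quadratically beyond that ball.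
So a minimizer over a sufficiently large ball is a global one.\<close>

lemma strongly_convex_has_minimizer:
  fixes \<Phi> :: "'a::euclidean_space \<Rightarrow> ereal"
  assumes M: "pos_def_map M" and Lb: "\<And>v. norm v \<le> B * normM M v"
    and lsc: "lsc \<Phi>" and sc: "strongly_convex_wrt M \<kappa> \<Phi>" and k: "0 < \<kappa>"
    and ninf: "\<And>x. \<Phi> x \<noteq> -\<infinity>" and fin: "\<Phi> x0 = ereal a"
  shows "\<exists>x. \<forall>y. \<Phi> x \<le> \<Phi> y"
proof -
  obtain w where w: "w \<in> cball x0 1" "\<And>y. y \<in> cball x0 1 \<Longrightarrow> \<Phi> w \<le> \<Phi> y"
    using lsc_attains_inf[OF lsc, of "cball x0 1"] by auto
  have "\<Phi> w \<le> ereal a" using w(2)[of x0] fin by simp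
  then obtain m0 where m0: "\<Phi> w = ereal m0" "m0 \<le> a" using ninf[of w] by (cases "\<Phi> w") auto
  define B' where "B' = max B 1"
  have B': "B' \<ge> 1" "norm v \<le> B' * normM M v" for v
    using Lb[of v] normM_nonneg[OF M, of v]
    by (auto simp: B'_def intro: order_trans[OF Lb mult_right_mono])
  \<comment> \<open>beyond this radius the quadratic growth exceeds the possible decrease from \<open>a\<close> to \<open>m0\<close>\<close>
  define R where "R = 2 + 2 * B'\<^sup>2 * (a - m0) / \<kappa>"
  have R: "R \<ge> 2" using k m0(2) by (auto simp: R_def)
  have far: "ereal a < \<Phi> y" if y: "R \<le> norm (y - x0)" for y
  proof (rule ccontr)
    assume "\<not> ?thesis"
    then obtain b where b: "\<Phi> y = ereal b" "b \<le> a" using ninf[of y] by (cases "\<Phi> y") auto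
    define d where "d = norm (y - x0)"
    have d: "d \<ge> 2" "R \<le> d" using y R by (auto simp: d_def)
    \<comment> \<open>the point \<open>z\<close> at this parameter lies on the unit sphere around \<open>x0\<close>, where \<open>\<Phi> \<ge> m0\<close>\<close>
    define t where "t = 1 / d"
    have t: "0 < t" "t < 1" "t \<le> 1/2" using d by (auto simp: t_def field_simps)
    define z where "z = (1 - t) *\<^sub>R x0 + t *\<^sub>R y"
    have "z - x0 = t *\<^sub>R (y - x0)" by (simp add: z_def algebra_simps)
    then have "norm (z - x0) = 1" using d by (simp add: t_def flip: d_def)
    then have "z \<in> cball x0 1" by (simp add: dist_norm norm_minus_commute)
    then have "ereal m0 \<le> \<Phi> z" using w(2) m0 by metis
    also have "\<Phi> z \<le> ereal ((1 - t) * a + t * b - \<kappa> / 2 * (t * (1 - t)) * (normM M (x0 - y))\<^sup>2)"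
      using sc fin b t unfolding strongly_convex_wrt_def z_def by blast
    finally have "m0 \<le> (1 - t) * a + t * b - \<kappa> / 2 * (t * (1 - t)) * (normM M (x0 - y))\<^sup>2"
      by simp
    also have "\<dots> \<le> a - \<kappa> / 2 * (t * (1 - t)) * (normM M (x0 - y))\<^sup>2"
      using mult_left_mono[OF b(2), of t] t by (simp add: algebra_simps)
    finally have 1: "\<kappa> / 2 * (t * (1 - t)) * (normM M (x0 - y))\<^sup>2 \<le> a - m0" by simp
    have "d \<le> B' * normM M (x0 - y)" using B'(2)[of "x0 - y"] by (simp add: d_def norm_minus_commute)
    then have 2: "d\<^sup>2 \<le> B'\<^sup>2 * (normM M (x0 - y))\<^sup>2"
      using power_mono[of d "B' * normM M (x0 - y)" 2] d by (simp add: power_mult_distrib)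
    have "\<kappa> / 2 * (t * (1 - t)) * d\<^sup>2 \<le> \<kappa> / 2 * (t * (1 - t)) * (B'\<^sup>2 * (normM M (x0 - y))\<^sup>2)"
      using 2 t k by (intro mult_left_mono) auto
    also have "\<dots> \<le> B'\<^sup>2 * (a - m0)" using mult_left_mono[OF 1, of "B'\<^sup>2"] by (simp add: algebra_simps)
    finally have "\<kappa> / 2 * (t * (1 - t)) * d\<^sup>2 \<le> B'\<^sup>2 * (a - m0)" .
    moreover have "t * (1 - t) * d\<^sup>2 = d - 1" using d by (simp add: t_def power2_eq_square field_simps)
    ultimately have "\<kappa> / 2 * (d - 1) \<le> B'\<^sup>2 * (a - m0)" by (simp add: mult.assoc)
    then have "d \<le> 1 + 2 * B'\<^sup>2 * (a - m0) / \<kappa>" using k by (simp add: field_simps)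
    then show False using d(2) by (simp add: R_def)
  qed
  obtain x where x: "x \<in> cball x0 R" "\<And>y. y \<in> cball x0 R \<Longrightarrow> \<Phi> x \<le> \<Phi> y"
    using lsc_attains_inf[OF lsc, of "cball x0 R"] R by auto
  have "\<Phi> x \<le> \<Phi> y" for y
  proof (cases "y \<in> cball x0 R")
    case False
    then have "ereal a < \<Phi> y" using far[of y] by (simp add: dist_norm norm_minus_commute)
    moreover have "\<Phi> x \<le> ereal a" using x(2)[of x0] R fin by simp
    ultimately show ?thesis by simp
  qed (use x in auto)
  then show ?thesis by blast
qed

text \<open>Used after dividing a convexity inequality by the step \<open>t\<close> along a segment, to let \<open>t\<close> tend to 0.\<close>

lemma le_of_le_add_multiples:
  fixes A B C :: real
  assumes "\<And>t. 0 < t \<Longrightarrow> t < 1 \<Longrightarrow> A \<le> B + t * C"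
  shows "A \<le> B"
proof (rule tendsto_lowerbound)
  have "((\<lambda>t. B + t * C) \<longlongrightarrow> B + 0 * C) (at_right 0)" by (intro tendsto_intros)
  then show "((\<lambda>t. B + t * C) \<longlongrightarrow> B) (at_right 0)" by simp
  show "\<forall>\<^sub>F t in at_right 0. A \<le> B + t * C"
    using assms by (auto simp: eventually_at_right_field intro!: exI[of _ 1])
qed simp

text \<open>Compare the minimizer \<open>z\<close> with the point at parameter \<open>t\<close> on the segment from \<open>z\<close> to \<open>y\<close>, divide
by \<open>t\<close> and let \<open>t\<close> tend to 0.\<close>

lemma strongly_convex_minimizer_gap:
  assumes sc: "strongly_convex_wrt M \<kappa> \<Phi>" and min: "\<And>y. \<Phi> z \<le> \<Phi> y"
    and z: "\<Phi> z = ereal a" and y: "\<Phi> y = ereal b"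
  shows "a + \<kappa> / 2 * (normM M (z - y))\<^sup>2 \<le> b"
proof (rule le_of_le_add_multiples)
  fix t :: real assume t: "0 < t" "t < 1"
  have "ereal a \<le> \<Phi> ((1 - t) *\<^sub>R z + t *\<^sub>R y)" using min z by metis
  also have "\<dots> \<le> ereal ((1 - t) * a + t * b - \<kappa> / 2 * (t * (1 - t)) * (normM M (z - y))\<^sup>2)"
    using sc z y t unfolding strongly_convex_wrt_def by blast
  finally have "a \<le> (1 - t) * a + t * b - \<kappa> / 2 * (t * (1 - t)) * (normM M (z - y))\<^sup>2" by simp
  moreover have "\<dots> = a + (t * (b + t * (\<kappa> / 2 * (normM M (z - y))\<^sup>2)) - t * (a + \<kappa> / 2 * (normM M (z - y))\<^sup>2))"
    by (simp add: field_simps)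
  ultimately have "t * (a + \<kappa> / 2 * (normM M (z - y))\<^sup>2) \<le> t * (b + t * (\<kappa> / 2 * (normM M (z - y))\<^sup>2))"
    by linarith
  then show "a + \<kappa> / 2 * (normM M (z - y))\<^sup>2 \<le> b + t * (\<kappa> / 2 * (normM M (z - y))\<^sup>2)"
    using t by (simp add: mult_le_cancel_left_pos)
qed

text \<open>A regular subgradient bounds difference quotients from below near \<open>x\<close>, up to an arbitrarily
small error. Along the segment towards \<open>y\<close> strong convexity bounds the same quotients from above by
their value at \<open>y\<close>, so the local inequality becomes a global one with a quadratic gain.\<close>

lemma strongly_convex_subgradient:
  assumes sc: "strongly_convex_wrt M \<kappa> \<Phi>"
    and v: "v \<in> frechet_subdiff \<Phi> x" and x: "\<Phi> x = ereal a" and y: "\<Phi> y = ereal b"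
  shows "a + inner v (y - x) + \<kappa> / 2 * (normM M (x - y))\<^sup>2 \<le> b"
proof (cases "y = x")
  case True
  then show ?thesis using x y by (simp add: normM_def)
next
  case False
  define d where "d = y - x"
  have d: "norm d > 0" using False by (simp add: d_def)
  define K where "K = \<kappa> / 2 * (normM M (x - y))\<^sup>2"
  have "a + inner v d + K \<le> b + e" if e: "e > 0" for e
  proof -
    define e' where "e' = e / norm d"
    have e': "e' > 0" using e d by (simp add: e'_def)
    have "0 \<le> Liminf (at x) (\<lambda>y. (\<Phi> y - \<Phi> x - ereal (inner v (y - x))) / ereal (norm (y - x)))"
      using v by (simp add: frechet_subdiff_def)
    then have "\<forall>\<^sub>F y in at x. ereal (- e') < (\<Phi> y - \<Phi> x - ereal (inner v (y - x))) / ereal (norm (y - x))"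
      unfolding le_Liminf_iff using e' by simp
    then obtain \<delta> where \<delta>: "\<delta> > 0" "\<And>z. z \<noteq> x \<Longrightarrow> dist z x < \<delta> \<Longrightarrow>
        ereal (- e') < (\<Phi> z - \<Phi> x - ereal (inner v (z - x))) / ereal (norm (z - x))"
      unfolding eventually_at by auto
    define t0 where "t0 = min 1 (\<delta> / norm d)"
    have t0: "0 < t0" "t0 \<le> 1" using \<delta> d by (auto simp: t0_def)
    have main: "a + inner v d + K \<le> (b + e) + t * K" if t: "0 < t" "t < t0" for t
    proof -
      define z where "z = (1 - t) *\<^sub>R x + t *\<^sub>R y"
      have zx: "z - x = t *\<^sub>R d" by (simp add: z_def d_def algebra_simps)
      have nz: "norm (z - x) = t * norm d" using zx t by simp
      have "z \<noteq> x" using nz d t by auto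
      moreover have "t < \<delta> / norm d" using t by (simp add: t0_def)
      then have "dist z x < \<delta>" using nz d by (simp add: dist_norm field_simps)
      ultimately have 1: "ereal (- e') < (\<Phi> z - \<Phi> x - ereal (inner v (z - x))) / ereal (norm (z - x))"
        using \<delta>(2) by blast
      have 2: "\<Phi> z \<le> ereal ((1 - t) * a + t * b - \<kappa> / 2 * (t * (1 - t)) * (normM M (x - y))\<^sup>2)"
        using sc x y t t0 unfolding strongly_convex_wrt_def z_def by auto
      have "\<Phi> z \<noteq> -\<infinity>" using 1 nz d t by (auto simp: x)
      then obtain c where c: "\<Phi> z = ereal c" using 2 by (cases "\<Phi> z") auto
      have "- e' < (c - a - inner v (t *\<^sub>R d)) / (t * norm d)"
        using 1 unfolding c x nz zx using d t by (simp add: divide_ereal_def divide_inverse)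
      then have "- e' * (t * norm d) < c - a - inner v (t *\<^sub>R d)"
        using d t by (simp add: pos_less_divide_eq)
      moreover have "e' * norm d = e" using d by (simp add: e'_def)
      then have "e' * (t * norm d) = t * e" by (metis mult.left_commute)
      ultimately have "- (t * e) < c - a - t * inner v d" by simp
      moreover have "c \<le> (1 - t) * a + t * b - (t * (1 - t)) * K" using 2 c by (simp add: K_def algebra_simps)
      ultimately have "- (t * e) \<le> (1 - t) * a + t * b - (t * (1 - t)) * K - a - t * inner v d" by linarith
      then have "t * (a + inner v d + K) \<le> t * ((b + e) + t * K)" by (simp add: algebra_simps)
      then show ?thesis using t by (simp add: mult_le_cancel_left_pos)
    qed
    show ?thesis
    proof (rule le_of_le_add_multiples[where C = "t0 * K"])
      fix t :: real assume "0 < t" "t < 1"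
      then show "a + inner v d + K \<le> b + e + t * (t0 * K)"
        using main[of "t * t0"] t0 by (simp add: mult.assoc)
    qed
  qed
  then show ?thesis unfolding K_def d_def by (rule field_le_epsilon) 
qed

section \<open>The proximal subproblem of a minibatch model\<close>

lemma lsc_add_continuous:
  assumes p: "lsc p" and g: "continuous_on UNIV g"
  shows "lsc (\<lambda>y. p y + ereal (g y))"
  unfolding lsc_def
proof (intro allI impI)
  fix y c assume c: "ereal c < p y + ereal (g y)"
  then have "ereal (c - g y) < p y" by (cases "p y") auto
  then obtain c' where c': "ereal (c - g y) < ereal c'" "ereal c' < p y"
    by (metis ereal_dense2)
  have "\<forall>\<^sub>F z in nhds y. ereal c' < p z" using p c' by (auto simp: lsc_def)
  moreover have "(g \<longlongrightarrow> g y) (nhds y)"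
    using g by (simp add: continuous_on_def tendsto_at_iff_tendsto_nhds)
  then have "\<forall>\<^sub>F z in nhds y. c - c' < g z"
    using c' by (intro order_tendstoD(1)) auto
  ultimately show "\<forall>\<^sub>F z in nhds y. ereal c < p z + ereal (g z)"
  proof eventually_elim
    case (elim z) then show ?case by (cases "p z") auto
  qed
qed

lemma continuous_on_normM_square:
  assumes "pos_def_map M" shows "continuous_on UNIV (\<lambda>y. c * (normM M (y - x))\<^sup>2)"
proof -
  have "bounded_linear M" using assms by (simp add: pos_def_map_def linear_conv_bounded_linear)
  then show ?thesis unfolding normM_square[OF assms]
    by (intro continuous_intros bounded_linear.continuous_on[of M])
qed

text \<open>The summand \<open>r\<close> is shared by all \<open>m\<close> models, so lower semicontinuity is known only for each
model plus \<open>r\<close>. At a point where \<open>r\<close> is finite, allow every summand the same loss \<open>e\<close>; where \<open>r\<close> is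
infinite, all summands exceed any given bound nearby.\<close>

lemma lsc_minibatch_phi:
  assumes m: "1 \<le> m" and r: "\<And>y. r y \<noteq> -\<infinity>"
    and lsc: "\<And>i. i \<in> {1..m} \<Longrightarrow> lsc (model_phi fm r x (ss i))"
  shows "lsc (minibatch_phi fm r m x ss)"
  unfolding lsc_def
proof (intro allI impI)
  fix y c assume c: "ereal c < minibatch_phi fm r m x ss y"
  define av where "av = (\<lambda>z. (\<Sum>i=1..m. fm x z (ss i)) / real m)"
  have m0: "real m > 0" using m by simp
  obtain d where d: "\<And>i. i \<in> {1..m} \<Longrightarrow> ereal (d i) < model_phi fm r x (ss i) y"
     "(\<Sum>i=1..m. d i) / real m \<ge> c"
  proof (cases "r y")
    case PInf
    show thesis by (rule that[of "\<lambda>_. c"]) (use PInf m0 in \<open>auto simp: model_phi_def\<close>)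
  next
    case (real ry)
    define e where "e = (av y + ry - c)"
    have e: "e > 0" using c real by (simp add: minibatch_phi_def e_def av_def)
    have "(\<Sum>i=1..m. fm x y (ss i) + ry - e) / real m = av y + ry - e"
      using m0 by (simp add: sum.distrib sum_subtractf av_def field_simps)
    then show thesis
      by (intro that[of "\<lambda>i. fm x y (ss i) + ry - e"]) (use e real in \<open>auto simp: model_phi_def e_def\<close>)
  qed (use r in auto)
  have "\<forall>\<^sub>F z in nhds y. \<forall>i\<in>{1..m}. ereal (d i) < model_phi fm r x (ss i) z"
    using lsc d(1) by (intro eventually_ball_finite ballI) (auto simp: lsc_def)
  then show "\<forall>\<^sub>F z in nhds y. ereal c < minibatch_phi fm r m x ss z"
  proof eventually_elim
    case (elim z)
    show ?case
    proof (cases "r z")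
      case (real rz)
      have "(\<Sum>i=1..m. d i) < (\<Sum>i=1..m. fm x z (ss i) + rz)"
        using elim m real by (intro sum_strict_mono) (auto simp: model_phi_def)
      also have "\<dots> = (\<Sum>i=1..m. fm x z (ss i)) + real m * rz" by (simp add: sum.distrib)
      finally have "(\<Sum>i=1..m. d i) / real m < av z + rz"
        using m0 by (simp add: av_def field_simps)
      then show ?thesis using d(2) real by (simp add: minibatch_phi_def av_def)
    qed (use r in \<open>auto simp: minibatch_phi_def\<close>)
  qed
qed

lemma norm_square_segment:
  fixes u v :: "'a::euclidean_space"
  shows "(norm ((1 - t) *\<^sub>R u + t *\<^sub>R v))\<^sup>2 =
    (1 - t) * (norm u)\<^sup>2 + t * (norm v)\<^sup>2 - t * (1 - t) * (norm (u - v))\<^sup>2"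
  using normM_square_segment[OF pos_def_map_id] by (simp add: normM_id)

text \<open>The average of weakly convex models is weakly convex with the same constant. Since
\<open>\<parallel>v\<parallel> \<le> B \<parallel>v\<parallel>\<^sub>M\<close>, the defect of convexity is at most \<open>B\<^sup>2 taub\<close> in the \<open>M\<close>-norm, while the
proximal term contributes exactly \<open>1/a\<close>.\<close>

lemma minibatch_prox_objective_strongly_convex:
  fixes r :: "'a::euclidean_space \<Rightarrow> ereal"
  assumes m: "1 \<le> m" and r: "\<And>y. r y \<noteq> -\<infinity>"
    and wc: "\<And>i. i \<in> {1..m} \<Longrightarrow> weakly_convex taub (model_phi fm r x (ss i))"
    and M: "pos_def_map M" and Lb: "\<And>v. norm v \<le> B * normM M v" and taub: "0 \<le> taub"
  shows "strongly_convex_wrt M (1 / a - B\<^sup>2 * taub) (prox_objective M a (minibatch_phi fm r m x ss) x)"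
  unfolding strongly_convex_wrt_def
proof (intro allI impI)
  fix u w :: 'a and b c t :: real
  define \<Phi> where "\<Phi> = prox_objective M a (minibatch_phi fm r m x ss) x"
  define z where "z = (1 - t) *\<^sub>R u + t *\<^sub>R w"
  assume u: "prox_objective M a (minibatch_phi fm r m x ss) x u = ereal b"
    and w: "prox_objective M a (minibatch_phi fm r m x ss) x w = ereal c" and t: "0 < t" "t < 1"
  define av where "av = (\<lambda>z. (\<Sum>i=1..m. fm x z (ss i)) / real m)"
  define Q where "Q = (\<lambda>y. 1 / (2 * a) * (normM M (y - x))\<^sup>2)"
  have m0: "real m > 0" using m by simp
  have mav: "real m * av y = (\<Sum>i=1..m. fm x y (ss i))" for y using m0 by (simp add: av_def)
  have \<Phi>: "\<Phi> y = ereal (av y + Q y) + r y" for y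
    by (cases "r y") (auto simp: \<Phi>_def prox_objective_def minibatch_phi_def av_def Q_def)
  obtain ru where ru: "r u = ereal ru" "b = av u + Q u + ru"
    using u unfolding \<Phi>_def[symmetric] \<Phi> by (cases "r u") auto
  obtain rw where rw: "r w = ereal rw" "c = av w + Q w + rw"
    using w unfolding \<Phi>_def[symmetric] \<Phi> by (cases "r w") auto
  have ineq: "model_phi fm r x (ss i) z + ereal (taub / 2 * (norm z)\<^sup>2)
      \<le> ereal ((1 - t) * (fm x u (ss i) + ru + taub / 2 * (norm u)\<^sup>2)
        + t * (fm x w (ss i) + rw + taub / 2 * (norm w)\<^sup>2))" if "i \<in> {1..m}" for i
  proof -
    have "ext_convex (\<lambda>y. model_phi fm r x (ss i) y + ereal (taub / 2 * (norm y)\<^sup>2))"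
      using wc[OF that] by (simp add: weakly_convex_def)
    then have "model_phi fm r x (ss i) z + ereal (taub / 2 * (norm z)\<^sup>2)
      \<le> ereal (1 - t) * (model_phi fm r x (ss i) u + ereal (taub / 2 * (norm u)\<^sup>2))
        + ereal t * (model_phi fm r x (ss i) w + ereal (taub / 2 * (norm w)\<^sup>2))"
      using t unfolding ext_convex_def z_def by auto
    then show ?thesis by (simp add: model_phi_def ru rw)
  qed
  have "r z \<noteq> \<infinity>" using ineq[of 1] m by (auto simp: model_phi_def)
  then obtain rz where rz: "r z = ereal rz" using r by (cases "r z") auto
  have seg: "(norm z)\<^sup>2 = (1 - t) * (norm u)\<^sup>2 + t * (norm w)\<^sup>2 - t * (1 - t) * (norm (u - w))\<^sup>2"
    unfolding z_def by (rule norm_square_segment)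
  define D where "D = taub / 2 * (t * (1 - t) * (norm (u - w))\<^sup>2)"
  have "taub / 2 * (norm z)\<^sup>2 = (1 - t) * (taub / 2 * (norm u)\<^sup>2) + t * (taub / 2 * (norm w)\<^sup>2) - D"
    unfolding seg D_def by (simp add: field_simps)
  then have "fm x z (ss i) \<le> ((1 - t) * (fm x u (ss i) + ru) + t * (fm x w (ss i) + rw) + D - rz)"
    if "i \<in> {1..m}" for i
    using ineq[OF that] unfolding model_phi_def rz by (simp add: algebra_simps)
  then have "(\<Sum>i=1..m. fm x z (ss i)) \<le>
     (\<Sum>i=1..m. (1 - t) * (fm x u (ss i) + ru) + t * (fm x w (ss i) + rw) + D - rz)"
    by (intro sum_mono) auto
  also have "\<dots> = (1 - t) * (\<Sum>i=1..m. fm x u (ss i)) + t * (\<Sum>i=1..m. fm x w (ss i))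
      + real m * ((1 - t) * ru + t * rw + D - rz)"
    by (simp add: sum.distrib sum_subtractf sum_distrib_left algebra_simps)
  also have "\<dots> = real m * ((1 - t) * av u + t * av w + ((1 - t) * ru + t * rw + D - rz))"
    unfolding mav[symmetric] by (simp add: algebra_simps)
  finally have 1: "av z \<le> (1 - t) * av u + t * av w + ((1 - t) * ru + t * rw + D - rz)"
    using m0 by (simp add: av_def pos_divide_le_eq mult.commute)
  have "z - x = (1 - t) *\<^sub>R (u - x) + t *\<^sub>R (w - x)" by (simp add: z_def algebra_simps)
  then have "(normM M (z - x))\<^sup>2 = (1 - t) * (normM M (u - x))\<^sup>2 + t * (normM M (w - x))\<^sup>2
      - t * (1 - t) * (normM M (u - w))\<^sup>2"
    using normM_square_segment[OF M, of t "u - x" "w - x"] by simp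
  then have 2: "Q z = (1 - t) * Q u + t * Q w - 1 / (2 * a) * (t * (1 - t) * (normM M (u - w))\<^sup>2)"
    unfolding Q_def by (simp add: right_diff_distrib distrib_left mult.left_commute)
  have "(norm (u - w))\<^sup>2 \<le> B\<^sup>2 * (normM M (u - w))\<^sup>2"
    using power_mono[OF Lb[of "u - w"], of 2] by (simp add: power_mult_distrib)
  then have 3: "D \<le> taub / 2 * (t * (1 - t) * (B\<^sup>2 * (normM M (u - w))\<^sup>2))"
    unfolding D_def using taub t by (intro mult_left_mono) auto
  have "av z + Q z + rz \<le> (1 - t) * b + t * c - (1 / a - B\<^sup>2 * taub) / 2 * (t * (1 - t)) * (normM M (u - w))\<^sup>2"
  proof -
    have "(1 / a - B\<^sup>2 * taub) / 2 * (t * (1 - t)) * (normM M (u - w))\<^sup>2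
       = 1 / (2 * a) * (t * (1 - t) * (normM M (u - w))\<^sup>2)
         - taub / 2 * (t * (1 - t) * (B\<^sup>2 * (normM M (u - w))\<^sup>2))"
    proof -
      define c where "c = 1 / (2 * a)"
      have "(1 / a - B\<^sup>2 * taub) / 2 = c - B\<^sup>2 * taub / 2" by (simp add: c_def diff_divide_distrib)
      then show ?thesis unfolding c_def[symmetric] by (simp only:) (simp add: field_simps)
    qed
    moreover have "(1 - t) * b + t * c = (1 - t) * av u + t * av w + ((1 - t) * Q u + t * Q w)
        + ((1 - t) * ru + t * rw)"
      unfolding ru rw by (simp add: algebra_simps)
    ultimately show ?thesis using 1 2 3 by linarith
  qed
  then show "prox_objective M a (minibatch_phi fm r m x ss) x ((1 - t) *\<^sub>R u + t *\<^sub>R w)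
     \<le> ereal ((1 - t) * b + t * c - (1 / a - B\<^sup>2 * taub) / 2 * (t * (1 - t)) * (normM M (u - w))\<^sup>2)"
    unfolding \<Phi>_def[symmetric] z_def[symmetric] \<Phi> rz by simp
qed

lemma prox_minimizes:
  assumes "\<exists>z. \<forall>y. prox_objective M a p x z \<le> prox_objective M a p x y"
  shows "prox_objective M a p x (prox M a p x) \<le> prox_objective M a p x y"
proof -
  obtain z where "is_arg_min (prox_objective M a p x) (\<lambda>_. True) z"
    using assms by (auto simp: is_arg_min_def not_less)
  then have "is_arg_min (prox_objective M a p x) (\<lambda>_. True) (prox M a p x)"
    unfolding prox_def arg_min_def by (rule someI)
  then show ?thesis by (auto simp: is_arg_min_def not_less)
qed

text \<open>The second and third criterion imply the first one. A small objective gap is converted by the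
growth of \<open>\<Phi>\<close> away from its minimizer. For a subgradient \<open>v\<close> at \<open>x'\<close>, adding the
subgradient inequality at \<open>x'\<close> and the growth inequality at the minimizer gives
\<open>\<kappa> \<parallel>d\<parallel>\<^sub>M\<^sup>2 \<le> \<langle>v, d\<rangle>\<close> for the error \<open>d\<close>, and the right-hand side is controlled by the norm of \<open>v\<close>
dual to the \<open>M\<close>-norm.\<close>

lemma inexact_prox_distance:
  assumes M: "pos_def_map M" and a: "0 < a" "t * a < 1" and e: "0 \<le> e"
    and sc: "strongly_convex_wrt M (1 / a - t) (prox_objective M a p x)"
    and min: "\<And>y. prox_objective M a p x (prox M a p x) \<le> prox_objective M a p x y"
    and fin: "prox_objective M a p x (prox M a p x) = ereal b"
    and inexact: "inexact_prox t M a e p x x'"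
  shows "normM M (x' - prox M a p x) \<le> e"
proof -
  define \<Phi> where "\<Phi> = prox_objective M a p x"
  define z where "z = prox M a p x"
  note sc = sc[folded \<Phi>_def] and min = min[folded \<Phi>_def z_def] and fin = fin[folded \<Phi>_def z_def]
  define \<kappa> where "\<kappa> = 1 / a - t"
  have \<kappa>: "\<kappa> > 0" "(1 - t * a) / a = \<kappa>" "(1 - t * a) / (2 * a) = \<kappa> / 2"
    using a by (auto simp: \<kappa>_def field_simps)
  have comm: "normM M (z - x') = normM M (x' - z)" by (rule normM_minus_commute[OF M])
  consider "normM M (x' - z) \<le> e" | "\<Phi> x' - (INF y. \<Phi> y) \<le> ereal (\<kappa> / 2 * e\<^sup>2)"
    | "distM (inv M) 0 (frechet_subdiff \<Phi> x') \<le> ereal (\<kappa> * e)"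
    using inexact unfolding inexact_prox_def \<Phi>_def[symmetric] z_def[symmetric] \<kappa> by blast
  then show ?thesis unfolding z_def[symmetric]
  proof cases
    case 1 then show "normM M (x' - z) \<le> e" .
  next
    case 2
    have "(INF y. \<Phi> y) = ereal b"
      unfolding fin[symmetric] by (intro antisym INF_lower INF_greatest min) auto
    then have 2: "\<Phi> x' - ereal b \<le> ereal (\<kappa> / 2 * e\<^sup>2)" using 2 by simp
    moreover have "ereal b \<le> \<Phi> x'" using min[of x'] fin by simp
    ultimately obtain c where c: "\<Phi> x' = ereal c" by (cases "\<Phi> x'") auto
    have "b + \<kappa> / 2 * (normM M (z - x'))\<^sup>2 \<le> c"
      using strongly_convex_minimizer_gap[OF sc[folded \<kappa>_def] min fin c] .
    then have "\<kappa> / 2 * (normM M (x' - z))\<^sup>2 \<le> \<kappa> / 2 * e\<^sup>2" using 2 c comm by simp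
    then have "(normM M (x' - z))\<^sup>2 \<le> e\<^sup>2" using \<kappa> by simp
    then show "normM M (x' - z) \<le> e" using e by (rule power2_le_imp_le)
  next
    case 3
    have lin: "linear M" using M by (simp add: pos_def_map_def)
    have injM: "inj M"
      unfolding linear_injective_0[OF lin]
      using M by (metis inner_zero_right less_irrefl pos_def_map_def)
    have surjM: "surj M" using linear_inj_imp_surj[OF lin injM] .
    \<comment> \<open>the infimum over the subdifferential need not be attained, hence the slack \<open>\<delta>\<close>\<close>
    have "normM M (x' - z) \<le> e + \<delta>" if \<delta>: "\<delta> > 0" for \<delta>
    proof -
      have "distM (inv M) 0 (frechet_subdiff \<Phi> x') < ereal (\<kappa> * (e + \<delta>))"
        using 3 \<kappa> \<delta> by (elim le_less_trans) simp
      then obtain v where v: "v \<in> frechet_subdiff \<Phi> x'" "normM (inv M) (0 - v) < \<kappa> * (e + \<delta>)"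
        unfolding distM_def by (auto simp: INF_less_iff)
      define g where "g = inv M v"
      have g: "M g = v" unfolding g_def using surjM by (rule surj_f_inv_f)
      have "normM (inv M) (0 - v) = normM M g"
      proof -
        have "M (- g) = - v" using g linear_neg[OF lin] by simp
        then have "inv M (- v) = - g" using injM by (metis inv_f_f)
        then show ?thesis by (simp add: normM_def g inner_commute)
      qed
      then have gn: "normM M g < \<kappa> * (e + \<delta>)" using v by simp
      have "\<bar>\<Phi> x'\<bar> \<noteq> \<infinity>" using v by (simp add: frechet_subdiff_def)
      then obtain c where c: "\<Phi> x' = ereal c" by (cases "\<Phi> x'") auto
      define d where "d = x' - z"
      have "c + inner v (z - x') + \<kappa> / 2 * (normM M (x' - z))\<^sup>2 \<le> b"
        using strongly_convex_subgradient[OF sc[folded \<kappa>_def] v(1) c fin] .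
      moreover have "b + \<kappa> / 2 * (normM M (z - x'))\<^sup>2 \<le> c"
        using strongly_convex_minimizer_gap[OF sc[folded \<kappa>_def] min fin c] .
      ultimately have 4: "\<kappa> * (normM M d)\<^sup>2 \<le> inner v d"
        by (simp add: comm d_def inner_diff_right)
      have "inner v d = inner g (M d)" using M g unfolding pos_def_map_def by metis
      \<comment> \<open>expanding \<open>\<parallel>g - \<kappa> d\<parallel>\<^sub>M\<^sup>2 \<ge> 0\<close> replaces the Cauchy-Schwarz inequality in the \<open>M\<close>-norm\<close>
      moreover have "0 \<le> (normM M g)\<^sup>2 - 2 * \<kappa> * inner g (M d) + \<kappa>\<^sup>2 * (normM M d)\<^sup>2"
        using normM_square_combination[OF M, of 1 g "- \<kappa>" d]
          zero_le_power2[of "normM M (1 *\<^sub>R g + (- \<kappa>) *\<^sub>R d)"] by (simp only:) simp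
      moreover have "\<kappa> * (\<kappa> * (normM M d)\<^sup>2) \<le> \<kappa> * inner v d" using 4 \<kappa> by simp
      ultimately have "(\<kappa> * normM M d)\<^sup>2 \<le> (normM M g)\<^sup>2"
        by (simp add: power2_eq_square algebra_simps)
      then have "\<kappa> * normM M d \<le> normM M g" using normM_nonneg[OF M] by (rule power2_le_imp_le)
      then show ?thesis using gn \<kappa> by (simp add: d_def mult_less_cancel_left_pos flip: d_def) (smt (verit) mult_le_cancel_left_pos)
    qed
    then show "normM M (x' - z) \<le> e" by (rule field_le_epsilon)
  qed
qed

lemma minibatch_prox_minimizes:
  fixes r :: "'a::euclidean_space \<Rightarrow> ereal"
  assumes m: "1 \<le> m" and r: "\<And>y. r y \<noteq> -\<infinity>" and q: "r q \<noteq> \<infinity>"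
    and wc: "\<And>i. i \<in> {1..m} \<Longrightarrow> weakly_convex taub (model_phi fm r x (ss i))"
    and M: "pos_def_map M" and Lb: "\<And>v. norm v \<le> B * normM M v" and taub: "0 \<le> taub"
    and a: "0 < a" "B\<^sup>2 * taub * a < 1"
  defines "\<Phi> \<equiv> prox_objective M a (minibatch_phi fm r m x ss) x"
    and "z \<equiv> prox M a (minibatch_phi fm r m x ss) x"
  shows "\<Phi> z \<le> \<Phi> y" "\<exists>b. \<Phi> z = ereal b"
proof -
  have ninf: "\<Phi> y \<noteq> -\<infinity>" for y
    using r[of y] by (cases "r y") (auto simp: \<Phi>_def prox_objective_def minibatch_phi_def)
  obtain b where b: "\<Phi> q = ereal b"
    using r[of q] q by (cases "r q") (auto simp: \<Phi>_def prox_objective_def minibatch_phi_def)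
  have "lsc \<Phi>"
    unfolding \<Phi>_def prox_objective_def
    by (intro lsc_add_continuous lsc_minibatch_phi m r continuous_on_normM_square M)
       (use wc in \<open>auto simp: weakly_convex_def intro: proper_closed_lsc\<close>)
  moreover have "0 < 1 / a - B\<^sup>2 * taub" using a by (simp add: field_simps)
  moreover have "strongly_convex_wrt M (1 / a - B\<^sup>2 * taub) \<Phi>"
    unfolding \<Phi>_def using m r wc M Lb taub by (rule minibatch_prox_objective_strongly_convex)
  ultimately have "\<exists>x. \<forall>y. \<Phi> x \<le> \<Phi> y"
    using M Lb ninf b by (intro strongly_convex_has_minimizer) 
  then show le: "\<Phi> z \<le> \<Phi> y" for y unfolding z_def \<Phi>_def by (rule prox_minimizes)
  show "\<exists>b. \<Phi> z = ereal b" using le[of q] b ninf[of z] by (cases "\<Phi> z") auto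
qed

text \<open>The exact proximal point \<open>z\<close> against a comparison point \<open>q\<close>. Start from the strong convexity
gap between \<open>z\<close> and \<open>q\<close>. The model at \<open>q\<close> exceeds the sample losses \<open>fq i\<close> by at most the accuracy
term. The model at \<open>z\<close> is traded for the model at \<open>x\<close>, and \<open>F z\<close> for \<open>F x\<close>, at the price of
\<open>Z \<parallel>z - x\<parallel>\<^sub>M\<close>, where \<open>Z\<close> is the sum of the average sample Lipschitz constant and that of \<open>F\<close>. The
proximal term at \<open>z\<close> pays for this price, because \<open>2 a Z u - u\<^sup>2 \<le> a\<^sup>2 Z\<^sup>2\<close>. The last
summand on the right is the sampling error at \<open>q\<close> minus the one at \<open>x\<close>.\<close>

lemma exact_step_inequality:
  fixes r :: "'a::euclidean_space \<Rightarrow> ereal" and F :: "'a \<Rightarrow> real"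
  assumes m: "1 \<le> m" and r: "\<And>y. r y \<noteq> -\<infinity>"
    and wc: "\<And>i. i \<in> {1..m} \<Longrightarrow> weakly_convex taub (model_phi fm r x (ss i))"
    and M: "pos_def_map M" and Lb: "\<And>v. norm v \<le> B * normM M v" and B: "0 \<le> B"
    and taub: "0 \<le> taub"
    and a: "0 < a" "B\<^sup>2 * taub * a < 1" and etab: "0 \<le> etab"
    and growth: "\<And>y. ereal (F q) + r q + ereal (g y) \<le> ereal (F y) + r y"
    and q: "r q \<noteq> \<infinity>"
    and acc: "\<And>i. i \<in> {1..m} \<Longrightarrow> fm x q (ss i) \<le> fq i + etab / 2 * (norm (q - x))\<^sup>2"
    and lip: "\<And>i. i \<in> {1..m} \<Longrightarrow> \<bar>fm x x (ss i) - fm x z (ss i)\<bar> \<le> l i * norm (x - z)"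
    and Flip: "\<bar>F x - F z\<bar> \<le> EL * norm (x - z)" and EL: "0 \<le> EL" and l: "\<And>i. i \<in> {1..m} \<Longrightarrow> 0 \<le> l i"
    and z_def: "z = prox M a (minibatch_phi fm r m x ss) x"
  shows "(1 - B\<^sup>2 * taub * a) * (normM M (q - z))\<^sup>2 + 2 * a * g z
    \<le> (1 + B\<^sup>2 * etab * a) * (normM M (q - x))\<^sup>2
      + a\<^sup>2 * ((\<Sum>i=1..m. B * l i) / real m + B * EL)\<^sup>2
      + 2 * a * (((\<Sum>i=1..m. fq i) / real m - F q) - ((\<Sum>i=1..m. fm x x (ss i)) / real m - F x))"
proof -
  define \<Phi> where "\<Phi> = prox_objective M a (minibatch_phi fm r m x ss) x"
  define av where "av = (\<lambda>z. (\<Sum>i=1..m. fm x z (ss i)) / real m)"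
  have m0: "real m > 0" using m by simp
  note minz = minibatch_prox_minimizes[where fm = fm and x = x and ss = ss, OF m r q wc M Lb taub a, folded z_def \<Phi>_def]
  obtain rq where rq: "r q = ereal rq" using r[of q] q by (cases "r q") auto
  obtain b where b: "\<Phi> z = ereal b" using minz(2) by blast
  obtain rz where rz: "r z = ereal rz"
    using b r[of z] by (cases "r z") (auto simp: \<Phi>_def prox_objective_def minibatch_phi_def)
  have bz: "b = av z + rz + 1 / (2 * a) * (normM M (z - x))\<^sup>2"
    using b rz by (simp add: \<Phi>_def prox_objective_def minibatch_phi_def av_def)
  have \<Phi>q: "\<Phi> q = ereal (av q + rq + 1 / (2 * a) * (normM M (q - x))\<^sup>2)"
    using rq by (simp add: \<Phi>_def prox_objective_def minibatch_phi_def av_def)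
  have gap: "b + (1 / a - B\<^sup>2 * taub) / 2 * (normM M (z - q))\<^sup>2
      \<le> av q + rq + 1 / (2 * a) * (normM M (q - x))\<^sup>2"
    using minibatch_prox_objective_strongly_convex[OF m r wc M Lb taub] minz(1) b \<Phi>q
    unfolding \<Phi>_def by (rule strongly_convex_minimizer_gap)
  have gr: "F q + rq + g z \<le> F z + rz" using growth[of z] rq rz by simp
  have avq: "av q \<le> (\<Sum>i=1..m. fq i) / real m + etab / 2 * (norm (q - x))\<^sup>2"
  proof -
    have "(\<Sum>i=1..m. fm x q (ss i)) \<le> (\<Sum>i=1..m. fq i + etab / 2 * (norm (q - x))\<^sup>2)"
      by (intro sum_mono acc)
    also have "\<dots> = (\<Sum>i=1..m. fq i) + real m * (etab / 2 * (norm (q - x))\<^sup>2)"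
      by (simp add: sum.distrib)
    finally show ?thesis using m0 by (simp add: av_def field_simps)
  qed
  have avz: "av z \<ge> av x - (\<Sum>i=1..m. l i) / real m * norm (x - z)"
  proof -
    have "(\<Sum>i=1..m. fm x x (ss i)) - (\<Sum>i=1..m. fm x z (ss i)) \<le> (\<Sum>i=1..m. l i * norm (x - z))"
      unfolding sum_subtractf[symmetric] using lip by (intro sum_mono) force
    then have "(\<Sum>i=1..m. fm x x (ss i)) \<le> (\<Sum>i=1..m. fm x z (ss i)) + (\<Sum>i=1..m. l i) * norm (x - z)"
      by (simp add: sum_distrib_right)
    from divide_right_mono[OF this, of "real m"] show ?thesis
      by (simp add: av_def add_divide_distrib)
  qed
  define S where "S = (\<Sum>i=1..m. l i) / real m + EL"
  have S0: "S \<ge> 0" unfolding S_def using l EL m0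
    by (intro add_nonneg_nonneg divide_nonneg_nonneg sum_nonneg) auto
  define u where "u = normM M (z - x)"
  have xz: "norm (x - z) \<le> B * u" using Lb[of "z - x"] by (simp add: u_def norm_minus_commute)
  have F: "F z - EL * norm (x - z) \<le> F x" using Flip by linarith
  have SBu: "S * norm (x - z) \<le> B * S * u" using mult_left_mono[OF xz S0] by (simp add: algebra_simps)
  have qx: "etab / 2 * (norm (q - x))\<^sup>2 \<le> etab / 2 * (B\<^sup>2 * (normM M (q - x))\<^sup>2)"
    using power_mono[OF Lb[of "q - x"], of 2] etab
    by (intro mult_left_mono) (auto simp: power_mult_distrib)
  have main: "av x - S * norm (x - z) + rz + 1 / (2 * a) * u\<^sup>2
       + (1 / a - B\<^sup>2 * taub) / 2 * (normM M (z - q))\<^sup>2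
     \<le> (\<Sum>i=1..m. fq i) / real m + etab / 2 * (B\<^sup>2 * (normM M (q - x))\<^sup>2) + rq + 1 / (2 * a) * (normM M (q - x))\<^sup>2
        - EL * norm (x - z)"
    using gap avq avz qx unfolding bz S_def u_def by (simp add: algebra_simps)
  define N where "N = ((\<Sum>i=1..m. fq i) / real m - F q) - (av x - F x)"
  have "g z - B * S * u + 1 / (2 * a) * u\<^sup>2 + (1 / a - B\<^sup>2 * taub) / 2 * (normM M (z - q))\<^sup>2
      \<le> N + etab / 2 * (B\<^sup>2 * (normM M (q - x))\<^sup>2) + 1 / (2 * a) * (normM M (q - x))\<^sup>2"
    using main F gr SBu unfolding N_def by linarith
  then have main1: "2 * a * (g z - B * S * u + 1 / (2 * a) * u\<^sup>2 + (1 / a - B\<^sup>2 * taub) / 2 * (normM M (z - q))\<^sup>2)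
      \<le> 2 * a * (N + etab / 2 * (B\<^sup>2 * (normM M (q - x))\<^sup>2) + 1 / (2 * a) * (normM M (q - x))\<^sup>2)"
    using a by (intro mult_left_mono) auto
  have cancel: "2 * a * (1 / (2 * a) * X) = X" "2 * a * ((1 / a - K) / 2 * X) = (1 - K * a) * X" for X K
    using a by (simp_all add: field_simps)
  have main2: "2 * a * g z - 2 * a * (B * S) * u + u\<^sup>2 + (1 - B\<^sup>2 * taub * a) * (normM M (z - q))\<^sup>2
      \<le> 2 * a * N + (1 + B\<^sup>2 * etab * a) * (normM M (q - x))\<^sup>2"
    using main1[unfolded distrib_left right_diff_distrib cancel] by (simp add: algebra_simps)
  have "0 \<le> (u - a * (B * S))\<^sup>2" by simp
  then have "- (a\<^sup>2 * (B * S)\<^sup>2) \<le> u\<^sup>2 - 2 * a * (B * S) * u"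
    by (simp add: power2_eq_square algebra_simps)
  moreover have "(\<Sum>i=1..m. B * l i) / real m + B * EL = B * S"
    by (simp add: S_def sum_distrib_left[symmetric] algebra_simps)
  ultimately show ?thesis
    using main2 normM_minus_commute[OF M, of z q] unfolding N_def av_def by simp
qed

section \<open>Conditioning on the past samples\<close>

text \<open>Independence says that the joint law of the identity map into \<open>G\<close> and of \<open>T\<close> is a product
measure, so Fubini's theorem evaluates the integral over any event of \<open>G\<close>. Independence is expressed
by probabilities of intersections because the two arguments take values in different types.\<close>

lemma (in prob_space) cond_exp_independent_argument:
  fixes h :: "'a \<Rightarrow> 't \<Rightarrow> real"
  assumes sub: "subalgebra M G" and T[measurable]: "T \<in> measurable M N"
    and ind: "\<And>A B. A \<in> sets G \<Longrightarrow> B \<in> sets N \<Longrightarrow>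
      prob (A \<inter> (T -` B \<inter> space M)) = prob A * prob (T -` B \<inter> space M)"
    and h: "(\<lambda>(\<omega>, t). h \<omega> t) \<in> borel_measurable (G \<Otimes>\<^sub>M N)"
    and int: "integrable M (\<lambda>\<omega>. h \<omega> (T \<omega>))"
  shows "AE \<omega> in M. real_cond_exp M G (\<lambda>\<omega>. h \<omega> (T \<omega>)) \<omega> = (\<integral>\<omega>'. h \<omega> (T \<omega>') \<partial>M)"
proof -
  interpret finite_measure_subalgebra M G
    by unfold_locales (rule sub)
  define MG where "MG = distr M G (\<lambda>\<omega>. \<omega>)"
  define D where "D = distr M N T"
  have spG: "space G = space M" and setsG: "sets G \<subseteq> sets M" using sub by (auto simp: subalgebra_def)
  have rv[measurable]: "(\<lambda>\<omega>. \<omega>) \<in> measurable M G"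
    using sub by (intro measurable_from_subalg[OF sub]) simp
  interpret MG: prob_space MG unfolding MG_def by (rule prob_space_distr) simp
  interpret D: prob_space D unfolding D_def by (rule prob_space_distr) simp
  interpret MD: pair_sigma_finite MG D ..
  have pair: "distr M (G \<Otimes>\<^sub>M N) (\<lambda>\<omega>. (\<omega>, T \<omega>)) = MG \<Otimes>\<^sub>M D"
  proof (rule pair_measure_eqI[symmetric])
    show "sets (MG \<Otimes>\<^sub>M D) = sets (distr M (G \<Otimes>\<^sub>M N) (\<lambda>\<omega>. (\<omega>, T \<omega>)))"
      unfolding sets_distr by (intro sets_pair_measure_cong) (auto simp: MG_def D_def)
    fix A B assume "A \<in> sets MG" "B \<in> sets D"
    then have AB[measurable]: "A \<in> sets G" "B \<in> sets N" by (auto simp: MG_def D_def)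
    have A: "A \<subseteq> space M" using AB(1) setsG sets.sets_into_space by blast
    have "emeasure (distr M (G \<Otimes>\<^sub>M N) (\<lambda>\<omega>. (\<omega>, T \<omega>))) (A \<times> B) = emeasure M (A \<inter> (T -` B \<inter> space M))"
      using A by (subst emeasure_distr) (auto intro!: arg_cong2[where f = emeasure])
    also have "\<dots> = emeasure M A * emeasure M (T -` B \<inter> space M)"
      by (simp add: emeasure_eq_measure ind AB ennreal_mult)
    also have "\<dots> = emeasure MG A * emeasure D B"
      using A by (simp add: MG_def D_def emeasure_distr Int_absorb2)
    finally show "emeasure MG A * emeasure D B = emeasure (distr M (G \<Otimes>\<^sub>M N) (\<lambda>\<omega>. (\<omega>, T \<omega>))) (A \<times> B)" ..
  qed unfold_locales
  have sets: "sets (MG \<Otimes>\<^sub>M D) = sets (G \<Otimes>\<^sub>M N)"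
    by (intro sets_pair_measure_cong) (auto simp: MG_def D_def)
  have hmeas[measurable]: "case_prod h \<in> borel_measurable (G \<Otimes>\<^sub>M N)" using h by simp
  have pm[measurable]: "(\<lambda>\<omega>. (\<omega>, T \<omega>)) \<in> measurable M (G \<Otimes>\<^sub>M N)" by measurable
  have inth: "integrable (MG \<Otimes>\<^sub>M D) (case_prod h)"
    unfolding pair[symmetric] using int by (subst integrable_distr_eq[OF pm]) auto
  define g where "g = (\<lambda>\<omega>. \<integral>t. h \<omega> t \<partial>D)"
  have gG[measurable]: "g \<in> borel_measurable G"
    unfolding g_def using hmeas
    by (intro D.borel_measurable_lebesgue_integral)
       (simp add: measurable_cong_sets[OF sets_pair_measure_cong[of G G D N]] D_def)
  have intgG: "integrable MG g"
    unfolding g_def using MD.integrable_fst'[OF inth] by simp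
  then have intg: "integrable M g"
    unfolding MG_def by (subst (asm) integrable_distr_eq) auto
  have "AE \<omega> in M. real_cond_exp M G (\<lambda>\<omega>. h \<omega> (T \<omega>)) \<omega> = g \<omega>"
  proof (rule real_cond_exp_charact)
    fix A assume A: "A \<in> sets G"
    then have AM[measurable]: "A \<in> sets M" "A \<in> sets G" using sub by (auto simp: subalgebra_def)
    have ind_meas: "(\<lambda>z. indicator A (fst z) * case_prod h z) \<in> borel_measurable (G \<Otimes>\<^sub>M N)"
      by measurable
    have intA: "integrable (MG \<Otimes>\<^sub>M D) (\<lambda>z. indicator A (fst z) * case_prod h z)"
    proof (rule Bochner_Integration.integrable_bound[OF inth])
      show "(\<lambda>z. indicator A (fst z) * case_prod h z) \<in> borel_measurable (MG \<Otimes>\<^sub>M D)"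
        using ind_meas by (simp add: measurable_cong_sets[OF sets refl])
    qed (auto simp: indicator_def)
    have "(\<integral>\<omega>\<in>A. h \<omega> (T \<omega>) \<partial>M)
        = (\<integral>z. indicator A (fst z) * case_prod h z \<partial>distr M (G \<Otimes>\<^sub>M N) (\<lambda>\<omega>. (\<omega>, T \<omega>)))"
      unfolding set_lebesgue_integral_def by (subst integral_distr[OF pm ind_meas]) simp
    also have "\<dots> = (\<integral>\<omega>. (\<integral>t. indicator A \<omega> * h \<omega> t \<partial>D) \<partial>MG)"
      unfolding pair using MD.integral_fst'[OF intA] by simp
    also have "\<dots> = (\<integral>\<omega>. indicator A \<omega> * g \<omega> \<partial>MG)"
      by (simp add: g_def)
    also have "\<dots> = (\<integral>\<omega>\<in>A. g \<omega> \<partial>M)"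
      unfolding MG_def set_lebesgue_integral_def by (subst integral_distr) auto
    finally show "(\<integral>\<omega>\<in>A. h \<omega> (T \<omega>) \<partial>M) = (\<integral>\<omega>\<in>A. g \<omega> \<partial>M)" .
  qed (use int intg gG in auto)
  moreover have "g \<omega> = (\<integral>\<omega>'. h \<omega> (T \<omega>') \<partial>M)" if "\<omega> \<in> space M" for \<omega>
    unfolding g_def D_def using that spG by (subst integral_distr) auto
  ultimately show ?thesis by (auto elim!: AE_mp)
qed

lemma iid_samplesD:
  assumes W: "prob_space W" and iid: "iid_samples W P m S" and k: "1 \<le> k" and i: "i \<in> {1..m}"
  shows "S k i \<in> measurable W P" "distr W P (S k i) = P"
proof -
  have "prob_space.indep_vars W (\<lambda>_. P) (\<lambda>(k, i). S k i) ({1..} \<times> {1..m})"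
    using iid by (simp add: iid_samples_def)
  then have "\<forall>p\<in>{1..} \<times> {1..m}. (case p of (k, i) \<Rightarrow> S k i) \<in> measurable W P"
    unfolding prob_space.indep_vars_def[OF W] by simp
  moreover have "(k, i) \<in> {1..} \<times> {1..m}" using k i by simp
  ultimately have "(case (k, i) of (k, i) \<Rightarrow> S k i) \<in> measurable W P" by (rule bspec)
  then show "S k i \<in> measurable W P" by simp
  show "distr W P (S k i) = P" using iid k i by (simp add: iid_samples_def)
qed

lemma sample_sigma_subalgebra:
  assumes W: "prob_space W" and iid: "iid_samples W P m S"
  shows "subalgebra W (sample_sigma W P m S k)"
proof -
  have "{S j i -` A \<inter> space W | j i A. j \<in> {1..k} \<and> i \<in> {1..m} \<and> A \<in> sets P} \<subseteq> sets W"
    using iid_samplesD(1)[OF W iid] by (auto intro: measurable_sets)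
  then show ?thesis
    unfolding subalgebra_def sample_sigma_def
    by (simp add: space_measure_of_conv sets_measure_of_conv sets.sigma_sets_subset)
qed

text \<open>The generators of the past and those of the current minibatch belong to disjoint groups of an
independent family, so the sigma-algebras that they generate are independent as well.\<close>

lemma samples_independent_of_past:
  assumes W: "prob_space W" and iid: "iid_samples W P m S" and k: "1 \<le> k"
  shows "(\<lambda>\<omega>. \<lambda>i\<in>{1..m}. S k i \<omega>) \<in> measurable W (PiM {1..m} (\<lambda>_. P))"
    and "A \<in> sets (sample_sigma W P m S (k - 1)) \<Longrightarrow> B \<in> sets (PiM {1..m} (\<lambda>_. P)) \<Longrightarrow>
      measure W (A \<inter> ((\<lambda>\<omega>. \<lambda>i\<in>{1..m}. S k i \<omega>) -` B \<inter> space W)) =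
      measure W A * measure W ((\<lambda>\<omega>. \<lambda>i\<in>{1..m}. S k i \<omega>) -` B \<inter> space W)"
proof -
  interpret W: prob_space W by (rule W)
  let ?G = "sample_sigma W P m S (k - 1)" and ?N = "PiM {1..m} (\<lambda>_. P)"
    and ?T = "\<lambda>\<omega>. \<lambda>i\<in>{1..m}. S k i \<omega>"
  define E where "E = (\<lambda>(j, i). {S j i -` A \<inter> space W | A. A \<in> sets P})"
  define I where "I = case_bool ({1..k - 1} \<times> {1..m}) ({k} \<times> {1..m})"
  have "W.indep_sets E ({1..} \<times> {1..m})"
    using iid unfolding iid_samples_def W.indep_vars_def2 E_def by (auto simp: case_prod_unfold)
  moreover have "(\<Union>j\<in>UNIV. I j) \<subseteq> {1..} \<times> {1..m}"
    using k by (auto simp: I_def UNIV_bool)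
  ultimately have "W.indep_sets E (\<Union>j\<in>UNIV. I j)" by (rule W.indep_sets_mono_index[rotated])
  then have "W.indep_sets (\<lambda>j. sigma_sets (space W) (\<Union>i\<in>I j. E i)) UNIV"
  proof (rule W.indep_sets_collect_sigma)
    show "Int_stable (E i)" for i
    proof (cases i)
      case (Pair a b)
      show ?thesis unfolding Pair E_def Int_stable_def
        apply (auto)
        subgoal for A B by (rule exI[of _ "A \<inter> B"]) auto
        done
    qed
    show "disjoint_family_on I UNIV"
      using k by (auto simp: disjoint_family_on_def I_def split: bool.splits)
  qed
  moreover have "(\<lambda>j. sigma_sets (space W) (\<Union>i\<in>I j. E i)) =
     case_bool (sigma_sets (space W) (\<Union>i\<in>{1..k - 1} \<times> {1..m}. E i))
       (sigma_sets (space W) (\<Union>i\<in>{k} \<times> {1..m}. E i))"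
    by (auto simp: I_def split: bool.splits)
  ultimately have ind: "W.indep_set (sigma_sets (space W) (\<Union>i\<in>{1..k - 1} \<times> {1..m}. E i))
       (sigma_sets (space W) (\<Union>i\<in>{k} \<times> {1..m}. E i))"
    unfolding W.indep_set_def by simp
  have G: "sets ?G = sigma_sets (space W) (\<Union>i\<in>{1..k - 1} \<times> {1..m}. E i)"
  proof -
    have eq: "{S j i -` A \<inter> space W | j i A. j \<in> {1..k - 1} \<and> i \<in> {1..m} \<and> A \<in> sets P}
        = (\<Union>i\<in>{1..k - 1} \<times> {1..m}. E i)"
      unfolding E_def by (auto 0 4)
    have "(\<Union>i\<in>{1..k - 1} \<times> {1..m}. E i) \<subseteq> Pow (space W)" by (auto simp: E_def)
    then show ?thesis unfolding sample_sigma_def eq by (rule sets_measure_of)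
  qed
  have subG: "subalgebra W ?G" by (rule sample_sigma_subalgebra[OF W iid])
  have SG: "space ?G = space W" "sets ?G \<subseteq> sets W" using subG by (auto simp: subalgebra_def)
  have T: "?T \<in> measurable W ?N"
    using iid_samplesD(1)[OF W iid k] by (intro measurable_restrict) auto
  define H where "H = sigma (space W) (\<Union>i\<in>{k} \<times> {1..m}. E i)"
  have Hp: "(\<Union>i\<in>{k} \<times> {1..m}. E i) \<subseteq> Pow (space W)" by (auto simp: E_def)
  have H: "sets H = sigma_sets (space W) (\<Union>i\<in>{k} \<times> {1..m}. E i)" "space H = space W"
    unfolding H_def using Hp by (auto simp: sets_measure_of space_measure_of)
  have TH: "?T \<in> measurable H ?N"
  proof (intro measurable_restrict measurableI)
    fix i A assume "i \<in> {1..m}" "A \<in> sets P"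
    then show "S k i -` A \<inter> space H \<in> sets H"
      unfolding H by (intro sigma_sets.Basic) (force simp: E_def)
  next
    fix i \<omega> assume "i \<in> {1..m}" "\<omega> \<in> space H"
    then show "S k i \<omega> \<in> space P"
      using iid_samplesD(1)[OF W iid k] H by (auto simp: measurable_def)
  qed
  show "?T \<in> measurable W ?N" by (rule T)
  have "W.indep_set (sets ?G) (sets H)" using ind G H by simp
  moreover have "?T -` B \<inter> space W \<in> sets H" if "B \<in> sets ?N" for B
    using measurable_sets[OF TH that] H by simp
  ultimately show "A \<in> sets ?G \<Longrightarrow> B \<in> sets ?N \<Longrightarrow>
      measure W (A \<inter> (?T -` B \<inter> space W)) = measure W A * measure W (?T -` B \<inter> space W)"
    unfolding W.indep_sets2_eq by blast
qed

section \<open>Second moment of the minibatch Lipschitz constant\<close>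

lemma (in prob_space) second_moment_indep_sum:
  fixes X :: "'i \<Rightarrow> 'a \<Rightarrow> real" and a b :: real
  assumes fin: "finite I" and ind: "indep_vars (\<lambda>_. borel) X I"
    and sq: "\<And>i. i \<in> I \<Longrightarrow> integrable M (\<lambda>\<omega>. (X i \<omega>)\<^sup>2)"
    and mean: "\<And>i. i \<in> I \<Longrightarrow> expectation (X i) = a"
    and second: "\<And>i. i \<in> I \<Longrightarrow> expectation (\<lambda>\<omega>. (X i \<omega>)\<^sup>2) = b"
  shows "integrable M (\<lambda>\<omega>. (\<Sum>i\<in>I. X i \<omega>)\<^sup>2)"
    and "expectation (\<lambda>\<omega>. (\<Sum>i\<in>I. X i \<omega>)\<^sup>2) = real (card I) * b + real (card I) * (real (card I) - 1) * a\<^sup>2"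
proof -
  have meas: "random_variable borel (X i)" if "i \<in> I" for i
    using ind that by (auto simp: indep_vars_def)
  have int: "integrable M (X i)" if "i \<in> I" for i
    using square_integrable_imp_integrable[OF meas sq] that by simp
  have prod: "integrable M (\<lambda>\<omega>. X i \<omega> * X j \<omega>) \<and> expectation (\<lambda>\<omega>. X i \<omega> * X j \<omega>) = (if i = j then b else a\<^sup>2)"
    if ij: "i \<in> I" "j \<in> I" for i j
  proof (cases "i = j")
    case True
    then show ?thesis using sq[OF ij(1)] second[OF ij(1)] by (simp add: power2_eq_square)
  next
    case False
    have "indep_vars (\<lambda>_. borel) X {i, j}" using ind ij by (intro indep_vars_subset[OF ind]) auto
    then have "expectation (\<lambda>\<omega>. \<Prod>l\<in>{i, j}. X l \<omega>) = (\<Prod>l\<in>{i, j}. expectation (X l))"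
        "integrable M (\<lambda>\<omega>. \<Prod>l\<in>{i, j}. X l \<omega>)"
      using int ij by (auto intro!: indep_vars_lebesgue_integral indep_vars_integrable simp del: prod.insert)
    then show ?thesis using False mean ij by (simp add: power2_eq_square)
  qed
  have eq: "(\<lambda>\<omega>. (\<Sum>i\<in>I. X i \<omega>)\<^sup>2) = (\<lambda>\<omega>. \<Sum>i\<in>I. \<Sum>j\<in>I. X i \<omega> * X j \<omega>)"
    by (simp add: power2_eq_square sum_product)
  show "integrable M (\<lambda>\<omega>. (\<Sum>i\<in>I. X i \<omega>)\<^sup>2)"
    unfolding eq using prod by (intro Bochner_Integration.integrable_sum) auto
  have "expectation (\<lambda>\<omega>. (\<Sum>i\<in>I. X i \<omega>)\<^sup>2) = (\<Sum>i\<in>I. \<Sum>j\<in>I. expectation (\<lambda>\<omega>. X i \<omega> * X j \<omega>))"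
    unfolding eq using prod by (subst Bochner_Integration.integral_sum) (auto intro!: sum.cong Bochner_Integration.integral_sum)
  also have "\<dots> = (\<Sum>i\<in>I. \<Sum>j\<in>I. (if i = j then b - a\<^sup>2 else 0) + a\<^sup>2)"
    using prod by (intro sum.cong) auto
  also have "\<dots> = real (card I) * b + real (card I) * (real (card I) - 1) * a\<^sup>2"
    using fin by (simp add: sum.distrib algebra_simps)
  finally show "expectation (\<lambda>\<omega>. (\<Sum>i\<in>I. X i \<omega>)\<^sup>2) = real (card I) * b + real (card I) * (real (card I) - 1) * a\<^sup>2" .
qed

text \<open>With \<open>a\<close> and \<open>b\<close> the first and second moment of \<open>l\<close>, the average of \<open>m\<close> independent copies has
second moment \<open>A\<^sup>2 b\<close>, where \<open>A\<^sup>2 = (1 + (m - 1) \<omega>) / m\<close> and \<open>\<omega> = a\<^sup>2 / b\<close>. Adding the constant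
\<open>a\<close>, which is at most \<open>\<surd>b\<close> and at most \<open>A \<surd>b\<close>, gives at most \<open>(A + 1)\<^sup>2 b\<close>.\<close>

lemma minibatch_constant_second_moment:
  fixes l :: "'s \<Rightarrow> real"
  assumes W: "prob_space W" and P: "prob_space P" and iid: "iid_samples W P m S" and k: "1 \<le> k" and m: "1 \<le> m"
    and l[measurable]: "l \<in> borel_measurable P" and l2: "integrable P (\<lambda>s. (l s)\<^sup>2)"
    and pos: "0 < (\<integral>s. (l s)\<^sup>2 \<partial>P)" and l0: "0 \<le> (\<integral>s. l s \<partial>P)"
    and c: "(\<integral>s. (l s)\<^sup>2 \<partial>P) \<le> c\<^sup>2"
  shows "integrable W (\<lambda>\<omega>. ((\<Sum>i=1..m. l (S k i \<omega>)) / real m + (\<integral>s. l s \<partial>P))\<^sup>2)"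
    and "(\<integral>\<omega>. ((\<Sum>i=1..m. l (S k i \<omega>)) / real m + (\<integral>s. l s \<partial>P))\<^sup>2 \<partial>W) \<le> rho_const P m l * c\<^sup>2"
proof -
  interpret W: prob_space W by (rule W)
  interpret P: prob_space P by (rule P)
  define a where "a = (\<integral>s. l s \<partial>P)"
  define b where "b = (\<integral>s. (l s)\<^sup>2 \<partial>P)"
  have m0: "real m > 0" using m by simp
  have l1: "integrable P l" using P.square_integrable_imp_integrable[OF l l2] .
  have Sm: "S k i \<in> measurable W P" and Sd: "distr W P (S k i) = P" if "i \<in> {1..m}" for i
    using iid_samplesD[OF W iid k that] by auto
  have trans: "integrable W (\<lambda>\<omega>. g (S k i \<omega>)) \<and> W.expectation (\<lambda>\<omega>. g (S k i \<omega>)) = (\<integral>s. g s \<partial>P)"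
    if "i \<in> {1..m}" "integrable P g" for i and g :: "'s \<Rightarrow> real"
    using integrable_distr_eq[OF Sm[OF that(1)], of g] integral_distr[OF Sm[OF that(1)], of g] that(2) Sd[OF that(1)]
    by auto
  have "W.indep_vars (\<lambda>_. P) (\<lambda>(k, i). S k i) ({1..} \<times> {1..m})"
    using iid by (simp add: iid_samples_def)
  then have "W.indep_vars (\<lambda>_. P) (\<lambda>(k, i). S k i) ({k} \<times> {1..m})"
    by (rule W.indep_vars_subset) (use k in auto)
  then have ind: "W.indep_vars (\<lambda>_. borel) (\<lambda>p \<omega>. l (case p of (k, i) \<Rightarrow> S k i \<omega>)) ({k} \<times> {1..m})"
    using W.indep_vars_compose2[where Y = "\<lambda>_. l" and N = "\<lambda>_. borel"] l
    by (fastforce simp: case_prod_unfold)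
  have sum2: "integrable W (\<lambda>\<omega>. (\<Sum>i=1..m. l (S k i \<omega>))\<^sup>2)"
    "W.expectation (\<lambda>\<omega>. (\<Sum>i=1..m. l (S k i \<omega>))\<^sup>2) = real m * b + real m * (real m - 1) * a\<^sup>2"
    using W.second_moment_indep_sum[where a = a and b = b, OF _ ind] trans[of _ "\<lambda>s. (l s)\<^sup>2"] trans[of _ l] l1 l2
    by (auto simp: a_def b_def sum.cartesian_product')
  have sum1: "integrable W (\<lambda>\<omega>. \<Sum>i=1..m. l (S k i \<omega>))"
    "W.expectation (\<lambda>\<omega>. \<Sum>i=1..m. l (S k i \<omega>)) = real m * a"
    using trans[of _ l] l1 by (auto simp: a_def)
  have eq: "(\<lambda>\<omega>. ((\<Sum>i=1..m. l (S k i \<omega>)) / real m + a)\<^sup>2) =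
     (\<lambda>\<omega>. (\<Sum>i=1..m. l (S k i \<omega>))\<^sup>2 / (real m)\<^sup>2 + (2 * a / real m) * (\<Sum>i=1..m. l (S k i \<omega>)) + a\<^sup>2)"
    by (simp add: power2_eq_square add_divide_distrib algebra_simps)
  show "integrable W (\<lambda>\<omega>. ((\<Sum>i=1..m. l (S k i \<omega>)) / real m + (\<integral>s. l s \<partial>P))\<^sup>2)"
    unfolding a_def[symmetric] eq using sum1 sum2 by auto
  define w where "w = omega_const P l"
  have var: "P.variance l = b - a\<^sup>2" unfolding a_def b_def by (rule P.variance_eq[OF l1 l2])
  have wb: "w * b = a\<^sup>2"
    unfolding w_def omega_const_def var b_def[symmetric] using pos unfolding b_def[symmetric]
    by (simp add: field_simps)
  have ba: "a\<^sup>2 \<le> b" using P.variance_positive[of l] var by simp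
  \<comment> \<open>\<open>(A + 1)\<^sup>2\<close> is \<open>rho_const P m l\<close>\<close>
  define A where "A = sqrt ((1 + (real m - 1) * w) / real m)"
  have "0 \<le> w" using wb pos unfolding b_def[symmetric]
    by (metis less_eq_real_def linorder_not_le mult_neg_pos zero_le_power2)
  then have A0: "0 \<le> (1 + (real m - 1) * w) / real m" using m by simp
  then have A2: "A\<^sup>2 = (1 + (real m - 1) * w) / real m" unfolding A_def by simp
  have A2b: "A\<^sup>2 * b = (b + (real m - 1) * a\<^sup>2) / real m"
    unfolding A2 wb[symmetric] by (simp add: field_simps)
  have aA: "a \<le> A * sqrt b"
  proof (rule power2_le_imp_le)
    have "real m * a\<^sup>2 \<le> b + (real m - 1) * a\<^sup>2" using ba by (simp add: algebra_simps)
    then have "a\<^sup>2 \<le> A\<^sup>2 * b" unfolding A2b using m0 by (simp add: field_simps)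
    then show "a\<^sup>2 \<le> (A * sqrt b)\<^sup>2" using pos by (simp add: power_mult_distrib b_def)
    show "0 \<le> A * sqrt b" using A0 pos by (simp add: A_def b_def)
  qed
  have "a \<le> sqrt b" using ba by (rule real_le_rsqrt)
  have "W.expectation (\<lambda>\<omega>. ((\<Sum>i=1..m. l (S k i \<omega>)) / real m + a)\<^sup>2)
      = (real m * b + real m * (real m - 1) * a\<^sup>2) / (real m)\<^sup>2 + (2 * a / real m) * (real m * a) + a\<^sup>2"
    unfolding eq using sum1 sum2 by (simp add: W.prob_space)
  also have "\<dots> = A\<^sup>2 * b + 2 * a * a + a\<^sup>2"
    unfolding A2b using m0 by (simp add: field_simps power2_eq_square)
  also have "\<dots> \<le> A\<^sup>2 * b + 2 * (A * sqrt b) * sqrt b + (sqrt b)\<^sup>2"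
    using aA \<open>a \<le> sqrt b\<close> l0[folded a_def] A0 pos[folded b_def] unfolding A_def
    by (intro add_mono mult_mono power_mono) (auto simp: less_imp_le)
  also have "\<dots> = (A + 1)\<^sup>2 * b"
    using pos unfolding b_def[symmetric] by (simp add: power2_eq_square algebra_simps)
  also have "\<dots> \<le> (A + 1)\<^sup>2 * c\<^sup>2" using c unfolding b_def by (intro mult_left_mono) auto
  finally show "(\<integral>\<omega>. ((\<Sum>i=1..m. l (S k i \<omega>)) / real m + (\<integral>s. l s \<partial>P))\<^sup>2 \<partial>W) \<le> rho_const P m l * c\<^sup>2"
    unfolding rho_const_def a_def A_def w_def .
qed

section \<open>Conditional change of preconditioner\<close>

text \<open>For positive definite \<open>M\<close> this is the square of the \<open>M\<close>-norm (lemma \<open>sqnorm_eq\<close>). The expansion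
in the basis makes it measurable for a random \<open>M\<close> and a random \<open>v\<close> even where \<open>M\<close> fails to be
linear, which may happen on a null set; the absolute value keeps it nonnegative there.\<close>

definition sqnorm :: "('a::euclidean_space \<Rightarrow> 'a) \<Rightarrow> 'a \<Rightarrow> real" where
  "sqnorm M v = \<bar>\<Sum>b\<in>Basis. inner v b * inner v (M b)\<bar>"

lemma sqnorm_nonneg: "0 \<le> sqnorm M v" by (simp add: sqnorm_def)

lemma sqnorm_minus_commute: "sqnorm M (u - v) = sqnorm M (v - u)"
proof -
  have "inner (u - v) b * inner (u - v) c = inner (v - u) b * inner (v - u) c" for b c
    by (simp add: inner_diff_left algebra_simps)
  then show ?thesis by (simp add: sqnorm_def)
qed

lemma linear_inner_expansion:
  assumes "linear M"
  shows "inner v (M v) = (\<Sum>b\<in>Basis. inner v b * inner v (M b))"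
proof -
  have "M v = M (\<Sum>b\<in>Basis. inner v b *\<^sub>R b)" by (simp add: euclidean_representation)
  also have "\<dots> = (\<Sum>b\<in>Basis. inner v b *\<^sub>R M b)"
    by (simp add: linear_sum[OF assms] linear_scale[OF assms] o_def)
  finally show ?thesis by (simp add: inner_sum_right)
qed

lemma sqnorm_eq: "sqnorm M v = (normM M v)\<^sup>2" if "pos_def_map M"
proof -
  have "linear M" using that by (simp add: pos_def_map_def)
  then have "sqnorm M v = \<bar>inner v (M v)\<bar>" by (simp add: sqnorm_def linear_inner_expansion)
  then show ?thesis using normM_square[OF that, of v] by (metis abs_of_nonneg zero_le_power2)
qed

lemma borel_measurable_sqnorm:
  fixes M :: "'w \<Rightarrow> 'a::euclidean_space \<Rightarrow> 'a"
  assumes [measurable]: "\<And>v. (\<lambda>\<omega>. M \<omega> v) \<in> borel_measurable F" "v \<in> borel_measurable F"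
  shows "(\<lambda>\<omega>. sqnorm (M \<omega>) (v \<omega>)) \<in> borel_measurable F"
  unfolding sqnorm_def by measurable

lemma pos_def_map_entry_bound:
  assumes M: "pos_def_map M" and mu: "0 < \<mu>" "\<And>v. \<mu> * normM M v \<le> norm v"
  shows "\<bar>inner u (M w)\<bar> \<le> ((norm u)\<^sup>2 + (norm w)\<^sup>2) / \<mu>\<^sup>2"
proof -
  have sq: "(normM M v)\<^sup>2 \<le> (norm v)\<^sup>2 / \<mu>\<^sup>2" for v
  proof -
    have "(\<mu> * normM M v)\<^sup>2 \<le> (norm v)\<^sup>2"
      using mu normM_nonneg[OF M] by (intro power_mono) auto
    then show ?thesis using mu by (simp add: power_mult_distrib field_simps)
  qed
  have "0 \<le> (normM M u)\<^sup>2 + 2 * inner u (M w) + (normM M w)\<^sup>2"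
    using normM_square_combination[OF M, of 1 u 1 w] zero_le_power2[of "normM M (u + w)"] by simp
  moreover have "0 \<le> (normM M u)\<^sup>2 - 2 * inner u (M w) + (normM M w)\<^sup>2"
    using normM_square_combination[OF M, of 1 u "-1" w] zero_le_power2[of "normM M (u - w)"] by simp
  moreover have "0 \<le> (norm u)\<^sup>2 / \<mu>\<^sup>2" "0 \<le> (norm w)\<^sup>2 / \<mu>\<^sup>2" by auto
  ultimately show ?thesis using sq[of u] sq[of w] by (simp add: add_divide_distrib abs_le_iff)
qed

text \<open>The hypothesis concerns one fixed vector at a time, outside a null set that depends on the
vector. Let \<open>C\<close> be the matrix of conditional expectations of the entries of \<open>M\<close>. For
fixed vectors the hypothesis bounds the quadratic form of \<open>C\<close> by \<open>c\<close> times that of \<open>M'\<close>. Countably many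
vectors share one null set, and both forms are continuous, so outside a single null set the bound
holds for all vectors at once. In particular it holds for a vector that is known given \<open>F\<close>,
whose coordinates can be pulled out of the conditional expectation.\<close>

lemma cond_exp_preconditioner_change:
  fixes M M' :: "'w \<Rightarrow> 'a::euclidean_space \<Rightarrow> 'a"
  assumes W: "prob_space W" and sub: "subalgebra W F"
    and meas: "\<And>v. (\<lambda>\<omega>. M \<omega> v) \<in> borel_measurable W" "\<And>v. (\<lambda>\<omega>. M' \<omega> v) \<in> borel_measurable F"
    and pd: "AE \<omega> in W. pos_def_map (M \<omega>)" "AE \<omega> in W. pos_def_map (M' \<omega>)"
    and mu: "0 < \<mu>" and bound: "AE \<omega> in W. \<forall>v. \<mu> * normM (M \<omega>) v \<le> norm v"
    and ratio: "\<And>v. v \<noteq> 0 \<Longrightarrow>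
      AE \<omega> in W. real_cond_exp W F (\<lambda>\<omega>. (normM (M \<omega>) v)\<^sup>2 / (normM (M' \<omega>) v)\<^sup>2) \<omega> \<le> c"
    and v: "v \<in> borel_measurable F" and R: "AE \<omega> in W. norm (v \<omega>) \<le> R"
  shows "integrable W (\<lambda>\<omega>. sqnorm (M \<omega>) (v \<omega>))"
    and "AE \<omega> in W. real_cond_exp W F (\<lambda>\<omega>. sqnorm (M \<omega>) (v \<omega>)) \<omega> \<le> c * sqnorm (M' \<omega>) (v \<omega>)"
proof -
  interpret W: prob_space W by (rule W)
  interpret finite_measure_subalgebra W F by unfold_locales (rule sub)
  note [measurable] = meas v measurable_from_subalg[OF sub meas(2)] measurable_from_subalg[OF sub v]
  define C where "C = (\<lambda>b b'. real_cond_exp W F (\<lambda>\<omega>. inner b' (M \<omega> b)))"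
  define f where "f = (\<lambda>b b' \<omega>. inner (v \<omega>) b * inner (v \<omega>) b')"
  have entry: "AE \<omega> in W. \<bar>inner u (M \<omega> w)\<bar> \<le> ((norm u)\<^sup>2 + (norm w)\<^sup>2) / \<mu>\<^sup>2" for u w
    using pd(1) bound by eventually_elim (rule pos_def_map_entry_bound, use mu in auto)
  have int_entry: "integrable W (\<lambda>\<omega>. inner u (M \<omega> w))" for u w
    by (rule W.integrable_const_bound[of _ "((norm u)\<^sup>2 + (norm w)\<^sup>2) / \<mu>\<^sup>2"])
       (use entry in auto)
  have int_f: "integrable W (\<lambda>\<omega>. f b b' \<omega> * inner b' (M \<omega> b))" for b b'
  proof (rule W.integrable_const_bound)
    show "AE \<omega> in W. norm (f b b' \<omega> * inner b' (M \<omega> b))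
        \<le> (R * norm b * (R * norm b')) * (((norm b')\<^sup>2 + (norm b)\<^sup>2) / \<mu>\<^sup>2)"
      using R entry[of b' b]
    proof eventually_elim
      case (elim \<omega>)
      have "\<bar>inner (v \<omega>) u\<bar> \<le> R * norm u" for u
        using Cauchy_Schwarz_ineq2[of "v \<omega>" u] mult_right_mono[OF elim(1), of "norm u"] by simp
      then have 1: "\<bar>inner (v \<omega>) b\<bar> * \<bar>inner (v \<omega>) b'\<bar> \<le> (R * norm b) * (R * norm b')"
        by (intro mult_mono) (auto intro: order_trans[OF abs_ge_zero])
      have "0 \<le> \<bar>inner (v \<omega>) b\<bar> * \<bar>inner (v \<omega>) b'\<bar>" by simp
      also note 1
      finally show ?case unfolding f_def real_norm_def abs_mult
        by (rule mult_mono[OF 1 elim(2)]) simp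
    qed
    show "(\<lambda>\<omega>. f b b' \<omega> * inner b' (M \<omega> b)) \<in> borel_measurable W" unfolding f_def by measurable
  qed
  have expand: "inner u (A u) = (\<Sum>b\<in>Basis. \<Sum>b'\<in>Basis. inner u b * inner u b' * inner b' (A b))"
    if "pos_def_map A" for u and A :: "'a \<Rightarrow> 'a"
  proof -
    have "inner u (A u) = (\<Sum>b\<in>Basis. inner u b * inner u (A b))"
      using that by (intro linear_inner_expansion) (simp add: pos_def_map_def)
    also have "\<dots> = (\<Sum>b\<in>Basis. inner u b * (\<Sum>b'\<in>Basis. inner u b' * inner (A b) b'))"
      by (subst (2) euclidean_inner) simp
    finally show ?thesis by (simp add: sum_distrib_left inner_commute mult.assoc)
  qed
  have sq_expand: "sqnorm A u = (\<Sum>b\<in>Basis. \<Sum>b'\<in>Basis. inner u b * inner u b' * inner b' (A b))"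
    if "pos_def_map A" for u and A :: "'a \<Rightarrow> 'a"
    using expand[OF that] normM_square[OF that] sqnorm_eq[OF that] by simp
  have meas_sq: "(\<lambda>\<omega>. sqnorm (M \<omega>) (v \<omega>)) \<in> borel_measurable W"
    by (intro borel_measurable_sqnorm) measurable
  have AEexp: "AE \<omega> in W. (\<Sum>b\<in>Basis. \<Sum>b'\<in>Basis. f b b' \<omega> * inner b' (M \<omega> b)) = sqnorm (M \<omega>) (v \<omega>)"
    using pd(1) by eventually_elim (simp add: sq_expand f_def)
  have int_sum: "integrable W (\<lambda>\<omega>. \<Sum>b\<in>Basis. \<Sum>b'\<in>Basis. f b b' \<omega> * inner b' (M \<omega> b))"
    by (intro Bochner_Integration.integrable_sum int_f)
  show int: "integrable W (\<lambda>\<omega>. sqnorm (M \<omega>) (v \<omega>))"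
    using integrable_cong_AE_imp[OF int_sum meas_sq AEexp] .
  have cond_sum: "AE \<omega> in W. real_cond_exp W F (\<lambda>\<omega>. \<Sum>b\<in>Basis. \<Sum>b'\<in>Basis. g b b' \<omega> * inner b' (M \<omega> b)) \<omega>
      = (\<Sum>b\<in>Basis. \<Sum>b'\<in>Basis. g b b' \<omega> * C b b' \<omega>)"
    if int_g: "\<And>b b'. integrable W (\<lambda>\<omega>. g b b' \<omega> * inner b' (M \<omega> b))"
      and g: "\<And>b b'. g b b' \<in> borel_measurable F" for g
  proof -
    have 1: "AE \<omega> in W. real_cond_exp W F (\<lambda>\<omega>. \<Sum>b\<in>Basis. \<Sum>b'\<in>Basis. g b b' \<omega> * inner b' (M \<omega> b)) \<omega>
        = (\<Sum>b\<in>Basis. real_cond_exp W F (\<lambda>\<omega>. \<Sum>b'\<in>Basis. g b b' \<omega> * inner b' (M \<omega> b)) \<omega>)"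
      using int_g by (intro real_cond_exp_sum Bochner_Integration.integrable_sum)
    have 2: "AE \<omega> in W. \<forall>b\<in>Basis. real_cond_exp W F (\<lambda>\<omega>. \<Sum>b'\<in>Basis. g b b' \<omega> * inner b' (M \<omega> b)) \<omega>
        = (\<Sum>b'\<in>Basis. real_cond_exp W F (\<lambda>\<omega>. g b b' \<omega> * inner b' (M \<omega> b)) \<omega>)"
      using int_g by (intro AE_finite_allI finite_Basis real_cond_exp_sum)
    have 3: "AE \<omega> in W. \<forall>b\<in>Basis. \<forall>b'\<in>Basis. real_cond_exp W F (\<lambda>\<omega>. g b b' \<omega> * inner b' (M \<omega> b)) \<omega>
        = g b b' \<omega> * C b b' \<omega>"
      unfolding C_def using int_g g by (intro AE_finite_allI finite_Basis real_cond_exp_mult borel_measurable_integrable[OF int_entry])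
    show ?thesis using 1 2 3 by eventually_elim simp
  qed
  have fixed: "AE \<omega> in W. (\<Sum>b\<in>Basis. \<Sum>b'\<in>Basis. inner u b * inner u b' * C b b' \<omega>) \<le> c * sqnorm (M' \<omega>) u" for u
  proof (cases "u = 0")
    case True then show ?thesis by (simp add: sqnorm_def)
  next
    case False
    define \<rho> where "\<rho> = (\<lambda>\<omega>. (normM (M \<omega>) u)\<^sup>2 / (normM (M' \<omega>) u)\<^sup>2)"
    have sq'F: "(\<lambda>\<omega>. sqnorm (M' \<omega>) u) \<in> borel_measurable F"
      by (intro borel_measurable_sqnorm) measurable
    have normm: "(\<lambda>\<omega>. normM (A \<omega>) u) \<in> borel_measurable W"
      if [measurable]: "(\<lambda>\<omega>. A \<omega> u) \<in> borel_measurable W" for A :: "'w \<Rightarrow> 'a \<Rightarrow> 'a"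
      unfolding normM_def by measurable
    have \<rho>m: "\<rho> \<in> borel_measurable W"
      unfolding \<rho>_def by (intro borel_measurable_divide borel_measurable_power normm) measurable
    have eq: "AE \<omega> in W. (\<Sum>b\<in>Basis. \<Sum>b'\<in>Basis. (inner u b * inner u b') * inner b' (M \<omega> b)) = sqnorm (M' \<omega>) u * \<rho> \<omega>"
      using pd
    proof eventually_elim
      case (elim \<omega>)
      have "(normM (M' \<omega>) u)\<^sup>2 > 0"
        unfolding normM_square[OF elim(2)] using elim(2) False by (simp add: pos_def_map_def)
      moreover have "(\<Sum>b\<in>Basis. \<Sum>b'\<in>Basis. (inner u b * inner u b') * inner b' (M \<omega> b)) = (normM (M \<omega>) u)\<^sup>2"
        using sq_expand[OF elim(1)] sqnorm_eq[OF elim(1)] by metis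
      ultimately show ?case by (simp add: \<rho>_def sqnorm_eq[OF elim(2)])
    qed
    have mprod: "(\<lambda>\<omega>. sqnorm (M' \<omega>) u * \<rho> \<omega>) \<in> borel_measurable W"
      using \<rho>m measurable_from_subalg[OF sub sq'F] by measurable
    have int_u: "integrable W (\<lambda>\<omega>. (inner u b * inner u b') * inner b' (M \<omega> b))" for b b'
      using int_entry by auto
    have "integrable W (\<lambda>\<omega>. \<Sum>b\<in>Basis. \<Sum>b'\<in>Basis. (inner u b * inner u b') * inner b' (M \<omega> b))"
      by (intro Bochner_Integration.integrable_sum int_u)
    from integrable_cong_AE_imp[OF this mprod eq]
    have "AE \<omega> in W. real_cond_exp W F (\<lambda>\<omega>. sqnorm (M' \<omega>) u * \<rho> \<omega>) \<omega> = sqnorm (M' \<omega>) u * real_cond_exp W F \<rho> \<omega>"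
      by (intro real_cond_exp_mult sq'F \<rho>m)
    moreover have "AE \<omega> in W. real_cond_exp W F (\<lambda>\<omega>. \<Sum>b\<in>Basis. \<Sum>b'\<in>Basis. (inner u b * inner u b') * inner b' (M \<omega> b)) \<omega>
        = real_cond_exp W F (\<lambda>\<omega>. sqnorm (M' \<omega>) u * \<rho> \<omega>) \<omega>"
      by (intro real_cond_exp_cong eq mprod) measurable
    moreover have "AE \<omega> in W. real_cond_exp W F \<rho> \<omega> \<le> c" unfolding \<rho>_def by (rule ratio[OF False])
    moreover have "AE \<omega> in W. real_cond_exp W F (\<lambda>\<omega>. \<Sum>b\<in>Basis. \<Sum>b'\<in>Basis. (inner u b * inner u b') * inner b' (M \<omega> b)) \<omega>
       = (\<Sum>b\<in>Basis. \<Sum>b'\<in>Basis. (inner u b * inner u b') * C b b' \<omega>)"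
      using cond_sum[of "\<lambda>b b' _. inner u b * inner u b'"] int_u by simp
    ultimately show ?thesis
    proof eventually_elim
      case (elim \<omega>)
      then have "(\<Sum>b\<in>Basis. \<Sum>b'\<in>Basis. (inner u b * inner u b') * C b b' \<omega>) = sqnorm (M' \<omega>) u * real_cond_exp W F \<rho> \<omega>"
        by simp
      also have "\<dots> \<le> sqnorm (M' \<omega>) u * c" using elim(3) by (intro mult_left_mono sqnorm_nonneg)
      finally show ?case by (simp add: mult.commute)
    qed
  qed
  obtain T :: "'a set" where T: "countable T" "closure T = UNIV"
    using separable[of "UNIV :: 'a set"] by (metis top.extremum_uniqueI)
  have "AE \<omega> in W. \<forall>u\<in>T. (\<Sum>b\<in>Basis. \<Sum>b'\<in>Basis. inner u b * inner u b' * C b b' \<omega>) \<le> c * sqnorm (M' \<omega>) u"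
    using fixed T(1) by (simp add: AE_ball_countable)
  then have all: "AE \<omega> in W. \<forall>u. (\<Sum>b\<in>Basis. \<Sum>b'\<in>Basis. inner u b * inner u b' * C b b' \<omega>) \<le> c * sqnorm (M' \<omega>) u"
  proof eventually_elim
    case (elim \<omega>)
    have "closed {u. (\<Sum>b\<in>Basis. \<Sum>b'\<in>Basis. inner u b * inner u b' * C b b' \<omega>) \<le> c * sqnorm (M' \<omega>) u}"
      unfolding sqnorm_def by (intro closed_Collect_le continuous_intros)
    from closure_minimal[OF _ this, of T] show ?case using elim T(2) by auto
  qed
  have fF: "f b b' \<in> borel_measurable F" for b b' unfolding f_def by measurable
  have "AE \<omega> in W. real_cond_exp W F (\<lambda>\<omega>. \<Sum>b\<in>Basis. \<Sum>b'\<in>Basis. f b b' \<omega> * inner b' (M \<omega> b)) \<omega>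
      = (\<Sum>b\<in>Basis. \<Sum>b'\<in>Basis. f b b' \<omega> * C b b' \<omega>)"
    using int_f fF by (intro cond_sum)
  moreover have "AE \<omega> in W. real_cond_exp W F (\<lambda>\<omega>. \<Sum>b\<in>Basis. \<Sum>b'\<in>Basis. f b b' \<omega> * inner b' (M \<omega> b)) \<omega>
      = real_cond_exp W F (\<lambda>\<omega>. sqnorm (M \<omega>) (v \<omega>)) \<omega>"
    by (intro real_cond_exp_cong AEexp meas_sq borel_measurable_integrable int_sum)
  ultimately show "AE \<omega> in W. real_cond_exp W F (\<lambda>\<omega>. sqnorm (M \<omega>) (v \<omega>)) \<omega> \<le> c * sqnorm (M' \<omega>) (v \<omega>)"
    using all
  proof eventually_elim
    case (elim \<omega>)
    show ?case using elim(1,2) elim(3)[rule_format, of "v \<omega>"] by (simp add: f_def)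
  qed
qed

section \<open>Squared distance to the solution set\<close>

text \<open>The squared distance to the range of a sequence \<open>q\<close>, later dense in the solution set. A countable
infimum keeps it measurable.\<close>

definition sqdist :: "('a::euclidean_space \<Rightarrow> 'a) \<Rightarrow> (nat \<Rightarrow> 'a) \<Rightarrow> 'a \<Rightarrow> real" where
  "sqdist M q x = (INF n. sqnorm M (x - q n))"

lemma sqdist_le: "sqdist M q x \<le> sqnorm M (x - q n)"
  unfolding sqdist_def by (rule cINF_lower) (auto intro!: bdd_belowI[of _ 0] sqnorm_nonneg)

lemma sqdist_greatest: "(\<And>n. c \<le> sqnorm M (x - q n)) \<Longrightarrow> c \<le> sqdist M q x"
  unfolding sqdist_def by (rule cINF_greatest) auto

lemma sqdist_nonneg: "0 \<le> sqdist M q x"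
  by (rule sqdist_greatest) (rule sqnorm_nonneg)

lemma borel_measurable_sqdist:
  fixes M :: "'w \<Rightarrow> 'a::euclidean_space \<Rightarrow> 'a"
  assumes "\<And>v. (\<lambda>\<omega>. M \<omega> v) \<in> borel_measurable F" and [measurable]: "x \<in> borel_measurable F"
  shows "(\<lambda>\<omega>. sqdist (M \<omega>) q (x \<omega>)) \<in> borel_measurable F"
  unfolding sqdist_def
  by (intro borel_measurable_cINF_real borel_measurable_sqnorm assms(1)) auto

text \<open>The distance from \<open>x\<close> to points of the sequence bounds the left-hand side, and this bound extends
to the closure of the sequence by continuity.\<close>

lemma sqdist_le_infdist:
  assumes M: "pos_def_map M" and mu: "0 \<le> \<mu>" "\<And>v. \<mu> * normM M v \<le> norm v"
    and dense: "X \<subseteq> closure (range q)" and X: "X \<noteq> {}"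
  shows "\<mu>\<^sup>2 * sqdist M q x \<le> (infdist x X)\<^sup>2"
proof -
  define t where "t = sqrt (\<mu>\<^sup>2 * sqdist M q x)"
  have "t \<le> dist x (q n)" for n
  proof -
    have "\<mu>\<^sup>2 * sqdist M q x \<le> \<mu>\<^sup>2 * (normM M (x - q n))\<^sup>2"
      using sqdist_le[of M q x n] sqnorm_eq[OF M] by (intro mult_left_mono) auto
    also have "\<dots> \<le> (norm (x - q n))\<^sup>2"
      unfolding power_mult_distrib[symmetric] using mu normM_nonneg[OF M]
      by (intro power_mono) auto
    finally show ?thesis unfolding t_def dist_norm by (rule real_le_lsqrt[OF norm_ge_zero])
  qed
  then have "range q \<subseteq> {y. t \<le> dist x y}" by auto
  moreover have "closed {y. t \<le> dist x y}" by (intro closed_Collect_le continuous_intros)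
  ultimately have "closure (range q) \<subseteq> {y. t \<le> dist x y}" by (rule closure_minimal)
  then have "t \<le> infdist x X"
    unfolding infdist_notempty[OF X] using dense X by (intro cINF_greatest) auto
  then have "t\<^sup>2 \<le> (infdist x X)\<^sup>2" by (intro power_mono) (auto simp: t_def sqdist_nonneg)
  then show ?thesis by (simp add: t_def sqdist_nonneg)
qed

lemma infdist_le_sqdist:
  assumes M: "pos_def_map M" and B: "\<And>v. norm v \<le> B * normM M v" "0 < B"
    and X: "range q \<subseteq> X"
  shows "(infdist x X)\<^sup>2 \<le> B\<^sup>2 * sqdist M q x"
proof -
  have "(infdist x X)\<^sup>2 / B\<^sup>2 \<le> sqdist M q x"
  proof (rule sqdist_greatest)
    fix n
    have "infdist x X \<le> norm (x - q n)" using X infdist_le[of "q n" X x] by (auto simp: dist_norm)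
    also have "\<dots> \<le> B * normM M (x - q n)" by (rule B)
    finally have "(infdist x X)\<^sup>2 \<le> B\<^sup>2 * (normM M (x - q n))\<^sup>2"
      unfolding power_mult_distrib[symmetric] by (intro power_mono infdist_nonneg)
    then show "(infdist x X)\<^sup>2 / B\<^sup>2 \<le> sqnorm M (x - q n)"
      using B(2) by (simp add: sqnorm_eq[OF M] field_simps)
  qed
  then show ?thesis using B(2) by (simp add: field_simps)
qed

lemma sqdist_perturb:
  assumes M: "pos_def_map M" and th: "0 < \<theta>" and e: "normM M (y - x) \<le> e"
  shows "sqdist M q y \<le> (1 + \<theta>) * sqdist M q x + (1 + 1 / \<theta>) * e\<^sup>2"
proof -
  have "(sqdist M q y - (1 + 1 / \<theta>) * e\<^sup>2) / (1 + \<theta>) \<le> sqdist M q x"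
  proof (rule sqdist_greatest)
    fix n
    have "sqdist M q y \<le> (normM M ((x - q n) + (y - x)))\<^sup>2"
      using sqdist_le[of M q y n] by (simp add: sqnorm_eq[OF M])
    also have "\<dots> \<le> (1 + \<theta>) * (normM M (x - q n))\<^sup>2 + (1 + 1 / \<theta>) * (normM M (y - x))\<^sup>2"
      by (rule normM_square_young[OF M th])
    also have "\<dots> \<le> (1 + \<theta>) * (normM M (x - q n))\<^sup>2 + (1 + 1 / \<theta>) * e\<^sup>2"
      using th e normM_nonneg[OF M] by (intro add_left_mono mult_left_mono power_mono) auto
    finally show "(sqdist M q y - (1 + 1 / \<theta>) * e\<^sup>2) / (1 + \<theta>) \<le> sqnorm M (x - q n)"
      using th by (simp add: sqnorm_eq[OF M] pos_divide_le_eq mult.commute)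
  qed
  then show ?thesis using th by (simp add: pos_divide_le_eq algebra_simps)
qed

section \<open>Lipschitz constants and scalar recursions\<close>

text \<open>Cut the segment from \<open>x\<close> to \<open>y\<close> into \<open>N\<close> equal pieces: the linear terms add up to the same total,
while the quadratic terms add up to a multiple of \<open>1/N\<close>.\<close>

lemma lipschitz_of_quadratic_perturbation:
  fixes g :: "'a::real_normed_vector \<Rightarrow> real"
  assumes U: "convex U" and x: "x \<in> U" and y: "y \<in> U"
    and bound: "\<And>u v. u \<in> U \<Longrightarrow> v \<in> U \<Longrightarrow> \<bar>g u - g v\<bar> \<le> A * norm (u - v) + B * (norm (u - v))\<^sup>2"
  shows "\<bar>g x - g y\<bar> \<le> A * norm (x - y)"
proof (rule LIMSEQ_le_const)
  define d where "d = norm (x - y)"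
  have "(\<lambda>n. A * d + B * d\<^sup>2 * (1 / real (Suc n))) \<longlonglongrightarrow> A * d + B * d\<^sup>2 * 0"
    by (intro tendsto_intros LIMSEQ_Suc[OF lim_1_over_n])
  then show "(\<lambda>n. A * d + B * d\<^sup>2 * (1 / real (Suc n))) \<longlonglongrightarrow> A * norm (x - y)" by (simp add: d_def)
  have "\<bar>g x - g y\<bar> \<le> A * d + B * d\<^sup>2 * (1 / real (Suc n))" for n
  proof -
    define N where "N = Suc n"
    have N: "real N > 0" by (simp add: N_def)
    define z where "z = (\<lambda>i. (1 - real i / real N) *\<^sub>R x + (real i / real N) *\<^sub>R y)"
    have zU: "z i \<in> U" if "i \<le> N" for i
      unfolding z_def using U x y that N by (intro convexD) auto
    have step: "\<bar>g (z i) - g (z (Suc i))\<bar> \<le> A * (d / real N) + B * (d / real N)\<^sup>2" if "i < N" for i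
    proof -
      have "z i - z (Suc i) = (1 / real N) *\<^sub>R (x - y)"
        by (simp add: z_def algebra_simps add_divide_distrib)
      then have "norm (z i - z (Suc i)) = d / real N" using N by (simp add: d_def)
      then show ?thesis using bound[OF zU[of i] zU[of "Suc i"]] that by simp
    qed
    have "g (z 0) - g (z N) = (\<Sum>i<N. g (z i) - g (z (Suc i)))"
      by (rule sum_lessThan_telescope'[symmetric])
    then have "\<bar>g (z 0) - g (z N)\<bar> \<le> (\<Sum>i<N. \<bar>g (z i) - g (z (Suc i))\<bar>)" by simp
    also have "\<dots> \<le> (\<Sum>i<N. A * (d / real N) + B * (d / real N)\<^sup>2)"
      using step by (intro sum_mono) auto
    also have "\<dots> = A * d + B * d\<^sup>2 * (1 / real N)"
      using N by (simp add: power2_eq_square field_simps)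
    finally show ?thesis using N by (simp add: z_def N_def)
  qed
  then show "\<exists>N. \<forall>n\<ge>N. \<bar>g x - g y\<bar> \<le> A * d + B * d\<^sup>2 * (1 / real (Suc n))" by blast
qed

text \<open>Dividing by the square of the partial product \<open>\<nu>' k\<close> of the \<open>\<rho> i\<close> removes the factors \<open>\<rho> k\<close>.
As \<open>\<nu>' k \<ge> 1\<close>, the division does not increase the inhomogeneity, and a geometric series with sum \<open>K / b\<close>
remains.\<close>

lemma discounted_recursion_bound:
  fixes e \<rho> :: "nat \<Rightarrow> real"
  assumes e1: "e 1 \<le> \<delta>" and \<delta>: "0 \<le> \<delta>" and b: "0 < b" and K: "0 \<le> K"
    and \<rho>0: "\<rho> 0 = 1" and \<rho>: "\<And>k. 1 \<le> k \<Longrightarrow> 1 \<le> \<rho> k"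
    and rec: "\<And>k. 1 \<le> k \<Longrightarrow> e (Suc k) \<le> 1 / (1 + b) * ((\<rho> k)\<^sup>2 * e k + K)"
    and lim: "(\<lambda>k. \<Prod>i<k. \<rho> i) \<longlonglongrightarrow> \<nu>" and k: "1 \<le> k"
  shows "e k \<le> \<nu>\<^sup>2 * ((1 / (1 + b)) ^ (k - 1) * \<delta> + K / b)"
proof -
  define \<nu>' where "\<nu>' = (\<lambda>k. \<Prod>i<k. \<rho> i)"
  define R where "R = (\<lambda>k. (1 / (1 + b)) ^ (k - 1) * \<delta> + K / b)"
  have \<rho>1: "1 \<le> \<rho> i" for i using \<rho>0 \<rho>[of i] by (cases "i = 0") auto
  have \<nu>1: "1 \<le> \<nu>' k" for k unfolding \<nu>'_def using \<rho>1 by (intro prod_ge_1) auto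
  have R0: "0 \<le> R k" for k unfolding R_def using b K \<delta> by simp
  have "e (Suc n) \<le> (\<nu>' (Suc n))\<^sup>2 * R (Suc n)" for n
  proof (induction n)
    case 0
    have "\<nu>' 1 = 1" by (simp add: \<nu>'_def \<rho>0)
    moreover have "0 \<le> K / b" using b K by simp
    ultimately show ?case using e1 by (simp add: R_def)
  next
    case (Suc n)
    let ?k = "Suc n"
    have \<nu>S: "\<nu>' (Suc ?k) = \<nu>' ?k * \<rho> ?k" by (simp add: \<nu>'_def)
    have "(\<rho> ?k)\<^sup>2 * e ?k + K \<le> (\<rho> ?k)\<^sup>2 * ((\<nu>' ?k)\<^sup>2 * R ?k) + (\<nu>' (Suc ?k))\<^sup>2 * K"
      using Suc.IH K mult_right_mono[OF one_le_power[OF \<nu>1[of "Suc ?k"], of 2] K]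
      by (intro add_mono mult_left_mono) auto
    also have "\<dots> = (\<nu>' (Suc ?k))\<^sup>2 * (R ?k + K)"
      unfolding \<nu>S by (simp add: power_mult_distrib algebra_simps)
    finally have "1 / (1 + b) * ((\<rho> ?k)\<^sup>2 * e ?k + K) \<le> 1 / (1 + b) * ((\<nu>' (Suc ?k))\<^sup>2 * (R ?k + K))"
      using b by (intro mult_left_mono) auto
    also have "1 / (1 + b) * (R ?k + K) = R (Suc ?k)"
    proof -
      have "K / b + K = (1 + b) * (K / b)" using b by (simp add: field_simps)
      then have "1 / (1 + b) * (K / b + K) = K / b" using b by simp
      then show ?thesis unfolding R_def by (simp add: distrib_left add_divide_distrib)
    qed
    then have "1 / (1 + b) * ((\<nu>' (Suc ?k))\<^sup>2 * (R ?k + K)) = (\<nu>' (Suc ?k))\<^sup>2 * R (Suc ?k)"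
      by (metis mult.left_commute)
    finally show ?case using rec[of ?k] by simp
  qed
  from this[of "k - 1"] have "e k \<le> (\<nu>' k)\<^sup>2 * R k" using k by simp
  also have "\<nu>' k \<le> \<nu>"
  proof (rule incseq_le)
    show "incseq \<nu>'"
    proof (rule incseq_SucI)
      fix j show "\<nu>' j \<le> \<nu>' (Suc j)"
        using \<nu>1[of j] \<rho>1[of j] by (simp add: \<nu>'_def mult_le_cancel_left1)
    qed
    show "\<nu>' \<longlonglongrightarrow> \<nu>" using lim by (simp add: \<nu>'_def)
  qed
  then have "(\<nu>' k)\<^sup>2 * R k \<le> \<nu>\<^sup>2 * R k"
    using R0 \<nu>1[of k] by (intro mult_right_mono power_mono) auto
  finally show ?thesis by (simp add: R_def)
qed

text \<open>Without inexactness the contraction factor is \<open>1 / (1 + 2 a)\<close>. The Young weight \<open>\<theta>\<close> is chosen such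
that \<open>1 + \<theta> = (1 + 2 a) / (1 + s a)\<close>: part of the contraction is given up, so that
\<open>1 / (1 + s a)\<close> remains, and in return the weight \<open>1 + 1/\<theta> = (1 + 2 a) / ((2 - s) a)\<close> of the squared accuracy
stays of order \<open>1 / \<alpha>\<close>. Since \<open>\<alpha> < 1 / \<rho>b\<close>, the rate \<open>a / \<alpha>\<close> is bounded below by the constant \<open>c1t\<close>,
which does not depend on \<open>\<alpha>\<close>.\<close>

lemma step_constants:
  fixes \<alpha> \<eta> \<tau> c1 s \<gamma> p \<rho>b X :: real
  assumes \<alpha>: "0 < \<alpha>" "\<alpha> < 1 / \<rho>b" and \<eta>: "0 \<le> \<eta>" and \<rho>b: "0 < \<rho>b"
    and w: "(\<tau> + \<eta>) / 2 < c1" and s: "0 < s" "s < 2" and p: "0 \<le> p" and X: "0 \<le> X"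
  defines "a \<equiv> (c1 - (\<tau> + \<eta>) / 2) * \<alpha> / (1 + \<eta> * \<alpha>)"
  defines "\<theta> \<equiv> (2 - s) * a / (1 + s * a)"
  defines "C \<equiv> p + ((1 + (2 * c1 - \<tau>) * \<alpha>) * (2 * (1 + \<eta> * \<alpha>) + s * (2 * c1 - \<tau> - \<eta>) * \<alpha>)) /
       ((2 - s) * (2 * c1 - \<tau> - \<eta>) * (1 + \<eta> * \<alpha>)) * \<gamma>\<^sup>2"
  defines "c1t \<equiv> \<rho>b * (c1 - (\<tau> + \<eta>) / 2) / (\<rho>b + \<eta>)"
  shows "0 < \<theta>" and "0 \<le> C" and "0 < c1t"
    and "(1 + \<theta>) / (1 + (2 * c1 - \<tau>) * \<alpha>) * ((1 + \<eta> * \<alpha>) * X + \<alpha>\<^sup>2 * p) + (1 + 1 / \<theta>) * (\<gamma>\<^sup>2 * \<alpha> ^ 3)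
      \<le> 1 / (1 + s * c1t * \<alpha>) * (X + \<alpha>\<^sup>2 * C)"
proof -
  define u where "u = 1 + \<eta> * \<alpha>"
  define w where "w = 2 * c1 - \<tau> - \<eta>"
  have u: "1 \<le> u" using \<eta> \<alpha> by (simp add: u_def)
  have w0: "0 < w" using w by (simp add: w_def)
  have half: "c1 - (\<tau> + \<eta>) / 2 = w / 2" by (simp add: w_def field_simps)
  have den: "1 + (2 * c1 - \<tau>) * \<alpha> = u + w * \<alpha>" by (simp add: u_def w_def algebra_simps)
  have a: "a = w * \<alpha> / (2 * u)" unfolding a_def half u_def[symmetric] by simp
  have a0: "0 < a" unfolding a using u w0 \<alpha> by simp
  have sa: "0 < 1 + s * a" using s a0 by (simp add: add_pos_pos)
  show \<theta>0: "0 < \<theta>" unfolding \<theta>_def using a0 s sa by (intro divide_pos_pos mult_pos_pos) auto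
  define Q where "Q = (u + w * \<alpha>) * (2 * u + s * w * \<alpha>) / ((2 - s) * w * u)"
  have Q0: "0 \<le> Q" unfolding Q_def using u w0 \<alpha> s by simp
  have C: "C = p + Q * \<gamma>\<^sup>2" unfolding C_def Q_def den u_def[symmetric] w_def[symmetric] by simp
  show C0: "0 \<le> C" unfolding C using p Q0 by simp
  show c1t0: "0 < c1t" unfolding c1t_def half using \<rho>b \<eta> w0 by simp
  have 2: "1 + 2 * a = (u + w * \<alpha>) / u" unfolding a using u by (simp add: field_simps)
  have uw: "0 < u + w * \<alpha>" using u w0 \<alpha> by (simp add: add_pos_pos)
  have \<theta>1: "1 + \<theta> = (1 + 2 * a) / (1 + s * a)" unfolding \<theta>_def using sa by (simp add: field_simps)
  have \<theta>2: "1 + 1 / \<theta> = (1 + 2 * a) / ((2 - s) * a)"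
    unfolding \<theta>_def using sa a0 s by (simp add: field_simps)
  have A: "(1 + \<theta>) / (u + w * \<alpha>) = 1 / (1 + s * a) * (1 / u)"
    unfolding \<theta>1 2 using uw by simp
  have B: "(1 + 1 / \<theta>) * (\<gamma>\<^sup>2 * \<alpha> ^ 3) = 1 / (1 + s * a) * (\<alpha>\<^sup>2 * (Q * \<gamma>\<^sup>2))"
  proof -
    have "(1 + s * a) * (1 + 1 / \<theta>) * \<alpha> = Q"
    proof -
      have "(1 + s * a) = (2 * u + s * w * \<alpha>) / (2 * u)" unfolding a using u by (simp add: field_simps)
      moreover have "(1 + 1 / \<theta>) * \<alpha> = 2 * (u + w * \<alpha>) / ((2 - s) * w)"
        unfolding \<theta>2 2 unfolding a using u w0 s \<alpha> by (simp add: field_simps)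
      ultimately have "(1 + s * a) * ((1 + 1 / \<theta>) * \<alpha>)
          = (2 * u + s * w * \<alpha>) / (2 * u) * (2 * (u + w * \<alpha>) / ((2 - s) * w))" by simp
      moreover have "p / (2 * u) * (2 * Y / Z) = Y * p / (Z * u)" for p Y Z :: real
        by (simp add: mult.commute)
      ultimately have "(1 + s * a) * ((1 + 1 / \<theta>) * \<alpha>) = Q" unfolding Q_def by metis
      then show ?thesis by (simp add: mult.assoc)
    qed
    then have "1 / (1 + s * a) * (\<alpha>\<^sup>2 * (Q * \<gamma>\<^sup>2))
        = 1 / (1 + s * a) * (\<alpha>\<^sup>2 * (((1 + s * a) * (1 + 1 / \<theta>) * \<alpha>) * \<gamma>\<^sup>2))" by simp
    also have "\<dots> = (1 + 1 / \<theta>) * (\<gamma>\<^sup>2 * \<alpha> ^ 3)"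
      using sa by (simp add: power2_eq_square power3_eq_cube)
    finally show ?thesis ..
  qed
  have "(1 + \<theta>) / (u + w * \<alpha>) * (u * X + \<alpha>\<^sup>2 * p) + (1 + 1 / \<theta>) * (\<gamma>\<^sup>2 * \<alpha> ^ 3)
      = 1 / (1 + s * a) * (X + \<alpha>\<^sup>2 * p / u + \<alpha>\<^sup>2 * (Q * \<gamma>\<^sup>2))"
  proof -
    have h: "1 / u * (u * X + \<alpha>\<^sup>2 * p) = X + \<alpha>\<^sup>2 * p / u" using u by (simp add: field_simps)
    have "1 / (1 + s * a) * (1 / u) * (u * X + \<alpha>\<^sup>2 * p) = 1 / (1 + s * a) * (X + \<alpha>\<^sup>2 * p / u)"
      unfolding h[symmetric] by (rule mult.assoc)
    then show ?thesis unfolding A B by (simp only: distrib_left[symmetric])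
  qed
  also have "\<dots> \<le> 1 / (1 + s * a) * (X + \<alpha>\<^sup>2 * C)"
  proof (intro mult_left_mono)
    have "\<alpha>\<^sup>2 * p * 1 \<le> \<alpha>\<^sup>2 * p * u" using u p by (intro mult_left_mono) auto
    then have "\<alpha>\<^sup>2 * p / u \<le> \<alpha>\<^sup>2 * p" using u by (simp add: divide_le_eq)
    then show "X + \<alpha>\<^sup>2 * p / u + \<alpha>\<^sup>2 * (Q * \<gamma>\<^sup>2) \<le> X + \<alpha>\<^sup>2 * C" unfolding C by (simp add: distrib_left)
  qed (use sa in auto)
  also have "\<dots> \<le> 1 / (1 + s * c1t * \<alpha>) * (X + \<alpha>\<^sup>2 * C)"
  proof (intro mult_right_mono)
    have "\<rho>b * u \<le> \<rho>b + \<eta>"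
    proof -
      have "\<rho>b * \<alpha> \<le> 1" using \<alpha> \<rho>b by (simp add: field_simps)
      from mult_left_mono[OF this \<eta>] show ?thesis by (simp add: u_def algebra_simps)
    qed
    then have "\<rho>b / (\<rho>b + \<eta>) \<le> 1 / u" using u \<rho>b \<eta> by (simp add: field_simps)
    then have "\<rho>b / (\<rho>b + \<eta>) * (w / 2 * \<alpha>) \<le> 1 / u * (w / 2 * \<alpha>)"
      using w0 \<alpha> by (intro mult_right_mono) auto
    then have "c1t * \<alpha> \<le> a" unfolding c1t_def half a by (simp add: mult_ac)
    then have "s * (c1t * \<alpha>) \<le> s * a" using s by (intro mult_left_mono) auto
    moreover have "0 < s * (c1t * \<alpha>)" using s c1t0 \<alpha> by simp
    ultimately show "1 / (1 + s * a) \<le> 1 / (1 + s * c1t * \<alpha>)"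
      by (intro divide_left_mono) (auto simp: mult.assoc)
    show "0 \<le> X + \<alpha>\<^sup>2 * C" using X C0 by simp
  qed
  finally show "(1 + \<theta>) / (1 + (2 * c1 - \<tau>) * \<alpha>) * ((1 + \<eta> * \<alpha>) * X + \<alpha>\<^sup>2 * p) + (1 + 1 / \<theta>) * (\<gamma>\<^sup>2 * \<alpha> ^ 3)
      \<le> 1 / (1 + s * c1t * \<alpha>) * (X + \<alpha>\<^sup>2 * C)"
    unfolding den u_def[symmetric] .
qed

section \<open>Iterates in a bounded set\<close>

text \<open>The almost sure boundedness event and its set \<open>U\<close> enter through the single assumption \<open>in_U\<close>. Stepsizes
and accuracies may still vary with the iteration; they become constant only in the final recursion.\<close>

locale bounded_ispPPA = P: prob_space P + W: prob_space W
  for P :: "'s measure" and W :: "'w measure" +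
  fixes f :: "'a::euclidean_space \<Rightarrow> 's \<Rightarrow> ereal" and r :: "'a \<Rightarrow> ereal"
    and V U :: "'a set" and fm :: "'a \<Rightarrow> 'a \<Rightarrow> 's \<Rightarrow> real"
    and Lfb :: "'a set \<Rightarrow> 's \<Rightarrow> real" and LFb :: "'a set \<Rightarrow> real"
    and m :: nat and alpha eps :: "nat \<Rightarrow> real"
    and S :: "nat \<Rightarrow> nat \<Rightarrow> 'w \<Rightarrow> 's" and M :: "nat \<Rightarrow> 'w \<Rightarrow> 'a \<Rightarrow> 'a"
    and x1 :: 'a and x :: "nat \<Rightarrow> 'w \<Rightarrow> 'a"
    and mu L rho :: "nat \<Rightarrow> real" and mu_inf L_inf nu_inf :: real
    and etab taub tau c1b :: real and Xstar :: "'a set"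
  assumes model: "model_functions P r V fm"
    and accuracy: "model_accuracy P f V fm etab"
    and precond: "preconditioner_condition W P m S M mu L rho mu_inf L_inf nu_inf"
    and regular: "regularity P f r V fm taub"
    and lipschitz: "local_lipschitz_condition P V fm Lfb LFb"
    and growth: "quadratic_growth (objective P f r) c1b"
    and Xstar_def: "Xstar = argmin_set (objective P f r)" and Xstar_nonempty: "Xstar \<noteq> {}"
    and tau_def: "tau = L_inf\<^sup>2 * taub"
    and algorithm: "ispPPA W P fm r m tau alpha eps S M x1 x"
    and U: "bounded U" "convex U" "open U" "U \<subseteq> V"
    and in_U: "AE \<omega> in W. \<forall>k\<ge>1. x k \<omega> \<in> U \<and> exact_step fm r m alpha S M x k \<omega> \<in> U"
begin

abbreviation F :: "'a \<Rightarrow> real" where "F \<equiv> expected_loss P f"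

abbreviation past :: "nat \<Rightarrow> 'w measure" where "past k \<equiv> sample_sigma W P m S k"

lemma r_facts: "r y \<noteq> -\<infinity>" "\<exists>y. r y \<noteq> \<infinity>"
  using regular by (auto simp: regularity_def proper_closed_def)

lemma m_pos: "1 \<le> m" and iid: "iid_samples W P m S"
  using algorithm by (auto simp: ispPPA_def)

lemma constants: "0 < mu_inf" "mu_inf \<le> 1" "1 \<le> L_inf" "0 \<le> taub" "0 < c1b"
  using precond regular growth by (auto simp: preconditioner_condition_def regularity_def quadratic_growth_def)

lemma sub_past: "subalgebra W (past k)"
  by (rule sample_sigma_subalgebra[OF W.prob_space_axioms iid])

lemma domain_in_V: "r y \<noteq> \<infinity> \<Longrightarrow> y \<in> V"
  using model by (auto simp: model_functions_def edom_def)

lemma finite_loss: "AE s in P. \<forall>y\<in>V. f y s = ereal (fm y y s)"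
  using accuracy unfolding model_accuracy_def by (rule AE_mp) (auto intro!: AE_I2)

lemma accuracy_real:
  "AE s in P. \<forall>y\<in>V. \<forall>z\<in>V. \<bar>fm y z s - real_of_ereal (f z s)\<bar> \<le> etab / 2 * (norm (z - y))\<^sup>2"
  using accuracy finite_loss unfolding model_accuracy_def
proof eventually_elim
  case (elim s)
  show ?case
  proof (intro ballI)
    fix y z assume "y \<in> V" "z \<in> V"
    then have "\<bar>ereal (fm y z s) - f z s\<bar> \<le> ereal (etab / 2 * (norm (z - y))\<^sup>2)" "f z s = ereal (fm z z s)"
      using elim by blast+
    then show "\<bar>fm y z s - real_of_ereal (f z s)\<bar> \<le> etab / 2 * (norm (z - y))\<^sup>2" by simp
  qed
qed

text \<open>The open set \<open>V\<close> is nonempty because \<open>r\<close> is proper, so it contains two distinct points, at which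
the accuracy bound must be nonnegative.\<close>

lemma etab_nonneg: "0 \<le> etab"
proof -
  obtain y where y: "y \<in> V" using r_facts(2) domain_in_V by blast
  have "open V" using model by (simp add: model_functions_def)
  then obtain e where e: "e > 0" "ball y e \<subseteq> V" using y by (rule openE) blast
  obtain b :: 'a where b: "b \<in> Basis" using nonempty_Basis by blast
  define z where "z = y + (e / 2) *\<^sub>R b"
  have "z \<in> ball y e" using e b by (simp add: z_def dist_norm)
  then have z: "z \<in> V" using e by blast
  have n: "norm (z - y) = e / 2" using e b by (simp add: z_def)
  have d: "0 < (norm (z - y))\<^sup>2" unfolding n using e by simp
  have "AE s in P. 0 \<le> etab"
    using accuracy_real
  proof eventually_elim
    case (elim s)
    then have "0 \<le> etab / 2 * (norm (z - y))\<^sup>2" using y z by (meson abs_ge_zero order_trans)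
    then show ?case using d by (simp add: zero_le_mult_iff)
  qed
  then show ?thesis by (metis P.AE_const)
qed

lemma optimal_point:
  assumes q: "q \<in> Xstar"
  shows "r q \<noteq> \<infinity>" "q \<in> V"
    and "ereal (F q) + r q + ereal (c1b * (infdist y Xstar)\<^sup>2) \<le> ereal (F y) + r y"
proof -
  have min: "objective P f r q \<le> objective P f r y" for y
    using q by (auto simp: Xstar_def argmin_set_def is_arg_min_def not_less)
  obtain y0 where "r y0 \<noteq> \<infinity>" using r_facts by blast
  then show rq: "r q \<noteq> \<infinity>" using min[of y0] r_facts(1)[of y0] by (cases "r y0") (auto simp: objective_def)
  show "q \<in> V" using domain_in_V[OF rq] .
  have "(INF y. objective P f r y) = objective P f r q"
    by (intro antisym INF_lower INF_greatest min) auto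
  then show "ereal (F q) + r q + ereal (c1b * (infdist y Xstar)\<^sup>2) \<le> ereal (F y) + r y"
    using growth by (auto simp: quadratic_growth_def objective_def Xstar_def)
qed

lemma loss_integrable: "integrable P (\<lambda>s. real_of_ereal (f y s))"
  using regular by (simp add: regularity_def)

lemma Lfb_facts:
  shows "Lfb U \<in> borel_measurable P" "s \<in> space P \<Longrightarrow> 0 \<le> Lfb U s"
    "integrable P (\<lambda>s. (Lfb U s)\<^sup>2)" "0 \<le> LFb U" "sqrt (\<integral>s. (Lfb U s)\<^sup>2 \<partial>P) \<le> LFb U"
    "AE s in P. \<forall>x\<in>U. \<forall>y\<in>U. \<bar>fm x x s - fm x y s\<bar> \<le> Lfb U s * norm (x - y)"
    "integrable P (Lfb U)" "0 \<le> (\<integral>s. Lfb U s \<partial>P)"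
proof -
  show 1: "Lfb U \<in> borel_measurable P" "s \<in> space P \<Longrightarrow> 0 \<le> Lfb U s"
    "integrable P (\<lambda>s. (Lfb U s)\<^sup>2)" "0 \<le> LFb U" "sqrt (\<integral>s. (Lfb U s)\<^sup>2 \<partial>P) \<le> LFb U"
    "AE s in P. \<forall>x\<in>U. \<forall>y\<in>U. \<bar>fm x x s - fm x y s\<bar> \<le> Lfb U s * norm (x - y)" for s
    using lipschitz U unfolding local_lipschitz_condition_def by blast+
  show "integrable P (Lfb U)" using P.square_integrable_imp_integrable[OF 1(1,3)] .
  show "0 \<le> (\<integral>s. Lfb U s \<partial>P)" using 1(2) by (intro Bochner_Integration.integral_nonneg) auto
qed

text \<open>The sample losses inherit the Lipschitz constant of the models up to a quadratic error. For the
expected loss the error disappears by subdivision (lemma \<open>expected_loss_lipschitz\<close>).\<close>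

lemma loss_difference:
  "AE s in P. \<forall>y\<in>U. \<forall>z\<in>U. \<bar>fm y y s - fm z z s\<bar> \<le> Lfb U s * norm (y - z) + etab / 2 * (norm (y - z))\<^sup>2"
  using accuracy_real finite_loss Lfb_facts(6)
proof eventually_elim
  case (elim s)
  show ?case
  proof (intro ballI)
    fix y z assume yz: "y \<in> U" "z \<in> U"
    then have "y \<in> V" "z \<in> V" using U by auto
    then have "\<bar>fm y z s - real_of_ereal (f z s)\<bar> \<le> etab / 2 * (norm (z - y))\<^sup>2" "f z s = ereal (fm z z s)"
      using elim by blast+
    moreover have "\<bar>fm y y s - fm y z s\<bar> \<le> Lfb U s * norm (y - z)" using elim yz by blast
    ultimately show "\<bar>fm y y s - fm z z s\<bar> \<le> Lfb U s * norm (y - z) + etab / 2 * (norm (y - z))\<^sup>2"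
      by (simp only: norm_minus_commute real_of_ereal.simps)
  qed
qed

lemma expected_loss_lipschitz:
  assumes "y \<in> U" "z \<in> U"
  shows "\<bar>F y - F z\<bar> \<le> (\<integral>s. Lfb U s \<partial>P) * norm (y - z)"
proof (rule lipschitz_of_quadratic_perturbation[OF U(2) assms])
  fix u v assume uv: "u \<in> U" "v \<in> U"
  have "F u - F v = (\<integral>s. real_of_ereal (f u s) - real_of_ereal (f v s) \<partial>P)"
    unfolding expected_loss_def by (rule Bochner_Integration.integral_diff[symmetric]) (rule loss_integrable)+
  then have "\<bar>F u - F v\<bar> \<le> (\<integral>s. \<bar>real_of_ereal (f u s) - real_of_ereal (f v s)\<bar> \<partial>P)"
    by (simp add: integral_abs_bound)
  also have "\<dots> \<le> (\<integral>s. Lfb U s * norm (u - v) + etab / 2 * (norm (u - v))\<^sup>2 \<partial>P)"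
  proof (rule integral_mono_AE)
    show "integrable P (\<lambda>s. \<bar>real_of_ereal (f u s) - real_of_ereal (f v s)\<bar>)"
      using loss_integrable by auto
    show "integrable P (\<lambda>s. Lfb U s * norm (u - v) + etab / 2 * (norm (u - v))\<^sup>2)"
      using Lfb_facts(7) by auto
    show "AE s in P. \<bar>real_of_ereal (f u s) - real_of_ereal (f v s)\<bar> \<le> Lfb U s * norm (u - v) + etab / 2 * (norm (u - v))\<^sup>2"
      using loss_difference finite_loss
    proof eventually_elim
      case (elim s)
      have "f u s = ereal (fm u u s)" "f v s = ereal (fm v v s)" using elim(2) uv U by auto
      then show ?case using elim(1) uv by simp
    qed
  qed
  also have "\<dots> = (\<integral>s. Lfb U s \<partial>P) * norm (u - v) + etab / 2 * (norm (u - v))\<^sup>2"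
    using Lfb_facts(7) by (simp add: P.prob_space)
  finally show "\<bar>F u - F v\<bar> \<le> (\<integral>s. Lfb U s \<partial>P) * norm (u - v) + etab / 2 * (norm (u - v))\<^sup>2" .
qed

lemma U_nonempty: "U \<noteq> {}"
proof -
  have "AE \<omega> in W. U \<noteq> {}" using in_U by eventually_elim auto
  then show ?thesis by (metis W.AE_const)
qed

text \<open>A measurable map of the whole space into \<open>U\<close> that fixes \<open>U\<close>. The models are measurable only as
functions on \<open>V\<close>, and the iterates lie in \<open>U\<close> only almost surely; composing with this map gives
functions that are defined and measurable everywhere.\<close>

definition retract :: "'a \<Rightarrow> 'a" where
  "retract y = (if y \<in> U then y else (SOME u. u \<in> U))"

lemma retract_in: "retract y \<in> U"
  using U_nonempty by (auto simp: retract_def some_in_eq)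

lemma retract_id: "y \<in> U \<Longrightarrow> retract y = y" by (simp add: retract_def)

lemma loss_jointly_measurable:
  "(\<lambda>(y, s). fm (retract y) (retract y) s) \<in> borel_measurable (borel \<Otimes>\<^sub>M P)"
proof -
  have [measurable]: "U \<in> sets borel" using U(3) by simp
  have "retract \<in> measurable borel borel"
    unfolding retract_def by measurable
  then have [measurable]: "retract \<in> measurable borel (restrict_space borel V)"
    using retract_in U(4) by (intro measurable_restrict_space2) auto
  have fm: "(\<lambda>(x, y, s). fm x y s)
       \<in> borel_measurable (restrict_space borel V \<Otimes>\<^sub>M (restrict_space borel V \<Otimes>\<^sub>M P))"
    using model by (simp add: model_functions_def)
  have "(\<lambda>(y, s). (retract y, retract y, s)) \<in> measurable (borel \<Otimes>\<^sub>M P) (restrict_space borel V \<Otimes>\<^sub>M (restrict_space borel V \<Otimes>\<^sub>M P))"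
    by measurable
  from measurable_compose[OF this fm]
  show ?thesis by (simp add: case_prod_unfold)
qed

lemma expected_model_loss: "y \<in> U \<Longrightarrow> (\<integral>s. fm (retract y) (retract y) s \<partial>P) = F y"
  unfolding expected_loss_def
proof (rule integral_cong_AE)
  assume y: "y \<in> U"
  show "AE s in P. fm (retract y) (retract y) s = real_of_ereal (f y s)"
    using finite_loss by eventually_elim (use y U in \<open>auto simp: retract_id\<close>)
  show "(\<lambda>s. fm (retract y) (retract y) s) \<in> borel_measurable P"
    using measurable_compose[OF measurable_Pair1'[of y borel P] loss_jointly_measurable] by simp
  show "(\<lambda>s. real_of_ereal (f y s)) \<in> borel_measurable P" using loss_integrable[of y] by auto
qed

lemma model_loss_integrable: "integrable P (fm (retract y) (retract y))"
proof (rule integrable_cong_AE_imp[OF loss_integrable[of "retract y"]])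
  show "fm (retract y) (retract y) \<in> borel_measurable P"
    using measurable_compose[OF measurable_Pair1'[of y borel P] loss_jointly_measurable] by simp
  show "AE s in P. real_of_ereal (f (retract y) s) = fm (retract y) (retract y) s"
    using finite_loss
  proof eventually_elim
    case (elim s)
    have "retract y \<in> V" using retract_in U(4) by blast
    then show ?case using elim by simp
  qed
qed

lemma sample_AE:
  assumes "AE s in P. Q s" "1 \<le> k"
  shows "AE \<omega> in W. \<forall>i\<in>{1..m}. Q (S k i \<omega>)"
proof (intro AE_finite_allI)
  fix i assume i: "i \<in> {1..m}"
  note S = iid_samplesD[OF W.prob_space_axioms iid assms(2) i]
  have "AE s in distr W P (S k i). Q s" unfolding S(2) by (rule assms)
  then show "AE \<omega> in W. Q (S k i \<omega>)" by (rule AE_distrD[OF S(1)])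
qed simp

lemma sample_integral:
  fixes g :: "'s \<Rightarrow> real"
  assumes "integrable P g" "1 \<le> k" "i \<in> {1..m}"
  shows "integrable W (\<lambda>\<omega>. g (S k i \<omega>))" "(\<integral>\<omega>. g (S k i \<omega>) \<partial>W) = (\<integral>s. g s \<partial>P)"
proof -
  note S = iid_samplesD[OF W.prob_space_axioms iid assms(2,3)]
  have [measurable]: "g \<in> borel_measurable P" using assms(1) by simp
  show "integrable W (\<lambda>\<omega>. g (S k i \<omega>))"
    using integrable_distr_eq[OF S(1), of g] S(2) assms(1) by simp
  show "(\<integral>\<omega>. g (S k i \<omega>) \<partial>W) = (\<integral>s. g s \<partial>P)"
    using integral_distr[OF S(1), of g] S(2) by simp
qed

lemma x_measurable: "1 \<le> k \<Longrightarrow> x k \<in> borel_measurable (past (k - 1))"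
proof (cases "k = 1")
  case True
  have "space (past 0) = space W" using sub_past[of 0] by (simp add: subalgebra_def)
  moreover have "\<forall>\<omega>\<in>space W. x 1 \<omega> = x1" using algorithm by (simp add: ispPPA_def)
  ultimately have "x 1 \<in> borel_measurable (past 0) \<longleftrightarrow> (\<lambda>_. x1) \<in> borel_measurable (past 0)"
    by (intro measurable_cong) auto
  then show ?thesis using True by simp
next
  case False
  assume "1 \<le> k"
  then obtain j where "k = Suc j" "1 \<le> j" using False by (cases k) auto
  then show ?thesis using algorithm by (simp add: ispPPA_def)
qed

lemma M_0: "\<omega> \<in> space W \<Longrightarrow> M 0 \<omega> = (\<lambda>v. v)"
  using precond by (auto simp: preconditioner_condition_def)

lemma M_measurable: "(\<lambda>\<omega>. M k \<omega> v) \<in> borel_measurable (past k)"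
proof (cases "k = 0")
  case True
  have "space (past 0) = space W" using sub_past[of 0] by (simp add: subalgebra_def)
  then have "(\<lambda>\<omega>. M 0 \<omega> v) \<in> borel_measurable (past 0) \<longleftrightarrow> (\<lambda>_. v) \<in> borel_measurable (past 0)"
    by (intro measurable_cong) (auto simp: M_0)
  then show ?thesis using True by simp
next
  case False
  then show ?thesis using algorithm by (simp add: ispPPA_def)
qed

lemma M_good: "AE \<omega> in W. pos_def_map (M k \<omega>) \<and> (\<forall>v. mu_inf * normM (M k \<omega>) v \<le> norm v)
    \<and> (\<forall>v. norm v \<le> L_inf * normM (M k \<omega>) v)"
proof (cases "k = 0")
  case True
  show ?thesis
  proof (rule AE_I2)
    fix \<omega> assume "\<omega> \<in> space W"
    then have "M k \<omega> = (\<lambda>v. v)" using True M_0 by simp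
    then show "pos_def_map (M k \<omega>) \<and> (\<forall>v. mu_inf * normM (M k \<omega>) v \<le> norm v)
      \<and> (\<forall>v. norm v \<le> L_inf * normM (M k \<omega>) v)"
      using constants by (auto simp: pos_def_map_id normM_id mult_le_cancel_right1 mult_le_cancel_right2)
  qed
next
  case False
  then have k: "1 \<le> k" by simp
  have pd: "AE \<omega> in W. pos_def_map (M k \<omega>)"
    using algorithm k unfolding ispPPA_def by (auto elim: AE_mp)
  have bd: "AE \<omega> in W. \<forall>v. mu k * normM (M k \<omega>) v \<le> norm v \<and> norm v \<le> L k * normM (M k \<omega>) v"
    and c: "mu_inf \<le> mu k" "L k \<le> L_inf"
    using precond k by (auto simp: preconditioner_condition_def)
  show ?thesis
    using pd bd
  proof eventually_elim
    case (elim \<omega>)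
    have "mu_inf * normM (M k \<omega>) v \<le> norm v" for v
      using elim(2) mult_right_mono[OF c(1) normM_nonneg[OF elim(1), of v]] order_trans by blast
    moreover have "norm v \<le> L_inf * normM (M k \<omega>) v" for v
      using elim(2) mult_right_mono[OF c(2) normM_nonneg[OF elim(1), of v]] order_trans by blast
    ultimately show ?case using elim by blast
  qed
qed

section \<open>One iteration\<close>

lemma dense_sequence: "\<exists>q::nat \<Rightarrow> 'a. range q \<subseteq> Xstar \<and> Xstar \<subseteq> closure (range q)"
proof -
  obtain T where T: "countable T" "T \<subseteq> Xstar" "Xstar \<subseteq> closure T" by (rule separable)
  have "T \<noteq> {}" using T Xstar_nonempty by auto
  then have "range (from_nat_into T) = T" using T(1) by simp
  then show ?thesis using T by metis
qed

text \<open>The stochastic part of the bound on one step, for the solution \<open>q\<close>: the squared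
Lipschitz term and the difference of the sampling errors at \<open>q\<close> and at the current iterate.\<close>

definition noise :: "real \<Rightarrow> 'a \<Rightarrow> nat \<Rightarrow> 'w \<Rightarrow> real" where
  "noise a q k \<omega> =
     a\<^sup>2 * ((\<Sum>i=1..m. L_inf * Lfb U (S k i \<omega>)) / real m + L_inf * (\<integral>s. Lfb U s \<partial>P))\<^sup>2
     + 2 * a * (((\<Sum>i=1..m. real_of_ereal (f q (S k i \<omega>))) / real m - F q)
       - ((\<Sum>i=1..m. fm (retract (x k \<omega>)) (retract (x k \<omega>)) (S k i \<omega>)) / real m
          - (\<integral>s. fm (retract (x k \<omega>)) (retract (x k \<omega>)) s \<partial>P)))"

text \<open>Combine \<open>exact_step_inequality\<close> at the solution \<open>q n\<close> with quadratic growth, bound both distances of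
the exact proximal point from below by the distance to the whole sequence, and pass to the actual
iterate by Young's inequality.\<close>

lemma step_inequality:
  assumes k: "1 \<le> k" and a: "alpha k = a" "0 < a" "tau * a < 1" and \<theta>: "0 < \<theta>"
    and q: "range q \<subseteq> Xstar" "Xstar \<subseteq> closure (range q)"
  defines "c1 \<equiv> mu_inf\<^sup>2 * c1b" and "eta \<equiv> L_inf\<^sup>2 * etab"
  shows "AE \<omega> in W. sqdist (M k \<omega>) q (x (Suc k) \<omega>)
    \<le> (1 + \<theta>) / (1 + (2 * c1 - tau) * a)
        * ((1 + eta * a) * sqnorm (M k \<omega>) (q n - x k \<omega>) + noise a (q n) k \<omega>)
      + (1 + 1 / \<theta>) * (eps k)\<^sup>2"
proof -
  have wcP: "AE s in P. \<forall>y\<in>V. weakly_convex taub (model_phi fm r y s)"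
    using regular unfolding regularity_def by (auto elim: AE_mp)
  have inexact: "AE \<omega> in W. inexact_prox tau (M k \<omega>) (alpha k) (eps k)
      (minibatch_phi fm r m (x k \<omega>) (\<lambda>i. S k i \<omega>)) (x k \<omega>) (x (Suc k) \<omega>)"
    and eps: "0 \<le> eps k"
    using algorithm k unfolding ispPPA_def by (auto elim: AE_mp)
  have qn: "q n \<in> Xstar" using q by auto
  note opt = optimal_point[OF qn]
  show ?thesis
    using M_good[of k] in_U sample_AE[OF wcP k] sample_AE[OF accuracy_real k]
      sample_AE[OF Lfb_facts(6) k] inexact AE_space
  proof eventually_elim
    case (elim \<omega>)
    define y where "y = x k \<omega>"
    define ss where "ss = (\<lambda>i. S k i \<omega>)"
    define z where "z = prox (M k \<omega>) a (minibatch_phi fm r m y ss) y"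
    have pd: "pos_def_map (M k \<omega>)" and lo: "\<And>v. mu_inf * normM (M k \<omega>) v \<le> norm v"
      and up: "\<And>v. norm v \<le> L_inf * normM (M k \<omega>) v" using elim(1) by blast+
    have yU: "y \<in> U" and zU: "z \<in> U"
      using elim(2) k a(1) by (auto simp: y_def z_def ss_def exact_step_def)
    then have yV: "y \<in> V" and zV: "z \<in> V" using U by auto
    have wc: "weakly_convex taub (model_phi fm r y (ss i))" if "i \<in> {1..m}" for i
      using elim(3) yV that by (auto simp: ss_def)
    have ta: "L_inf\<^sup>2 * taub * a < 1" using a(3) by (simp add: tau_def)
    have L0: "0 \<le> L_inf" using constants by simp
    have acc: "fm y (q n) (ss i) \<le> real_of_ereal (f (q n) (ss i)) + etab / 2 * (norm (q n - y))\<^sup>2"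
      if "i \<in> {1..m}" for i
    proof -
      have "\<bar>fm y (q n) (S k i \<omega>) - real_of_ereal (f (q n) (S k i \<omega>))\<bar> \<le> etab / 2 * (norm (q n - y))\<^sup>2"
        using elim(4) that yV opt(2) by blast
      then show ?thesis unfolding ss_def by linarith
    qed
    have lip: "\<bar>fm y y (ss i) - fm y z (ss i)\<bar> \<le> Lfb U (ss i) * norm (y - z)" if "i \<in> {1..m}" for i
      using elim(5) that yU zU by (auto simp: ss_def)
    have l0: "0 \<le> Lfb U (ss i)" if "i \<in> {1..m}" for i
    proof -
      have "ss i \<in> space P"
        using iid_samplesD(1)[OF W.prob_space_axioms iid k that] elim(7) by (auto simp: ss_def measurable_def)
      then show ?thesis by (rule Lfb_facts(2))
    qed
    have "(1 - L_inf\<^sup>2 * taub * a) * (normM (M k \<omega>) (q n - z))\<^sup>2 + 2 * a * (c1b * (infdist z Xstar)\<^sup>2)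
      \<le> (1 + L_inf\<^sup>2 * etab * a) * (normM (M k \<omega>) (q n - y))\<^sup>2
        + a\<^sup>2 * ((\<Sum>i=1..m. L_inf * Lfb U (ss i)) / real m + L_inf * (\<integral>s. Lfb U s \<partial>P))\<^sup>2
        + 2 * a * (((\<Sum>i=1..m. real_of_ereal (f (q n) (ss i))) / real m - F (q n))
           - ((\<Sum>i=1..m. fm y y (ss i)) / real m - F y))"
      by (rule exact_step_inequality[where g = "\<lambda>y. c1b * (infdist y Xstar)\<^sup>2",
            OF m_pos r_facts(1) wc pd up L0 constants(4) a(2) ta etab_nonneg opt(3) opt(1)
              acc lip expected_loss_lipschitz[OF yU zU] Lfb_facts(8) l0 z_def])
    then have main: "(1 - tau * a) * (normM (M k \<omega>) (q n - z))\<^sup>2 + 2 * a * (c1b * (infdist z Xstar)\<^sup>2)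
      \<le> (1 + eta * a) * sqnorm (M k \<omega>) (q n - y) + noise a (q n) k \<omega>"
      using yU unfolding noise_def tau_def eta_def ss_def y_def[symmetric]
      by (simp add: retract_id expected_model_loss[of y, simplified retract_id[OF yU]] sqnorm_eq[OF pd])
    have "(1 - tau * a) * sqdist (M k \<omega>) q z \<le> (1 - tau * a) * (normM (M k \<omega>) (q n - z))\<^sup>2"
      using sqdist_le[of "M k \<omega>" q z n] a(3) normM_minus_commute[OF pd, of "q n" z]
      by (intro mult_left_mono) (auto simp: sqnorm_eq[OF pd])
    moreover have "2 * a * (c1b * (mu_inf\<^sup>2 * sqdist (M k \<omega>) q z)) \<le> 2 * a * (c1b * (infdist z Xstar)\<^sup>2)"
      using sqdist_le_infdist[OF pd _ lo q(2) Xstar_nonempty] constants a(2)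
      by (intro mult_left_mono) auto
    ultimately have "(1 - tau * a) * sqdist (M k \<omega>) q z + 2 * a * (c1b * (mu_inf\<^sup>2 * sqdist (M k \<omega>) q z))
      \<le> (1 + eta * a) * sqnorm (M k \<omega>) (q n - y) + noise a (q n) k \<omega>"
      using main by linarith
    then have "(1 + (2 * c1 - tau) * a) * sqdist (M k \<omega>) q z
      \<le> (1 + eta * a) * sqnorm (M k \<omega>) (q n - y) + noise a (q n) k \<omega>"
      by (simp add: c1_def algebra_simps)
    moreover have den: "0 < 1 + (2 * c1 - tau) * a"
    proof -
      have "0 < 2 * c1 * a" unfolding c1_def using constants a(2) by simp
      then show ?thesis using a(3) by (simp add: algebra_simps)
    qed
    ultimately have exact: "sqdist (M k \<omega>) q z
      \<le> ((1 + eta * a) * sqnorm (M k \<omega>) (q n - y) + noise a (q n) k \<omega>) / (1 + (2 * c1 - tau) * a)"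
      by (simp add: pos_le_divide_eq mult.commute)
    note sc = minibatch_prox_objective_strongly_convex[where fm = fm and x = y and ss = ss and a = a,
        OF m_pos r_facts(1) wc pd up constants(4)]
    note minz = minibatch_prox_minimizes[where fm = fm and x = y and ss = ss and a = a,
        OF m_pos r_facts(1) opt(1) wc pd up constants(4) a(2) ta]
    obtain b where b: "prox_objective (M k \<omega>) a (minibatch_phi fm r m y ss) y z = ereal b"
      using minz(2) unfolding z_def by blast
    have "normM (M k \<omega>) (x (Suc k) \<omega> - prox (M k \<omega>) a (minibatch_phi fm r m y ss) y) \<le> eps k"
      using inexact_prox_distance[OF pd a(2,3) eps sc[folded tau_def] minz(1) b[unfolded z_def]]
        elim(6) unfolding a(1) y_def ss_def by blast
    then have "sqdist (M k \<omega>) q (x (Suc k) \<omega>) \<le> (1 + \<theta>) * sqdist (M k \<omega>) q z + (1 + 1 / \<theta>) * (eps k)\<^sup>2"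
      unfolding z_def by (rule sqdist_perturb[OF pd \<theta>])
    also have "\<dots> \<le> (1 + \<theta>) * (((1 + eta * a) * sqnorm (M k \<omega>) (q n - y) + noise a (q n) k \<omega>) / (1 + (2 * c1 - tau) * a))
        + (1 + 1 / \<theta>) * (eps k)\<^sup>2"
      using exact \<theta> by (intro add_right_mono mult_left_mono) auto
    finally show ?case by (simp add: y_def)
  qed
qed

text \<open>Given the past, the current iterate is a constant and the samples are fresh, so both sampling
errors average to zero and only the second moment of the Lipschitz term survives.\<close>

lemma noise_conditional_bound:
  assumes k: "1 \<le> k" and a: "0 \<le> a" and q: "q \<in> Xstar"
    and pos: "0 < (\<integral>s. (L_inf * Lfb U s)\<^sup>2 \<partial>P)"
  shows "integrable W (noise a q k)"
    and "AE \<omega> in W. real_cond_exp W (past (k - 1)) (noise a q k) \<omega>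
      \<le> a\<^sup>2 * (rho_const P m (\<lambda>s. L_inf * Lfb U s) * (L_inf * LFb U)\<^sup>2)"
proof -
  define EL where "EL = (\<integral>s. Lfb U s \<partial>P)"
  define G where "G = (\<lambda>y s. fm (retract y) (retract y) s)"
  define FF where "FF = (\<lambda>y. \<integral>s. G y s \<partial>P)"
  define N where "N = PiM {1..m} (\<lambda>_. P)"
  define T where "T = (\<lambda>\<omega>. \<lambda>i\<in>{1..m}. S k i \<omega>)"
  define Z where "Z = (\<lambda>t. ((\<Sum>i=1..m. L_inf * Lfb U (t i)) / real m + L_inf * EL)\<^sup>2)"
  define h where "h = (\<lambda>\<omega> t. a\<^sup>2 * Z t
     + 2 * a * (((\<Sum>i=1..m. real_of_ereal (f q (t i))) / real m - F q)
       - ((\<Sum>i=1..m. G (x k \<omega>) (t i)) / real m - FF (x k \<omega>))))"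
  have m0: "real m > 0" using m_pos by simp
  note Tind = samples_independent_of_past[OF W.prob_space_axioms iid k, folded T_def N_def]
  have noise: "noise a q k = (\<lambda>\<omega>. h \<omega> (T \<omega>))"
    by (rule ext) (simp add: noise_def h_def Z_def EL_def G_def FF_def T_def)
  note [measurable] = x_measurable[OF k] Lfb_facts(1)
  have fq[measurable]: "(\<lambda>s. real_of_ereal (f q s)) \<in> borel_measurable P" using loss_integrable[of q] by auto
  have G[measurable]: "case_prod G \<in> borel_measurable (borel \<Otimes>\<^sub>M P)"
    using loss_jointly_measurable by (simp add: G_def)
  have FF[measurable]: "FF \<in> borel_measurable borel" unfolding FF_def by measurable
  have comp: "(\<lambda>t. t i) \<in> measurable N P" if "i \<in> {1..m}" for i
    unfolding N_def using that by (rule measurable_component_singleton)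
  have meas_h: "(\<lambda>(\<omega>, t). h \<omega> t) \<in> borel_measurable (past (k - 1) \<Otimes>\<^sub>M N)"
  proof -
    have s: "(\<lambda>p. snd p i) \<in> measurable (past (k - 1) \<Otimes>\<^sub>M N) P" if "i \<in> {1..m}" for i
      using measurable_compose[OF measurable_snd comp[OF that]] .
    have 1: "(\<lambda>p. Lfb U (snd p i)) \<in> borel_measurable (past (k - 1) \<Otimes>\<^sub>M N)"
      "(\<lambda>p. real_of_ereal (f q (snd p i))) \<in> borel_measurable (past (k - 1) \<Otimes>\<^sub>M N)"
      if "i \<in> {1..m}" for i
      using measurable_compose[OF s[OF that] Lfb_facts(1)] measurable_compose[OF s[OF that] fq] by auto
    have 2: "(\<lambda>p. G (x k (fst p)) (snd p i)) \<in> borel_measurable (past (k - 1) \<Otimes>\<^sub>M N)" if "i \<in> {1..m}" for i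
    proof -
      have "(\<lambda>p. (x k (fst p), snd p i)) \<in> measurable (past (k - 1) \<Otimes>\<^sub>M N) (borel \<Otimes>\<^sub>M P)"
        using s[OF that] measurable_compose[OF measurable_fst x_measurable[OF k]] by (intro measurable_Pair) auto
      from measurable_compose[OF this G] show ?thesis by simp
    qed
    have 3: "(\<lambda>p. FF (x k (fst p))) \<in> borel_measurable (past (k - 1) \<Otimes>\<^sub>M N)" by measurable
    show ?thesis
      unfolding h_def Z_def case_prod_unfold
      by (intro borel_measurable_add borel_measurable_times borel_measurable_const borel_measurable_diff
          borel_measurable_divide borel_measurable_sum borel_measurable_power 1 2 3)
  qed
  note Zm = minibatch_constant_second_moment[OF W.prob_space_axioms P.prob_space_axioms iid k m_pos,
      of "\<lambda>s. L_inf * Lfb U s" "L_inf * LFb U"]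
  have Lsq: "integrable P (\<lambda>s. (L_inf * Lfb U s)\<^sup>2)" using Lfb_facts(3) by (simp add: power_mult_distrib)
  have LF: "(\<integral>s. (L_inf * Lfb U s)\<^sup>2 \<partial>P) \<le> (L_inf * LFb U)\<^sup>2"
  proof -
    have "0 \<le> (\<integral>s. (Lfb U s)\<^sup>2 \<partial>P)" by (intro Bochner_Integration.integral_nonneg) auto
    then have "(\<integral>s. (Lfb U s)\<^sup>2 \<partial>P) \<le> (LFb U)\<^sup>2"
      using power_mono[OF Lfb_facts(5), of 2] by simp
    then show ?thesis by (simp add: power_mult_distrib mult_left_mono)
  qed
  have L0: "0 \<le> (\<integral>s. L_inf * Lfb U s \<partial>P)" using Lfb_facts(8) constants by simp
  have Lm: "(\<lambda>s. L_inf * Lfb U s) \<in> borel_measurable P" by measurable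
  have ELe: "(\<integral>s. L_inf * Lfb U s \<partial>P) = L_inf * EL" by (simp add: EL_def)
  have ZT: "Z (T \<omega>) = ((\<Sum>i=1..m. L_inf * Lfb U (S k i \<omega>)) / real m + L_inf * EL)\<^sup>2" for \<omega>
    by (simp add: Z_def T_def)
  have intZ: "integrable W (\<lambda>\<omega>. Z (T \<omega>))"
    and EZ: "(\<integral>\<omega>. Z (T \<omega>) \<partial>W) \<le> rho_const P m (\<lambda>s. L_inf * Lfb U s) * (L_inf * LFb U)\<^sup>2"
    unfolding ZT using Zm[OF Lm Lsq pos L0 LF] unfolding ELe by auto
  have Tk: "T \<omega> i = S k i \<omega>" if "i \<in> {1..m}" for \<omega> i using that by (simp add: T_def)
  have mean: "integrable W (\<lambda>\<omega>. (\<Sum>i=1..m. g (T \<omega> i)) / real m)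
      \<and> (\<integral>\<omega>. (\<Sum>i=1..m. g (T \<omega> i)) / real m \<partial>W) = (\<integral>s. g s \<partial>P)"
    if g: "integrable P g" for g :: "'s \<Rightarrow> real"
  proof -
    have T: "integrable W (\<lambda>\<omega>. g (T \<omega> i))" "(\<integral>\<omega>. g (T \<omega> i) \<partial>W) = (\<integral>s. g s \<partial>P)" if "i \<in> {1..m}" for i
      using sample_integral[OF g k that] by (simp_all add: Tk[OF that])
    have "integrable W (\<lambda>\<omega>. \<Sum>i=1..m. g (T \<omega> i))"
      by (intro Bochner_Integration.integrable_sum T)
    moreover have "(\<integral>\<omega>. (\<Sum>i=1..m. g (T \<omega> i)) \<partial>W) = (\<Sum>i=1..m. \<integral>s. g s \<partial>P)"
      using T by (subst Bochner_Integration.integral_sum) auto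
    ultimately show ?thesis using m0 by simp
  qed
  have intq: "integrable W (\<lambda>\<omega>. (\<Sum>i=1..m. real_of_ereal (f q (T \<omega> i))) / real m)"
    and Eq: "(\<integral>\<omega>. (\<Sum>i=1..m. real_of_ereal (f q (T \<omega> i))) / real m \<partial>W) = F q"
    using mean[OF loss_integrable[of q]] by (simp_all add: expected_loss_def)
  have intG1: "integrable W (\<lambda>\<omega>. (\<Sum>i=1..m. G y (T \<omega> i)) / real m)"
    and EG1: "(\<integral>\<omega>. (\<Sum>i=1..m. G y (T \<omega> i)) / real m \<partial>W) = FF y" for y
    using mean[OF model_loss_integrable[of y]] by (simp_all add: G_def FF_def)
  have bU: "\<exists>d. \<forall>y\<in>U. \<forall>z\<in>U. norm (y - z) \<le> d"
    using U(1) by (metis bounded_two_points dist_norm)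
  then obtain d where d: "\<And>y z. y \<in> U \<Longrightarrow> z \<in> U \<Longrightarrow> norm (y - z) \<le> d" by blast
  obtain u0 where u0: "u0 \<in> U" using U_nonempty by blast
  have d0: "0 \<le> d" using d[OF u0 u0] by simp
  \<comment> \<open>an integrable bound uniform in \<open>y\<close>, available because \<open>U\<close> is bounded\<close>
  have Gbound: "AE s in P. \<forall>y. \<bar>G y s\<bar> \<le> \<bar>G u0 s\<bar> + (Lfb U s * d + etab / 2 * d\<^sup>2)"
    using loss_difference AE_space
  proof eventually_elim
    case (elim s)
    show ?case
    proof
      fix y
      have "\<bar>G y s - G u0 s\<bar> \<le> Lfb U s * norm (retract y - retract u0) + etab / 2 * (norm (retract y - retract u0))\<^sup>2"
        using elim(1) retract_in unfolding G_def by blast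
      also have "\<dots> \<le> Lfb U s * d + etab / 2 * d\<^sup>2"
        using d[OF retract_in retract_in, of y u0] Lfb_facts(2)[OF elim(2)] etab_nonneg
        by (intro add_mono mult_left_mono power_mono) auto
      finally show "\<bar>G y s\<bar> \<le> \<bar>G u0 s\<bar> + (Lfb U s * d + etab / 2 * d\<^sup>2)" by linarith
    qed
  qed
  have intGs: "integrable W (\<lambda>\<omega>. G (x k \<omega>) (S k i \<omega>))" if i: "i \<in> {1..m}" for i
  proof (rule Bochner_Integration.integrable_bound)
    have "integrable P (\<lambda>s. \<bar>G u0 s\<bar> + (Lfb U s * d + etab / 2 * d\<^sup>2))"
      using model_loss_integrable[of u0] Lfb_facts(7) by (auto simp: G_def)
    then show "integrable W (\<lambda>\<omega>. \<bar>G u0 (S k i \<omega>)\<bar> + (Lfb U (S k i \<omega>) * d + etab / 2 * d\<^sup>2))"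
      by (rule sample_integral(1)[OF _ k i])
    have "x k \<in> borel_measurable W" using measurable_from_subalg[OF sub_past x_measurable[OF k]] .
    then have "(\<lambda>\<omega>. (x k \<omega>, S k i \<omega>)) \<in> measurable W (borel \<Otimes>\<^sub>M P)"
      using iid_samplesD(1)[OF W.prob_space_axioms iid k i] by (intro measurable_Pair) auto
    from measurable_compose[OF this G]
    show "(\<lambda>\<omega>. G (x k \<omega>) (S k i \<omega>)) \<in> borel_measurable W" by simp
    show "AE \<omega> in W. norm (G (x k \<omega>) (S k i \<omega>))
        \<le> norm (\<bar>G u0 (S k i \<omega>)\<bar> + (Lfb U (S k i \<omega>) * d + etab / 2 * d\<^sup>2))"
      using sample_AE[OF Gbound k]
    proof eventually_elim
      case (elim \<omega>)
      then have "\<bar>G (x k \<omega>) (S k i \<omega>)\<bar> \<le> \<bar>G u0 (S k i \<omega>)\<bar> + (Lfb U (S k i \<omega>) * d + etab / 2 * d\<^sup>2)"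
        using i by blast
      then show ?case by simp
    qed
  qed
  have intG: "integrable W (\<lambda>\<omega>. (\<Sum>i=1..m. G (x k \<omega>) (T \<omega> i)) / real m)"
    using intGs by (intro integrable_divide_zero Bochner_Integration.integrable_sum) (simp add: Tk)
  have intFF: "integrable W (\<lambda>\<omega>. FF (x k \<omega>))"
  proof (rule W.integrable_const_bound)
    show "(\<lambda>\<omega>. FF (x k \<omega>)) \<in> borel_measurable W"
      using measurable_compose[OF measurable_from_subalg[OF sub_past x_measurable[OF k]] FF] .
    have int1: "integrable P (\<lambda>s. \<bar>G u0 s\<bar> + (Lfb U s * d + etab / 2 * d\<^sup>2))"
      using model_loss_integrable[of u0] Lfb_facts(7) by (auto simp: G_def)
    have "\<bar>FF y\<bar> \<le> (\<integral>s. \<bar>G u0 s\<bar> + (Lfb U s * d + etab / 2 * d\<^sup>2) \<partial>P)" for y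
    proof -
      have "\<bar>FF y\<bar> \<le> (\<integral>s. \<bar>G y s\<bar> \<partial>P)" unfolding FF_def by (rule integral_abs_bound)
      also have "\<dots> \<le> (\<integral>s. \<bar>G u0 s\<bar> + (Lfb U s * d + etab / 2 * d\<^sup>2) \<partial>P)"
      proof (rule integral_mono_AE)
        show "integrable P (\<lambda>s. \<bar>G y s\<bar>)" using model_loss_integrable[of y] by (simp add: G_def)
        show "AE s in P. \<bar>G y s\<bar> \<le> \<bar>G u0 s\<bar> + (Lfb U s * d + etab / 2 * d\<^sup>2)"
          using Gbound by eventually_elim blast
      qed (rule int1)
      finally show ?thesis .
    qed
    then show "AE \<omega> in W. norm (FF (x k \<omega>)) \<le> (\<integral>s. \<bar>G u0 s\<bar> + (Lfb U s * d + etab / 2 * d\<^sup>2) \<partial>P)"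
      by simp
  qed
  show int: "integrable W (noise a q k)"
    unfolding noise h_def using intZ intq intG intFF by auto
  have cond: "AE \<omega> in W. real_cond_exp W (past (k - 1)) (\<lambda>\<omega>. h \<omega> (T \<omega>)) \<omega> = (\<integral>\<omega>'. h \<omega> (T \<omega>') \<partial>W)"
    by (rule W.cond_exp_independent_argument[where h = h and T = T, OF sub_past Tind(1) _ meas_h int[unfolded noise]])
       (rule Tind(2))
  have Eh: "(\<integral>\<omega>'. h \<omega> (T \<omega>') \<partial>W) = a\<^sup>2 * (\<integral>\<omega>'. Z (T \<omega>') \<partial>W)" for \<omega>
  proof -
    have "(\<integral>\<omega>'. h \<omega> (T \<omega>') \<partial>W) = a\<^sup>2 * (\<integral>\<omega>'. Z (T \<omega>') \<partial>W)
      + 2 * a * (((\<integral>\<omega>'. (\<Sum>i=1..m. real_of_ereal (f q (T \<omega>' i))) / real m \<partial>W) - F q)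
         - ((\<integral>\<omega>'. (\<Sum>i=1..m. G (x k \<omega>) (T \<omega>' i)) / real m \<partial>W) - FF (x k \<omega>)))"
      unfolding h_def using intZ intq intG1[of "x k \<omega>"]
      by (simp add: W.prob_space del: Bochner_Integration.integral_divide_zero)
    then show ?thesis unfolding Eq EG1 by simp
  qed
  show "AE \<omega> in W. real_cond_exp W (past (k - 1)) (noise a q k) \<omega>
      \<le> a\<^sup>2 * (rho_const P m (\<lambda>s. L_inf * Lfb U s) * (L_inf * LFb U)\<^sup>2)"
    unfolding noise using cond by eventually_elim (simp add: Eh mult_left_mono[OF EZ])
qed

section \<open>The complexity bound\<close>

text \<open>The distance at iteration \<open>k\<close> is measured in the norm of \<open>M (k - 1)\<close>, the preconditioner already
known before the samples of iteration \<open>k\<close> are drawn.\<close>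

definition expected_sqdist :: "(nat \<Rightarrow> 'a) \<Rightarrow> nat \<Rightarrow> real" where
  "expected_sqdist q k = (\<integral>\<omega>. sqdist (M (k - 1) \<omega>) q (x k \<omega>) \<partial>W)"

lemma iterates_bounded: "\<exists>C. AE \<omega> in W. \<forall>k\<ge>1. norm (x k \<omega>) \<le> C"
proof -
  obtain C where C: "\<forall>y\<in>U. norm y \<le> C" using U(1) by (auto simp: bounded_iff)
  have "AE \<omega> in W. \<forall>k\<ge>1. norm (x k \<omega>) \<le> C"
    using in_U by eventually_elim (use C in blast)
  then show ?thesis by blast
qed

lemma sqdist_iterate_integrable:
  assumes k: "1 \<le> k"
  shows "integrable W (\<lambda>\<omega>. sqdist (M (k - 1) \<omega>) q (x k \<omega>))"
proof -
  obtain C where C: "AE \<omega> in W. \<forall>k\<ge>1. norm (x k \<omega>) \<le> C" using iterates_bounded by blast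
  show ?thesis
  proof (rule W.integrable_const_bound)
    show "AE \<omega> in W. norm (sqdist (M (k - 1) \<omega>) q (x k \<omega>)) \<le> ((C + norm (q 0)) / mu_inf)\<^sup>2"
      using C M_good[of "k - 1"]
    proof eventually_elim
      case (elim \<omega>)
      have pd: "pos_def_map (M (k - 1) \<omega>)" using elim by blast
      have "mu_inf * normM (M (k - 1) \<omega>) (x k \<omega> - q 0) \<le> norm (x k \<omega> - q 0)" using elim by blast
      also have "\<dots> \<le> C + norm (q 0)" using elim k norm_triangle_ineq4[of "x k \<omega>" "q 0"] by force
      finally have "normM (M (k - 1) \<omega>) (x k \<omega> - q 0) \<le> (C + norm (q 0)) / mu_inf"
        using constants by (simp add: pos_le_divide_eq mult.commute)
      then have "(normM (M (k - 1) \<omega>) (x k \<omega> - q 0))\<^sup>2 \<le> ((C + norm (q 0)) / mu_inf)\<^sup>2"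
        using normM_nonneg[OF pd] by (intro power_mono) auto
      then have "sqdist (M (k - 1) \<omega>) q (x k \<omega>) \<le> ((C + norm (q 0)) / mu_inf)\<^sup>2"
        unfolding sqnorm_eq[OF pd, symmetric] by (rule order_trans[OF sqdist_le])
      then show ?case using sqdist_nonneg[of "M (k - 1) \<omega>" q "x k \<omega>"] by simp
    qed
    show "(\<lambda>\<omega>. sqdist (M (k - 1) \<omega>) q (x k \<omega>)) \<in> borel_measurable W"
      by (rule measurable_from_subalg[OF sub_past borel_measurable_sqdist[OF M_measurable x_measurable[OF k]]])
  qed
qed

text \<open>Condition on the past for each point of the sequence separately, take the infimum over the
sequence, and integrate.\<close>

lemma expected_sqdist_step:
  assumes k: "1 \<le> k" and a: "alpha k = a" "0 < a" "tau * a < 1" and \<theta>: "0 < \<theta>"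
    and q: "range q \<subseteq> Xstar" "Xstar \<subseteq> closure (range q)"
    and pos: "0 < (\<integral>s. (L_inf * Lfb U s)\<^sup>2 \<partial>P)"
  defines "c1 \<equiv> mu_inf\<^sup>2 * c1b" and "eta \<equiv> L_inf\<^sup>2 * etab"
    and "p \<equiv> rho_const P m (\<lambda>s. L_inf * Lfb U s) * (L_inf * LFb U)\<^sup>2"
  shows "expected_sqdist q (Suc k)
    \<le> (1 + \<theta>) / (1 + (2 * c1 - tau) * a)
        * ((1 + eta * a) * ((rho k)\<^sup>2 * expected_sqdist q k) + a\<^sup>2 * p)
      + (1 + 1 / \<theta>) * (eps k)\<^sup>2"
proof -
  let ?F = "past (k - 1)"
  interpret finite_measure_subalgebra W ?F by unfold_locales (rule sub_past)
  define B where "B = (1 + \<theta>) / (1 + (2 * c1 - tau) * a)"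
  define c where "c = (1 + 1 / \<theta>) * (eps k)\<^sup>2"
  define D where "D = (\<lambda>j \<omega>. sqdist (M (j - 1) \<omega>) q (x j \<omega>))"
  have eta0: "0 \<le> eta" unfolding eta_def using etab_nonneg by simp
  then have eta1: "0 < 1 + eta * a" using a(2) by (simp add: add_pos_nonneg)
  have "0 < 2 * c1 * a" unfolding c1_def using constants a(2) by simp
  then have B: "0 < B" unfolding B_def using a(3) \<theta> by (simp add: algebra_simps)
  have rho: "1 \<le> rho k" using precond k by (simp add: preconditioner_condition_def)
  have intD: "integrable W (D j)" if "1 \<le> j" for j
    unfolding D_def by (rule sqdist_iterate_integrable[OF that])
  obtain C where C: "AE \<omega> in W. \<forall>k\<ge>1. norm (x k \<omega>) \<le> C" using iterates_bounded by blast
  have cond: "AE \<omega> in W. real_cond_exp W ?F (D (Suc k)) \<omega>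
      \<le> B * ((1 + eta * a) * ((rho k)\<^sup>2 * sqnorm (M (k - 1) \<omega>) (x k \<omega> - q n)) + a\<^sup>2 * p) + c" for n
  proof -
    have qn: "q n \<in> Xstar" using q by auto
    define sq where "sq = (\<lambda>\<omega>. sqnorm (M k \<omega>) (q n - x k \<omega>))"
    have ratio: "AE \<omega> in W. real_cond_exp W ?F (\<lambda>\<omega>. (normM (M k \<omega>) v)\<^sup>2 / (normM (M (k - 1) \<omega>) v)\<^sup>2) \<omega> \<le> (rho k)\<^sup>2"
      if "v \<noteq> 0" for v
      using precond k that unfolding preconditioner_condition_def by (auto elim: AE_mp)
    have bnd: "AE \<omega> in W. norm (q n - x k \<omega>) \<le> norm (q n) + C"
      using C
    proof eventually_elim
      case (elim \<omega>)
      then have "norm (x k \<omega>) \<le> C" using k by blast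
      then show ?case using norm_triangle_ineq4[of "q n" "x k \<omega>"] by linarith
    qed
    have vm: "(\<lambda>\<omega>. q n - x k \<omega>) \<in> borel_measurable ?F" using x_measurable[OF k] by measurable
    have pd: "AE \<omega> in W. pos_def_map (M j \<omega>)" for j using M_good[of j] by eventually_elim blast
    have lo: "AE \<omega> in W. \<forall>v. mu_inf * normM (M k \<omega>) v \<le> norm v" using M_good[of k] by eventually_elim blast
    have change: "integrable W sq"
      "AE \<omega> in W. real_cond_exp W ?F sq \<omega> \<le> (rho k)\<^sup>2 * sqnorm (M (k - 1) \<omega>) (q n - x k \<omega>)"
      unfolding sq_def
      using cond_exp_preconditioner_change[where M = "M k" and M' = "M (k - 1)",
        OF W.prob_space_axioms sub_past measurable_from_subalg[OF sub_past M_measurable]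
          M_measurable pd pd constants(1) lo ratio vm bnd] by auto
    note nz = noise_conditional_bound[OF k less_imp_le[OF a(2)] qn pos, folded p_def]
    have int1: "integrable W (\<lambda>\<omega>. B * (1 + eta * a) * sq \<omega>)" "integrable W (\<lambda>\<omega>. B * noise a (q n) k \<omega>)"
      using change(1) nz(1) by auto
    have "AE \<omega> in W. D (Suc k) \<omega> \<le> (B * (1 + eta * a) * sq \<omega> + B * noise a (q n) k \<omega>) + c"
      using step_inequality[OF k a \<theta> q, of n, folded c1_def eta_def, folded B_def c_def]
      by eventually_elim (simp add: D_def sq_def algebra_simps)
    then have "AE \<omega> in W. real_cond_exp W ?F (D (Suc k)) \<omega>
        \<le> real_cond_exp W ?F (\<lambda>\<omega>. (B * (1 + eta * a) * sq \<omega> + B * noise a (q n) k \<omega>) + c) \<omega>"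
      using intD[of "Suc k"] int1 by (intro real_cond_exp_mono) auto
    moreover have "AE \<omega> in W. real_cond_exp W ?F (\<lambda>\<omega>. (B * (1 + eta * a) * sq \<omega> + B * noise a (q n) k \<omega>) + c) \<omega>
       = real_cond_exp W ?F (\<lambda>\<omega>. B * (1 + eta * a) * sq \<omega> + B * noise a (q n) k \<omega>) \<omega> + real_cond_exp W ?F (\<lambda>_. c) \<omega>"
      using int1 by (intro real_cond_exp_add) auto
    moreover have "AE \<omega> in W. real_cond_exp W ?F (\<lambda>\<omega>. B * (1 + eta * a) * sq \<omega> + B * noise a (q n) k \<omega>) \<omega>
       = real_cond_exp W ?F (\<lambda>\<omega>. B * (1 + eta * a) * sq \<omega>) \<omega> + real_cond_exp W ?F (\<lambda>\<omega>. B * noise a (q n) k \<omega>) \<omega>"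
      using int1 by (intro real_cond_exp_add)
    moreover have "AE \<omega> in W. real_cond_exp W ?F (\<lambda>_. c) \<omega> = c" by (intro real_cond_exp_F_meas) auto
    moreover have "AE \<omega> in W. real_cond_exp W ?F (\<lambda>\<omega>. B * (1 + eta * a) * sq \<omega>) \<omega> = B * (1 + eta * a) * real_cond_exp W ?F sq \<omega>"
      by (rule real_cond_exp_cmult[OF change(1)])
    moreover have "AE \<omega> in W. real_cond_exp W ?F (\<lambda>\<omega>. B * noise a (q n) k \<omega>) \<omega> = B * real_cond_exp W ?F (noise a (q n) k) \<omega>"
      by (rule real_cond_exp_cmult[OF nz(1)])
    moreover note change(2) nz(2)
    ultimately show ?thesis
    proof eventually_elim
      case (elim \<omega>)
      have "real_cond_exp W ?F (D (Suc k)) \<omega>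
          \<le> B * (1 + eta * a) * real_cond_exp W ?F sq \<omega> + B * real_cond_exp W ?F (noise a (q n) k) \<omega> + c"
        using elim(1-6) by simp
      also have "\<dots> \<le> B * (1 + eta * a) * ((rho k)\<^sup>2 * sqnorm (M (k - 1) \<omega>) (q n - x k \<omega>)) + B * (a\<^sup>2 * p) + c"
        using elim(7,8) B eta1 by (intro add_mono mult_left_mono) auto
      finally show ?case by (simp add: sqnorm_minus_commute[of _ "q n"] algebra_simps)
    qed
  qed
  have "AE \<omega> in W. \<forall>n. real_cond_exp W ?F (D (Suc k)) \<omega>
      \<le> B * ((1 + eta * a) * ((rho k)\<^sup>2 * sqnorm (M (k - 1) \<omega>) (x k \<omega> - q n)) + a\<^sup>2 * p) + c"
    using cond by (simp add: AE_all_countable)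
  then have "AE \<omega> in W. real_cond_exp W ?F (D (Suc k)) \<omega>
      \<le> B * ((1 + eta * a) * ((rho k)\<^sup>2 * D k \<omega>) + a\<^sup>2 * p) + c"
  proof eventually_elim
    case (elim \<omega>)
    define K where "K = B * (1 + eta * a) * (rho k)\<^sup>2"
    have K: "0 < K" unfolding K_def using B eta1 rho by simp
    have "(real_cond_exp W ?F (D (Suc k)) \<omega> - (B * (a\<^sup>2 * p) + c)) / K \<le> D k \<omega>"
      unfolding D_def
    proof (rule sqdist_greatest)
      fix n
      have "real_cond_exp W ?F (D (Suc k)) \<omega> - (B * (a\<^sup>2 * p) + c) \<le> K * sqnorm (M (k - 1) \<omega>) (x k \<omega> - q n)"
        using elim[rule_format, of n] unfolding K_def by (simp add: algebra_simps)
      then show "(real_cond_exp W ?F (\<lambda>\<omega>. sqdist (M (Suc k - 1) \<omega>) q (x (Suc k) \<omega>)) \<omega> - (B * (a\<^sup>2 * p) + c)) / K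
          \<le> sqnorm (M (k - 1) \<omega>) (x k \<omega> - q n)"
        using K unfolding D_def by (simp add: pos_divide_le_eq mult.commute)
    qed
    then have "real_cond_exp W ?F (D (Suc k)) \<omega> - (B * (a\<^sup>2 * p) + c) \<le> K * D k \<omega>"
      using K by (simp add: pos_divide_le_eq mult.commute)
    then show ?case unfolding K_def by (simp add: algebra_simps)
  qed
  then have "(\<integral>\<omega>. real_cond_exp W ?F (D (Suc k)) \<omega> \<partial>W)
      \<le> (\<integral>\<omega>. B * ((1 + eta * a) * ((rho k)\<^sup>2 * D k \<omega>) + a\<^sup>2 * p) + c \<partial>W)"
    using intD[OF k] intD[of "Suc k"] by (intro integral_mono_AE real_cond_exp_int(1)) auto
  also have "\<dots> = B * ((1 + eta * a) * ((rho k)\<^sup>2 * expected_sqdist q k) + a\<^sup>2 * p) + c"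
    using intD[OF k] by (simp add: W.prob_space expected_sqdist_def D_def)
  also have "(\<integral>\<omega>. real_cond_exp W ?F (D (Suc k)) \<omega> \<partial>W) = expected_sqdist q (Suc k)"
    using real_cond_exp_int(2)[OF intD[of "Suc k"]] by (simp add: expected_sqdist_def D_def)
  finally show ?thesis unfolding B_def c_def .
qed

lemma expected_sqdist_initial:
  assumes q: "Xstar \<subseteq> closure (range q)"
  shows "expected_sqdist q 1 \<le> (infdist x1 Xstar)\<^sup>2"
proof -
  have "expected_sqdist q 1 = (\<integral>\<omega>. sqdist (\<lambda>v. v) q x1 \<partial>W)"
    unfolding expected_sqdist_def
    by (intro Bochner_Integration.integral_cong) (use algorithm in \<open>auto simp: M_0 ispPPA_def\<close>)
  also have "\<dots> = sqdist (\<lambda>v. v) q x1" by (simp add: W.prob_space)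
  also have "\<dots> \<le> (infdist x1 Xstar)\<^sup>2"
    using sqdist_le_infdist[OF pos_def_map_id, of 1 Xstar q x1] q Xstar_nonempty by (simp add: normM_id)
  finally show ?thesis .
qed

lemma expected_infdist_le:
  assumes k: "1 \<le> k" and q: "range q \<subseteq> Xstar"
  shows "(\<integral>\<omega>. (infdist (x k \<omega>) Xstar)\<^sup>2 \<partial>W) \<le> L_inf\<^sup>2 * expected_sqdist q k"
proof -
  have le: "AE \<omega> in W. (infdist (x k \<omega>) Xstar)\<^sup>2 \<le> L_inf\<^sup>2 * sqdist (M (k - 1) \<omega>) q (x k \<omega>)"
    using M_good[of "k - 1"]
  proof eventually_elim
    case (elim \<omega>)
    then show ?case using constants q by (intro infdist_le_sqdist) auto
  qed
  have intR: "integrable W (\<lambda>\<omega>. L_inf\<^sup>2 * sqdist (M (k - 1) \<omega>) q (x k \<omega>))"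
    using sqdist_iterate_integrable[OF k] by auto
  have "(\<integral>\<omega>. (infdist (x k \<omega>) Xstar)\<^sup>2 \<partial>W) \<le> (\<integral>\<omega>. L_inf\<^sup>2 * sqdist (M (k - 1) \<omega>) q (x k \<omega>) \<partial>W)"
    using le by (intro integral_mono_AE' intR) (auto intro!: AE_I2 mult_nonneg_nonneg sqdist_nonneg)
  then show ?thesis by (simp add: expected_sqdist_def)
qed

end

theorem theorem2p12:
  fixes P :: "'s measure" and W :: "'w measure"
    and f :: "'a::euclidean_space \<Rightarrow> 's \<Rightarrow> ereal" and r :: "'a \<Rightarrow> ereal"
    and V U :: "'a set" and fm :: "'a \<Rightarrow> 'a \<Rightarrow> 's \<Rightarrow> real"
    and Lfb :: "'a set \<Rightarrow> 's \<Rightarrow> real" and LFb :: "'a set \<Rightarrow> real"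
    and m :: nat and alpha eps :: "nat \<Rightarrow> real"
    and S :: "nat \<Rightarrow> nat \<Rightarrow> 'w \<Rightarrow> 's" and M :: "nat \<Rightarrow> 'w \<Rightarrow> 'a \<Rightarrow> 'a"
    and x1 :: 'a and x :: "nat \<Rightarrow> 'w \<Rightarrow> 'a"
    and mu L rho :: "nat \<Rightarrow> real" and mu_inf L_inf nu_inf :: real
    and etab taub c1b eta tau c1 :: real
    and gam rhob alpha0 c_te c1t delta1 s :: real
    and Lf :: "'s \<Rightarrow> real" and LF :: real and Xstar :: "'a set"
  assumes "prob_space P" and "prob_space W"
    and "model_functions P r V fm"
    and "model_accuracy P f V fm etab"
    and "preconditioner_condition W P m S M mu L rho mu_inf L_inf nu_inf"
    and "regularity P f r V fm taub"
    and "local_lipschitz_condition P V fm Lfb LFb"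
    and "quadratic_growth (objective P f r) c1b"
    and "Xstar = argmin_set (objective P f r)" and "Xstar \<noteq> {}"
    and "eta = L_inf\<^sup>2 * etab" and "tau = L_inf\<^sup>2 * taub" and "c1 = mu_inf\<^sup>2 * c1b"
    and "ispPPA W P fm r m tau alpha eps S M x1 x"
    and "0 \<le> gam" and "eta + tau < rhob"
    and "0 < alpha0" and "alpha0 < 1 / rhob"
    and "\<forall>k\<ge>1. alpha k = alpha0 \<and> eps k = gam * alpha0 powr (3/2)"
    and "c_te = c1 - (tau + eta) / 2"
    and "c1t = rhob * c_te / (rhob + eta)"
    and "delta1 = (infdist x1 Xstar)\<^sup>2"
    and "0 < s" and "s < 2"
    and "(tau + eta) / 2 < c1"
    \<comment> \<open>the boundedness event, and the set \<open>U\<close> containing the iterates and exact proximal points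
       on that event\<close>
    and "AE \<omega> in W. bounded ((\<lambda>k. x k \<omega>) ` {1..})"
    and "bounded U" and "open U" and "convex U" and "U \<subseteq> V"
    and "AE \<omega> in W. bounded ((\<lambda>k. x k \<omega>) ` {1..}) \<longrightarrow>
           (\<forall>k\<ge>1. x k \<omega> \<in> U \<and> exact_step fm r m alpha S M x k \<omega> \<in> U)"
    and "Lf = (\<lambda>s. L_inf * Lfb U s)" and "LF = L_inf * LFb U"
    and "0 < prob_space.expectation P (\<lambda>s. (Lf s)\<^sup>2)"
  shows "\<forall>k\<ge>1.
    prob_space.expectation W (\<lambda>\<omega>. (infdist (x k \<omega>) Xstar)\<^sup>2) \<le>
      (nu_inf * L_inf)\<^sup>2 *
        ((1 / (1 + s * c1t * alpha0)) ^ (k - 1) * delta1 +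
         C_tilde (rho_const P m Lf) LF c1 tau eta s gam alpha0 / (s * c1t) * alpha0)"
proof -
  note constants_def = \<open>eta = _\<close> \<open>tau = _\<close> \<open>c1 = _\<close>
  have in_U: "AE \<omega> in W. \<forall>k\<ge>1. x k \<omega> \<in> U \<and> exact_step fm r m alpha S M x k \<omega> \<in> U"
    using \<open>AE \<omega> in W. bounded ((\<lambda>k. x k \<omega>) ` {1..})\<close>
      \<open>AE \<omega> in W. bounded ((\<lambda>k. x k \<omega>) ` {1..}) \<longrightarrow>
           (\<forall>k\<ge>1. x k \<omega> \<in> U \<and> exact_step fm r m alpha S M x k \<omega> \<in> U)\<close>
    by eventually_elim blast
  interpret bounded_ispPPA P W f r V U fm Lfb LFb m alpha eps S M x1 x mu L rho mu_inf L_inf nu_inf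
      etab taub tau c1b Xstar
    using assms in_U
    by (intro bounded_ispPPA.intro bounded_ispPPA_axioms.intro) simp_all
  obtain q :: "nat \<Rightarrow> 'a" where q: "range q \<subseteq> Xstar" "Xstar \<subseteq> closure (range q)"
    using dense_sequence by blast
  have eta0: "0 \<le> eta" unfolding constants_def using etab_nonneg by simp
  have tau0: "0 \<le> tau" unfolding constants_def using constants by simp
  have rhob: "0 < rhob" "tau < rhob" using eta0 tau0 \<open>eta + tau < rhob\<close> by auto
  have "tau * alpha0 \<le> rhob * alpha0" using rhob \<open>0 < alpha0\<close> by (intro mult_right_mono) auto
  also have "rhob * alpha0 < 1" using rhob \<open>alpha0 < 1 / rhob\<close> by (simp add: field_simps)
  finally have ta: "tau * alpha0 < 1" .
  have eps2: "(eps k)\<^sup>2 = gam\<^sup>2 * alpha0 ^ 3" if "1 \<le> k" for k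
  proof -
    have "(alpha0 powr (3/2))\<^sup>2 = alpha0 powr 3"
      using \<open>0 < alpha0\<close> by (simp add: power2_eq_square flip: powr_add)
    also have "\<dots> = alpha0 ^ 3" using \<open>0 < alpha0\<close> by (simp add: powr_numeral)
    finally show ?thesis
      using \<open>\<forall>k\<ge>1. alpha k = alpha0 \<and> eps k = gam * alpha0 powr (3/2)\<close> that
      by (simp add: power_mult_distrib)
  qed
  define p where "p = rho_const P m Lf * LF\<^sup>2"
  have p0: "0 \<le> p" by (simp add: p_def rho_const_def)
  define a where "a = (c1 - (tau + eta) / 2) * alpha0 / (1 + eta * alpha0)"
  define \<theta> where "\<theta> = (2 - s) * a / (1 + s * a)"
  define C where "C = C_tilde (rho_const P m Lf) LF c1 tau eta s gam alpha0"
  have c1t: "c1t = rhob * (c1 - (tau + eta) / 2) / (rhob + eta)"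
    using \<open>c1t = _\<close> \<open>c_te = _\<close> by simp
  have C: "C = p + ((1 + (2 * c1 - tau) * alpha0) * (2 * (1 + eta * alpha0) + s * (2 * c1 - tau - eta) * alpha0)) /
       ((2 - s) * (2 * c1 - tau - eta) * (1 + eta * alpha0)) * gam\<^sup>2"
    by (simp add: C_def C_tilde_def p_def)
  note step_const = step_constants[OF \<open>0 < alpha0\<close> \<open>alpha0 < 1 / rhob\<close> eta0 rhob(1)
      \<open>(tau + eta) / 2 < c1\<close> \<open>0 < s\<close> \<open>s < 2\<close> p0]
  have \<theta>: "0 < \<theta>" unfolding \<theta>_def a_def by (rule step_const(1)[OF order_refl])
  have C0: "0 \<le> C" unfolding C by (rule step_const(2)[OF order_refl])
  have c1t0: "0 < c1t" unfolding c1t by (rule step_const(3)[OF order_refl])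
  have nonneg: "0 \<le> expected_sqdist q k" for k
    unfolding expected_sqdist_def by (intro Bochner_Integration.integral_nonneg sqdist_nonneg)
  define b where "b = s * c1t * alpha0"
  have b0: "0 < b" unfolding b_def using \<open>0 < s\<close> c1t0 \<open>0 < alpha0\<close> by simp
  have rec: "expected_sqdist q (Suc k) \<le> 1 / (1 + b) * ((rho k)\<^sup>2 * expected_sqdist q k + alpha0\<^sup>2 * C)"
    if k: "1 \<le> k" for k
  proof -
    have "alpha k = alpha0"
      using \<open>\<forall>k\<ge>1. alpha k = alpha0 \<and> eps k = gam * alpha0 powr (3/2)\<close> k by blast
    from expected_sqdist_step[OF k this \<open>0 < alpha0\<close> ta \<theta> q]
    have "expected_sqdist q (Suc k)
      \<le> (1 + \<theta>) / (1 + (2 * c1 - tau) * alpha0)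
          * ((1 + eta * alpha0) * ((rho k)\<^sup>2 * expected_sqdist q k) + alpha0\<^sup>2 * p)
        + (1 + 1 / \<theta>) * (gam\<^sup>2 * alpha0 ^ 3)"
      using \<open>0 < prob_space.expectation P (\<lambda>s. (Lf s)\<^sup>2)\<close>
      unfolding p_def \<open>Lf = _\<close> \<open>LF = _\<close> constants_def eps2[OF k] by simp
    also have "\<dots> \<le> 1 / (1 + b) * ((rho k)\<^sup>2 * expected_sqdist q k + alpha0\<^sup>2 * C)"
      unfolding b_def \<theta>_def a_def C c1t by (rule step_const(4)) (simp add: nonneg)
    finally show ?thesis .
  qed
  show ?thesis
  proof (intro allI impI)
    fix k :: nat assume k: "1 \<le> k"
    have "expected_sqdist q k \<le> nu_inf\<^sup>2 * ((1 / (1 + b)) ^ (k - 1) * delta1 + alpha0\<^sup>2 * C / b)"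
    proof (rule discounted_recursion_bound)
      show "expected_sqdist q 1 \<le> delta1"
        using expected_sqdist_initial[OF q(2)] \<open>delta1 = _\<close> by simp
      show "0 \<le> delta1" "0 \<le> alpha0\<^sup>2 * C" using \<open>delta1 = _\<close> C0 by simp_all
      show "rho 0 = 1" "\<And>k. 1 \<le> k \<Longrightarrow> 1 \<le> rho k" "(\<lambda>k. \<Prod>i<k. rho i) \<longlonglongrightarrow> nu_inf"
        using precond by (auto simp: preconditioner_condition_def)
    qed (use b0 rec k in auto)
    also have "alpha0\<^sup>2 * C / b = C / (s * c1t) * alpha0"
      unfolding b_def using \<open>0 < alpha0\<close> by (simp add: power2_eq_square)
    finally have "L_inf\<^sup>2 * expected_sqdist q k
       \<le> L_inf\<^sup>2 * (nu_inf\<^sup>2 * ((1 / (1 + b)) ^ (k - 1) * delta1 + C / (s * c1t) * alpha0))"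
      by (rule mult_left_mono) simp
    then show "prob_space.expectation W (\<lambda>\<omega>. (infdist (x k \<omega>) Xstar)\<^sup>2) \<le>
      (nu_inf * L_inf)\<^sup>2 *
        ((1 / (1 + s * c1t * alpha0)) ^ (k - 1) * delta1 +
         C_tilde (rho_const P m Lf) LF c1 tau eta s gam alpha0 / (s * c1t) * alpha0)"
      using expected_infdist_le[OF k q(1)] unfolding C_def[symmetric] b_def[symmetric]
      by (simp add: power_mult_distrib mult_ac)
  qed
qed

end
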